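(* Under the standing setup, consider the positive Hermitian compact operators $C_m M_m^{-1} C_m$ (for $m\in\mathbb N^\star$) and $C M^{-1} C$ on $L^2([-2L,2L]^d,\mathbb C)$. Then: (i) $$\lim_{m\to\infty}\sum_{\lambda\in \sigma(C_mM_m^{-1}C_m)} \frac{\lambda}{1+\lambda} = \sum_{\lambda\in \sigma(CM^{-1}C)} \frac{\lambda}{1+\lambda}$$ (both sums being finite; the summand $\frac{\lambda}{1+\lambda}$ equals $\frac{1}{1+\lambda^{-1}}$ for $\lambda>0$ and is $0$ for $\lambda=0$); (ii) for every $k\in\mathbb N^\star$, $\lim_{m\to\infty}\sigma^\downarrow_k(C_mM_m^{-1}C_m) = \sigma^\downarrow_k(CM^{-1}C)$.
   Context: Standing setup. Let $d\in\mathbb N^\star$, $L>0$, and let $\Omega\subseteq[-L,L]^d$ be a measurable set. Let $s\in\mathbb N$ with $s>d/2$, let $\lambda_n>0$ and $\mu_n\geq 0$, and let $\mathscr D=\sum_{|\alpha|\le s}a_\alpha\partial^\alpha$ be a linear differential operator with constant real coefficients $a_\alpha$. Equip $L^2([-2L,2L]^d,\mathbb C)$ with $\langle f,g\rangle=\int_{[-2L,2L]^d}f\bar g$ and norm $\|\cdot\|_2$. For $k\in\mathbb Z^d$ let $\phi_k(x)=(4L)^{-d/2}e^{\frac{i\pi}{2L}\langle k,x\rangle}$ (an orthonormal basis). The periodic Sobolev space $H^s_{\mathrm{per}}=H^s_{\mathrm{per}}([-2L,2L]^d,\mathbb C)$ is the set of $f=\sum_k z_k\phi_k$ with $\sum_k|z_k|^2(1+\|k\|_2^{2s})<\infty$,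 normed by $\|f\|^2_{H^s_{\mathrm{per}}}=\sum_k|z_k|^2\big(1+(\|k\|_2^2/(2L)^d)^s\big)$; for such $f$, $\partial^\alpha f=\sum_k z_k\prod_\ell(\frac{i\pi k_\ell}{2L})^{\alpha_\ell}\phi_k$. Define the quadratic form $q(f)=\lambda_n\|f\|^2_{H^s_{\mathrm{per}}}+\mu_n\|\mathscr D(f)\|^2_{L^2(\Omega)}$ on $H^s_{\mathrm{per}}$, and let $M$ be the positive self-adjoint operator on $L^2([-2L,2L]^d,\mathbb C)$ associated with $q$ (so $\langle f,Mf\rangle=q(f)$). $M$ is invertible, and $M^{-1}$ is a positive Hermitian compact operator with $\sum_k\sigma^\downarrow_k(M^{-1})<\infty$. For $m\in\mathbb N^\star$, let $H_m=\mathrm{Span}\{\phi_k:\|k\|_\infty\le m\}$ and $\Pi_m$ the orthogonal projection of $L^2([-2L,2L]^d,\mathbb C)$ onto $H_m$. Let $M_m:H_m\to H_m$ be the unique Hermitian operator with $\langle f,M_mf\rangle=q(f)$ for all $f\in H_m$; it is positive definite, hence invertible on $H_m$. By abuse of notation, $M_m^{-1}$ denotes the operator $\Pi_m (M_m)^{-1}\Pi_m$ on $L^2([-2L,2L]^d,\mathbb C)$. Let $C$ be the operator $Cf=\mathbf 1_\Omega f$ and $C_m=\Pi_mC\Pi_m$. For a positive Hermitian compact operator $\mathscr O$, $\sigma^\downarrow_k(\mathscr O)$ denotes its $k$-th largest eigenvalue counted with multiplicity (set to $0$ if there are fewer than $k$ nonzero eigenvalues), and $\sigma(\mathscr O)$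 the multiset $(\sigma^\downarrow_k(\mathscr O))_{k\in\mathbb N^\star}$. *)

theory Defs
  imports "HOL-Analysis.Analysis"
begin

definition cube :: "real \<Rightarrow> (real^'d) set" where
  "cube r = {x. \<forall>l. \<bar>x$l\<bar> \<le> r}"

definition sqbox :: "real \<Rightarrow> (real^'d) set" where
  "sqbox L = cube (2*L)"

definition phi :: "real \<Rightarrow> int^'d \<Rightarrow> real^'d \<Rightarrow> complex" where
  "phi L k x = complex_of_real ((4*L) powr (- real CARD('d) / 2)) *
     exp (\<i> * complex_of_real (pi / (2*L) * (\<Sum>l\<in>UNIV. real_of_int (k$l) * x$l)))"

definition ip :: "real \<Rightarrow> (real^'d \<Rightarrow> complex) \<Rightarrow> (real^'d \<Rightarrow> complex) \<Rightarrow> complex" where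
  "ip L f g = (LINT x:sqbox L|lebesgue. f x * cnj (g x))"

definition L2 :: "real \<Rightarrow> (real^'d \<Rightarrow> complex) set" where
  "L2 L = {f. f \<in> borel_measurable lebesgue \<and>
              set_integrable lebesgue (sqbox L) (\<lambda>x. (cmod (f x))^2)}"

definition coef :: "real \<Rightarrow> (real^'d \<Rightarrow> complex) \<Rightarrow> int^'d \<Rightarrow> complex" where
  "coef L f k = ip L f (phi L k)"

definition sqnorm :: "int^'d \<Rightarrow> real" where
  "sqnorm k = (\<Sum>l\<in>UNIV. (real_of_int (k$l))^2)"

definition Hs :: "real \<Rightarrow> nat \<Rightarrow> (real^'d \<Rightarrow> complex) set" where
  "Hs L s = {f \<in> L2 L. (\<lambda>k::int^'d. (cmod (coef L f k))^2 * (1 + (sqnorm k)^s)) summable_on UNIV}"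

definition hs_inner :: "real \<Rightarrow> nat \<Rightarrow> (real^'d \<Rightarrow> complex) \<Rightarrow> (real^'d \<Rightarrow> complex) \<Rightarrow> complex" where
  "hs_inner L s f g = (\<Sum>\<^sub>\<infinity>k::int^'d. coef L f k * cnj (coef L g k) *
        complex_of_real (1 + (sqnorm k / (2*L)^CARD('d))^s))"

text \<open>Multi-indices alpha with |alpha| <= s, and the Fourier symbol of D = sum a_alpha d^alpha.\<close>
definition mindex :: "nat \<Rightarrow> ('d::finite \<Rightarrow> nat) set" where
  "mindex s = {\<alpha>. sum \<alpha> UNIV \<le> s}"

definition symb :: "real \<Rightarrow> nat \<Rightarrow> (('d::finite \<Rightarrow> nat) \<Rightarrow> real) \<Rightarrow> int^'d \<Rightarrow> complex" where
  "symb L s a k = (\<Sum>\<alpha>\<in>mindex s. complex_of_real (a \<alpha>) *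
      (\<Prod>l\<in>UNIV. (\<i> * complex_of_real (pi * real_of_int (k$l) / (2*L))) ^ (\<alpha> l)))"

definition Dop :: "real \<Rightarrow> nat \<Rightarrow> (('d::finite \<Rightarrow> nat) \<Rightarrow> real) \<Rightarrow> (real^'d \<Rightarrow> complex) \<Rightarrow> (real^'d \<Rightarrow> complex)" where
  "Dop L s a f = (SOME g. g \<in> L2 L \<and> (\<forall>k. coef L g k = symb L s a k * coef L f k))"

text \<open>Sesquilinear form associated with q (q f = qsesq ... f f).\<close>
definition qsesq :: "real \<Rightarrow> (real^'d::finite) set \<Rightarrow> nat \<Rightarrow> real \<Rightarrow> real \<Rightarrow> (('d \<Rightarrow> nat) \<Rightarrow> real)
     \<Rightarrow> (real^'d \<Rightarrow> complex) \<Rightarrow> (real^'d \<Rightarrow> complex) \<Rightarrow> complex" where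
  "qsesq L \<Omega> s lam mu a f g = complex_of_real lam * hs_inner L s f g +
      complex_of_real mu * (LINT x:\<Omega>|lebesgue. Dop L s a f x * cnj (Dop L s a g x))"

text \<open>M^{-1}: M f = g iff f in H^s and <g,h> = q(f,h) for all h in H^s.\<close>
definition Minv :: "real \<Rightarrow> (real^'d::finite) set \<Rightarrow> nat \<Rightarrow> real \<Rightarrow> real \<Rightarrow> (('d \<Rightarrow> nat) \<Rightarrow> real)
     \<Rightarrow> (real^'d \<Rightarrow> complex) \<Rightarrow> (real^'d \<Rightarrow> complex)" where
  "Minv L \<Omega> s lam mu a g = (SOME f. f \<in> Hs L s \<and> (\<forall>h\<in>Hs L s. qsesq L \<Omega> s lam mu a f h = ip L g h))"

definition Km :: "nat \<Rightarrow> (int^'d) set" where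
  "Km m = {k. \<forall>l. \<bar>k$l\<bar> \<le> int m}"

definition Hm :: "real \<Rightarrow> nat \<Rightarrow> (real^'d \<Rightarrow> complex) set" where
  "Hm L m = {f. \<exists>c. f = (\<lambda>x. \<Sum>k\<in>Km m. c k * phi L k x)}"

definition Proj :: "real \<Rightarrow> nat \<Rightarrow> (real^'d \<Rightarrow> complex) \<Rightarrow> (real^'d \<Rightarrow> complex)" where
  "Proj L m g = (\<lambda>x. \<Sum>k\<in>Km m. coef L g k * phi L k x)"

text \<open>M_m^{-1} in the abusive sense Pi_m (M_m)^{-1} Pi_m, where M_m is the Hermitian
  operator on H_m with <M_m f, h> = q(f,h) for f,h in H_m.\<close>
definition Mminv :: "real \<Rightarrow> (real^'d::finite) set \<Rightarrow> nat \<Rightarrow> real \<Rightarrow> real \<Rightarrow> (('d \<Rightarrow> nat) \<Rightarrow> real)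
     \<Rightarrow> nat \<Rightarrow> (real^'d \<Rightarrow> complex) \<Rightarrow> (real^'d \<Rightarrow> complex)" where
  "Mminv L \<Omega> s lam mu a m g = Proj L m (SOME f. f \<in> Hm L m \<and>
      (\<forall>h\<in>Hm L m. qsesq L \<Omega> s lam mu a f h = ip L (Proj L m g) h))"

definition Cop :: "(real^'d) set \<Rightarrow> (real^'d \<Rightarrow> complex) \<Rightarrow> (real^'d \<Rightarrow> complex)" where
  "Cop \<Omega> f = (\<lambda>x. indicator \<Omega> x * f x)"

definition Cm :: "real \<Rightarrow> (real^'d) set \<Rightarrow> nat \<Rightarrow> (real^'d \<Rightarrow> complex) \<Rightarrow> (real^'d \<Rightarrow> complex)" where
  "Cm L \<Omega> m = Proj L m \<circ> Cop \<Omega> \<circ> Proj L m"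

text \<open>k-th largest eigenvalue counted with multiplicity (0 if fewer than k positive ones):
  the supremum of r > 0 such that there are k orthonormal eigenvectors (equality a.e. on the
  box) with eigenvalues >= r.\<close>
definition sdown :: "real \<Rightarrow> ((real^'d \<Rightarrow> complex) \<Rightarrow> (real^'d \<Rightarrow> complex)) \<Rightarrow> nat \<Rightarrow> real" where
  "sdown L T k = Sup (insert 0 {r. 0 < r \<and> (\<exists>fs \<mu>s. length fs = k \<and>
      (\<forall>i<k. fs!i \<in> L2 L \<and> \<mu>s i \<ge> r \<and>
         (AE x in lebesgue. x \<in> sqbox L \<longrightarrow> T (fs!i) x = complex_of_real (\<mu>s i) * (fs!i) x)) \<and>
      (\<forall>i<k. \<forall>j<k. ip L (fs!i) (fs!j) = (if i = j then 1 else 0)))})"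

end

theory Submission
  imports Defs
begin

text \<open>
  Passing to Fourier coefficients identifies \<open>L\<^sup>2\<close> of the box with \<open>\<ell>\<^sup>2(\<int>\<^sup>d)\<close>. Substituting \<open>u = S b\<close>, where
  \<open>S\<close> is the compact multiplier by the inverse square root of the Sobolev weight, turns the form \<open>q\<close> into a
  bounded operator \<open>G \<ge> 1\<close>, so that \<open>M\<^sup>-\<^sup>1 = S G\<^sup>-\<^sup>1 S\<close> and \<open>M\<^sub>m\<^sup>-\<^sup>1 = S \<Pi>\<^sub>m G\<^sub>m\<^sup>-\<^sup>1 \<Pi>\<^sub>m S\<close> with \<open>G\<^sub>m \<rightarrow> G\<close>
  strongly. Since \<open>S\<close> is compact, strong convergence of \<open>C\<^sub>m\<close> and \<open>G\<^sub>m\<^sup>-\<^sup>1\<close> becomes norm convergence of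
  \<open>C\<^sub>m M\<^sub>m\<^sup>-\<^sup>1 C\<^sub>m\<close>. The min-max characterization of eigenvalues makes \<open>\<sigma>\<^sub>k\<close> 1-Lipschitz in the operator norm,
  which gives (ii); it also bounds \<open>\<sigma>\<^sub>k\<close> by a multiple of \<open>k\<^bsup>-2s/d\<^esup>\<close> uniformly in \<open>m\<close>, and \<open>2s/d > 1\<close> gives (i)
  by dominated convergence.
\<close>

subsection \<open>The Hilbert space of square-summable families\<close>

text \<open>\<open>M\<close> is unbounded, and \<open>Minv\<close> and \<open>Mminv\<close> are only
  chosen by \<open>SOME\<close> from variational equations. Absorbing \<open>lam\<close> into the
  weight makes the Sobolev part of \<open>q\<close> exactly the identity in the new coordinates, so
  every inverse that occurs has norm at most 1, uniformly in \<open>m\<close>. The bound survives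
  discretization because the Galerkin operator is extended by the identity outside
  \<open>Hm\<close>. \<open>C\<close> need not be compact and \<open>Cm\<close> is only known to
  converge strongly, so each strongly convergent factor must be paired with an \<open>S\<close>. On
  the right end of the product strong convergence says nothing about norms, and that factor is
  treated through its adjoint. \<open>sdown\<close> speaks of eigenvectors, which cannot be compared
  between different operators. Min-max replaces them by a condition on quadratic forms; it is proved
  by extracting eigenvectors one at a time, not from a full spectral theorem. The decay rate is a
  count: \<open>Km m\<close> holds \<open>(2*m+1)^d\<close> frequencies, and beyond it the square of
  \<open>S\<close> is of order \<open>(m+1)^(-2*s)\<close>.\<close>

typedef 'i ell2 = "{c :: 'i \<Rightarrow> complex. (\<lambda>k. (cmod (c k))\<^sup>2) summable_on UNIV}"
  morphisms nth2 Abs_ell2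
  by (rule exI[of _ "\<lambda>_. 0"]) simp

lemma nth2_summable: "(\<lambda>k. (cmod (nth2 x k))\<^sup>2) summable_on A"
  using nth2[of x] summable_on_subset_banach[of _ UNIV A] by auto

lemma nth2_Abs: "(\<lambda>k. (cmod (c k))\<^sup>2) summable_on UNIV \<Longrightarrow> nth2 (Abs_ell2 c) = c"
  by (simp add: Abs_ell2_inverse)

lemma ell2_eqI: "(\<And>k. nth2 x k = nth2 y k) \<Longrightarrow> x = y"
  by (metis ext nth2_inject)

lemma sq_summable_mult:
  assumes "\<And>k. cmod (m k) \<le> B" "(\<lambda>k. (cmod (c k))\<^sup>2) summable_on A"
  shows "(\<lambda>k. (cmod (m k * c k))\<^sup>2) summable_on A"
proof (rule summable_on_comparison_test)
  show "(\<lambda>k. B\<^sup>2 * (cmod (c k))\<^sup>2) summable_on A"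
    using assms(2) by (rule summable_on_cmult_right)
  show "(cmod (m k * c k))\<^sup>2 \<le> B\<^sup>2 * (cmod (c k))\<^sup>2" for k
    using assms(1)[of k] by (auto simp: norm_mult power_mult_distrib intro!: mult_right_mono power_mono)
qed auto

lemma sq_summable_add:
  assumes "(\<lambda>k. (cmod (c k))\<^sup>2) summable_on A" "(\<lambda>k. (cmod (d k))\<^sup>2) summable_on A"
  shows "(\<lambda>k. (cmod (c k + d k))\<^sup>2) summable_on A"
proof (rule summable_on_comparison_test)
  show "(\<lambda>k. 2 * (cmod (c k))\<^sup>2 + 2 * (cmod (d k))\<^sup>2) summable_on A"
    using assms by (intro summable_on_add summable_on_cmult_right)
  fix k
  have "(cmod (c k + d k))\<^sup>2 \<le> (cmod (c k) + cmod (d k))\<^sup>2"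
    by (intro power_mono norm_triangle_ineq) auto
  also have "\<dots> \<le> 2 * (cmod (c k))\<^sup>2 + 2 * (cmod (d k))\<^sup>2"
    using sum_squares_bound[of "cmod (c k)" "cmod (d k)"] by (simp add: power2_sum)
  finally show "(cmod (c k + d k))\<^sup>2 \<le> 2 * (cmod (c k))\<^sup>2 + 2 * (cmod (d k))\<^sup>2" .
qed auto

lemma sq_summable_prod:
  assumes "(\<lambda>k. (cmod (c k))\<^sup>2) summable_on A" "(\<lambda>k. (cmod (d k))\<^sup>2) summable_on A"
  shows "(\<lambda>k. c k * cnj (d k)) summable_on A"
proof -
  have "(\<lambda>k. cmod (c k * cnj (d k))) summable_on A"
  proof (rule summable_on_comparison_test)
    show "(\<lambda>k. (cmod (c k))\<^sup>2 + (cmod (d k))\<^sup>2) summable_on A"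
      using assms by (intro summable_on_add)
    fix k
    show "cmod (c k * cnj (d k)) \<le> (cmod (c k))\<^sup>2 + (cmod (d k))\<^sup>2"
      using sum_squares_bound[of "cmod (c k)" "cmod (d k)"]
        mult_nonneg_nonneg[of "cmod (c k)" "cmod (d k)"] by (simp add: norm_mult del: mult_nonneg_nonneg)
  qed auto
  then show ?thesis
    using summable_on_iff_abs_summable_on_complex by blast
qed

definition cin :: "'i ell2 \<Rightarrow> 'i ell2 \<Rightarrow> complex"
  where "cin x y = (\<Sum>\<^sub>\<infinity>k. nth2 x k * cnj (nth2 y k))"

lemma cin_summable: "(\<lambda>k. nth2 x k * cnj (nth2 y k)) summable_on A"
  by (intro sq_summable_prod nth2_summable)

definition cscale :: "complex \<Rightarrow> 'i ell2 \<Rightarrow> 'i ell2"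
  where "cscale z x = Abs_ell2 (\<lambda>k. z * nth2 x k)"

lemma nth2_cscale [simp]: "nth2 (cscale z x) k = z * nth2 x k"
  unfolding cscale_def by (subst nth2_Abs) (auto intro!: sq_summable_mult nth2_summable)

instantiation ell2 :: (type) real_vector
begin
definition "0 = Abs_ell2 (\<lambda>_. 0)"
definition "x + y = Abs_ell2 (\<lambda>k. nth2 x k + nth2 y k)"
definition "- x = cscale (-1) x"
definition "x - y = x + (- y :: 'a ell2)"
definition "r *\<^sub>R x = cscale (complex_of_real r) x"

lemma nth2_zero [simp]: "nth2 0 k = 0"
  unfolding zero_ell2_def by (simp add: nth2_Abs)
lemma nth2_add [simp]: "nth2 (x + y) k = nth2 x k + nth2 y k"
  unfolding plus_ell2_def by (subst nth2_Abs) (auto intro!: sq_summable_add nth2_summable)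
lemma nth2_uminus [simp]: "nth2 (- x) k = - nth2 x k"
  unfolding uminus_ell2_def by simp
lemma nth2_diff [simp]: "nth2 (x - y) k = nth2 x k - nth2 y k"
  unfolding minus_ell2_def by simp
lemma nth2_scaleR [simp]: "nth2 (r *\<^sub>R x) k = complex_of_real r * nth2 x k"
  unfolding scaleR_ell2_def by simp

instance
  by standard (auto intro!: ell2_eqI simp: algebra_simps)
end

lemma nth2_sum [simp]: "nth2 (sum f A) k = (\<Sum>i\<in>A. nth2 (f i) k)"
  by (induction A rule: infinite_finite_induct) auto

lemma cin_add_left: "cin (x + y) z = cin x z + cin y z"
  unfolding cin_def by (simp add: algebra_simps infsum_add cin_summable)

lemma cin_cscale_left [simp]: "cin (cscale c x) z = c * cin x z"
  unfolding cin_def by (simp add: mult.assoc infsum_cmult_right cin_summable)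

lemma cin_commute: "cin y x = cnj (cin x y)"
  unfolding cin_def infsum_cnj[symmetric] by (simp add: mult.commute)

lemma cin_self: "cin x x = complex_of_real (\<Sum>\<^sub>\<infinity>k. (cmod (nth2 x k))\<^sup>2)"
  unfolding cin_def complex_norm_square[symmetric]
  by (rule infsum_bounded_linear_strong)
    (simp_all add: bounded_linear_of_real summable_on_of_real nth2_summable del: of_real_power)

lemma cin_add_right: "cin z (x + y) = cin z x + cin z y"
  by (metis cin_add_left cin_commute complex_cnj_add)

lemma cin_cscale_right [simp]: "cin z (cscale c x) = cnj c * cin z x"
  by (metis cin_cscale_left cin_commute complex_cnj_mult)

lemma cin_zero [simp]: "cin 0 x = 0" "cin x 0 = 0"
  by (simp_all add: cin_def)

lemma cin_sum_left: "cin (sum f A) z = (\<Sum>i\<in>A. cin (f i) z)"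
  by (induction A rule: infinite_finite_induct) (auto simp: cin_add_left)

lemma cin_sum_right: "cin z (sum f A) = (\<Sum>i\<in>A. cin z (f i))"
  by (induction A rule: infinite_finite_induct) (auto simp: cin_add_right)

text \<open>The type class is real, so \<open>inner\<close> is the real part of \<open>cin\<close>;
  both give the same norm. Bounded operators, coercivity and compactness use the real structure,
  while orthogonality and complex linearity are stated with \<open>cin\<close> and
  \<open>cscale\<close>.\<close>

instantiation ell2 :: (type) real_inner
begin
definition "inner x y = Re (cin x y)"
definition "norm x = sqrt (inner x (x :: 'a ell2))"
definition "dist x y = norm (x - y :: 'a ell2)"
definition "sgn x = x /\<^sub>R norm (x :: 'a ell2)"
definition [code del]: "(uniformity :: ('a ell2 \<times> 'a ell2) filter) =
  (INF e\<in>{0 <..}. principal {(x, y). dist x y < e})"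
definition [code del]: "open (U :: 'a ell2 set) = (\<forall>x\<in>U. \<forall>\<^sub>F (x', y) in uniformity. x' = x \<longrightarrow> y \<in> U)"

instance
proof
  fix x y z :: "'a ell2" and r :: real
  show "inner x y = inner y x"
    unfolding inner_ell2_def by (subst cin_commute) simp
  show "inner (x + y) z = inner x z + inner y z"
    unfolding inner_ell2_def by (simp add: cin_add_left)
  show "inner (r *\<^sub>R x) y = r * inner x y"
    unfolding inner_ell2_def by (simp add: scaleR_ell2_def)
  show "0 \<le> inner x x"
    unfolding inner_ell2_def cin_self by (auto intro!: infsum_nonneg)
  show "inner x x = 0 \<longleftrightarrow> x = 0"
  proof
    assume "inner x x = 0"
    then have "(\<Sum>\<^sub>\<infinity>k. (cmod (nth2 x k))\<^sup>2) \<le> 0"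
      unfolding inner_ell2_def cin_self by simp
    then have "(cmod (nth2 x k))\<^sup>2 = 0" for k
      by (rule nonneg_infsum_le_0D) (auto intro: nth2_summable)
    then show "x = 0"
      by (auto intro!: ell2_eqI)
  qed (simp add: inner_ell2_def)
qed (simp_all add: norm_ell2_def dist_ell2_def sgn_ell2_def uniformity_ell2_def open_ell2_def)
end

lemma norm_ell2_sq: "(norm x)\<^sup>2 = (\<Sum>\<^sub>\<infinity>k. (cmod (nth2 x k))\<^sup>2)"
  unfolding power2_norm_eq_inner inner_ell2_def cin_self by simp

lemma cin_self_norm: "cin x x = complex_of_real ((norm x)\<^sup>2)"
  by (simp add: cin_self norm_ell2_sq)

text \<open>Bounds on finite partial sums are stable under coordinatewise limits, which is what
  completeness needs.\<close>

lemma norm_ell2_le_iff: "norm x \<le> B \<longleftrightarrow> 0 \<le> B \<and> (\<forall>F. finite F \<longrightarrow> (\<Sum>k\<in>F. (cmod (nth2 x k))\<^sup>2) \<le> B\<^sup>2)"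
proof
  assume *: "norm x \<le> B"
  have "(\<Sum>k\<in>F. (cmod (nth2 x k))\<^sup>2) \<le> B\<^sup>2" if "finite F" for F
  proof -
    have "(\<Sum>k\<in>F. (cmod (nth2 x k))\<^sup>2) \<le> (norm x)\<^sup>2"
      unfolding norm_ell2_sq using that by (intro finite_sum_le_infsum nth2_summable) auto
    also have "\<dots> \<le> B\<^sup>2"
      using * by (intro power_mono) auto
    finally show ?thesis .
  qed
  then show "0 \<le> B \<and> (\<forall>F. finite F \<longrightarrow> (\<Sum>k\<in>F. (cmod (nth2 x k))\<^sup>2) \<le> B\<^sup>2)"
    using * order_trans[OF norm_ge_zero *] by blast
next
  assume *: "0 \<le> B \<and> (\<forall>F. finite F \<longrightarrow> (\<Sum>k\<in>F. (cmod (nth2 x k))\<^sup>2) \<le> B\<^sup>2)"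
  have "(norm x)\<^sup>2 \<le> B\<^sup>2"
    unfolding norm_ell2_sq using * by (intro infsum_le_finite_sums nth2_summable) auto
  then show "norm x \<le> B"
    using * power2_le_imp_le by blast
qed

lemma norm_nth2_le: "cmod (nth2 x k) \<le> norm x"
proof -
  have "(\<Sum>k\<in>{k}. (cmod (nth2 x k))\<^sup>2) \<le> (norm x)\<^sup>2"
    using norm_ell2_le_iff[of x "norm x"] by blast
  then show ?thesis
    by (auto intro: power2_le_imp_le)
qed

lemma norm_cscale [simp]: "norm (cscale z x) = cmod z * norm x"
proof -
  have "(norm (cscale z x))\<^sup>2 = (cmod z * norm x)\<^sup>2"
    unfolding norm_ell2_sq power_mult_distrib
    by (simp add: norm_mult power_mult_distrib infsum_cmult_right nth2_summable)
  then show ?thesis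
    by (simp add: power2_eq_iff_nonneg)
qed

instance ell2 :: (type) complete_space
proof
  fix X :: "nat \<Rightarrow> 'a ell2"
  assume X: "Cauchy X"
  have "Cauchy (\<lambda>n. nth2 (X n) k)" for k
  proof (rule CauchyI)
    fix e :: real assume "e > 0"
    then obtain M where "\<forall>m\<ge>M. \<forall>n\<ge>M. norm (X m - X n) < e"
      using X CauchyD by blast
    then show "\<exists>M. \<forall>m\<ge>M. \<forall>n\<ge>M. norm (nth2 (X m) k - nth2 (X n) k) < e"
      by (metis nth2_diff norm_nth2_le order_le_less_trans)
  qed
  then have "\<exists>l. (\<lambda>n. nth2 (X n) k) \<longlonglongrightarrow> l" for k
    by (simp add: Cauchy_convergent_iff convergent_def)
  then obtain c where c: "\<And>k. (\<lambda>n. nth2 (X n) k) \<longlonglongrightarrow> c k"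
    by metis
  \<comment> \<open>For a fixed finite set the Cauchy estimate passes to the coordinatewise limit,
    and \<open>N\<close> does not depend on that set.\<close>
  have tail: "\<exists>N. \<forall>n\<ge>N. \<forall>F. finite F \<longrightarrow> (\<Sum>k\<in>F. (cmod (nth2 (X n) k - c k))\<^sup>2) \<le> e\<^sup>2" if "e > 0" for e :: real
  proof -
    obtain N where N: "\<And>m n. m \<ge> N \<Longrightarrow> n \<ge> N \<Longrightarrow> norm (X n - X m) < e"
      using X CauchyD \<open>e > 0\<close> by meson
    have "(\<Sum>k\<in>F. (cmod (nth2 (X n) k - c k))\<^sup>2) \<le> e\<^sup>2" if "n \<ge> N" "finite F" for n F
    proof (rule tendsto_upperbound)
      show "(\<lambda>m. \<Sum>k\<in>F. (cmod (nth2 (X n) k - nth2 (X m) k))\<^sup>2) \<longlonglongrightarrow> (\<Sum>k\<in>F. (cmod (nth2 (X n) k - c k))\<^sup>2)"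
        by (intro tendsto_intros c)
      show "\<forall>\<^sub>F m in sequentially. (\<Sum>k\<in>F. (cmod (nth2 (X n) k - nth2 (X m) k))\<^sup>2) \<le> e\<^sup>2"
      proof (rule eventually_sequentiallyI)
        fix m assume "m \<ge> N"
        then have "norm (X n - X m) \<le> e"
          using N that by (simp add: less_imp_le)
        then show "(\<Sum>k\<in>F. (cmod (nth2 (X n) k - nth2 (X m) k))\<^sup>2) \<le> e\<^sup>2"
          using norm_ell2_le_iff[of "X n - X m" e] that by simp
      qed
    qed auto
    then show ?thesis by blast
  qed
  obtain N where N: "\<And>F. finite F \<Longrightarrow> (\<Sum>k\<in>F. (cmod (nth2 (X N) k - c k))\<^sup>2) \<le> 1\<^sup>2"
    using tail[of 1] by auto
  have "(\<lambda>k. (cmod (nth2 (X N) k - c k))\<^sup>2) summable_on UNIV"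
    using N by (intro nonneg_bdd_above_summable_on bdd_aboveI[of _ 1]) auto
  \<comment> \<open>The limit family is square-summable because it is \<open>X N\<close> minus a
    square-summable difference.\<close>
  then have "(\<lambda>k. (cmod (nth2 (X N) k + (-1) * (nth2 (X N) k - c k)))\<^sup>2) summable_on UNIV"
    by (intro sq_summable_add nth2_summable sq_summable_mult) auto
  then have l: "nth2 (Abs_ell2 c) = c"
    by (intro nth2_Abs) simp
  have "X \<longlonglongrightarrow> Abs_ell2 c"
  proof (rule LIMSEQ_I)
    fix e :: real assume "e > 0"
    then obtain N where N: "\<And>n F. n \<ge> N \<Longrightarrow> finite F \<Longrightarrow> (\<Sum>k\<in>F. (cmod (nth2 (X n) k - c k))\<^sup>2) \<le> (e/2)\<^sup>2"
      using tail[of "e/2"] by auto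
    have "norm (X n - Abs_ell2 c) \<le> e/2" if "n \<ge> N" for n
      unfolding norm_ell2_le_iff using N[OF that] \<open>e > 0\<close> by (simp add: l)
    then show "\<exists>N. \<forall>n\<ge>N. norm (X n - Abs_ell2 c) < e"
      using \<open>e > 0\<close> by (intro exI[of _ N]) (smt (verit) field_sum_of_halves)
  qed
  then show "convergent X"
    by (auto simp: convergent_def)
qed

section \<open>Diagonal operators and coordinate truncations\<close>

definition diag :: "('i \<Rightarrow> complex) \<Rightarrow> 'i ell2 \<Rightarrow>\<^sub>L 'i ell2" where
  "diag m = (if bounded (range m) then Blinfun (\<lambda>x. Abs_ell2 (\<lambda>k. m k * nth2 x k)) else 0)"

lemma
  assumes "\<And>k. cmod (m k) \<le> B"
  shows nth2_diag: "nth2 (diag m x) k = m k * nth2 x k"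
    and norm_diag_le: "norm (diag m) \<le> B"
proof -
  have B: "bounded (range m)"
    using assms by (auto simp: bounded_iff)
  have B0: "0 \<le> B"
    using assms[of undefined] norm_ge_zero order_trans by blast
  define D where "D = (\<lambda>x. Abs_ell2 (\<lambda>k. m k * nth2 x k))"
  have n: "nth2 (D x) = (\<lambda>k. m k * nth2 x k)" for x
    unfolding D_def by (intro nth2_Abs sq_summable_mult[where B=B] assms nth2_summable)
  have "(\<Sum>k\<in>F. (cmod (m k * nth2 x k))\<^sup>2) \<le> (B * norm x)\<^sup>2" if "finite F" for x F
  proof -
    have "(\<Sum>k\<in>F. (cmod (m k * nth2 x k))\<^sup>2) \<le> (\<Sum>k\<in>F. B\<^sup>2 * (cmod (nth2 x k))\<^sup>2)"
      using assms by (intro sum_mono) (auto simp: norm_mult power_mult_distrib intro!: mult_right_mono power_mono)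
    also have "\<dots> \<le> B\<^sup>2 * (norm x)\<^sup>2"
      unfolding sum_distrib_left[symmetric]
      using norm_ell2_le_iff[of x "norm x"] that by (intro mult_left_mono) auto
    finally show ?thesis by (simp add: power_mult_distrib)
  qed
  then have nb: "norm (D x) \<le> B * norm x" for x
    unfolding norm_ell2_le_iff n using B0 by auto
  have "D (x + y) = D x + D y" "D (r *\<^sub>R x) = r *\<^sub>R D x" for x y r
    by (rule ell2_eqI, simp add: n algebra_simps)+
  then have bl: "bounded_linear D"
    by (rule bounded_linear_intro[where K=B]) (simp add: nb mult.commute)
  have d: "blinfun_apply (diag m) = D"
    unfolding diag_def using B bl by (simp add: bounded_linear_Blinfun_apply flip: D_def)
  show "nth2 (diag m x) k = m k * nth2 x k"
    unfolding d n ..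
  show "norm (diag m) \<le> B"
    by (rule norm_blinfun_bound[OF B0]) (simp add: d nb)
qed

text \<open>For \<open>K = Km m\<close> this is the projection \<open>Proj L m\<close> seen on
  Fourier coefficients.\<close>

definition cut :: "'i set \<Rightarrow> 'i ell2 \<Rightarrow>\<^sub>L 'i ell2"
  where "cut K = diag (indicator K)"

lemma nth2_cut [simp]: "nth2 (cut K x) k = (if k \<in> K then nth2 x k else 0)"
  unfolding cut_def by (subst nth2_diag[where B=1]) (auto simp: indicator_def)

lemma norm_cut_le: "norm (cut K) \<le> 1"
  unfolding cut_def by (rule norm_diag_le) (auto simp: indicator_def)

lemma cin_cut: "cin (cut K x) y = cin x (cut K y)"
  unfolding cin_def by (intro infsum_cong) auto

lemma cut_cut [simp]: "cut K (cut K x) = cut K x"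
  by (rule ell2_eqI) auto

text \<open>The remainder after truncation is again diagonal, with a symbol vanishing on
  \<open>K\<close>. This gives both the compactness of \<open>S\<close> and the decay of
  eigenvalues.\<close>

lemma norm_diag_cut_le:
  assumes "\<And>k. cmod (m k) \<le> B" "\<And>k. k \<notin> K \<Longrightarrow> cmod (m k) \<le> e" "0 \<le> e"
  shows "norm (diag m - (diag m o\<^sub>L cut K)) \<le> e"
proof -
  have "diag m - (diag m o\<^sub>L cut K) = diag (\<lambda>k. if k \<in> K then 0 else m k)"
    by (intro blinfun_eqI ell2_eqI, subst nth2_diag[where B=e])
      (use assms in \<open>auto simp: blinfun.diff_left nth2_diag[where B=B]\<close>)
  also have "norm \<dots> \<le> e"
    using assms by (intro norm_diag_le) auto
  finally show ?thesis .
qed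

text \<open>The squared error is the tail of the series of squares, and \<open>K n\<close>
  eventually contains every finite set.\<close>

lemma cut_tendsto:
  assumes fin: "\<And>n. finite (K n)" and mono: "incseq K" and ex: "(\<Union>n. K n) = UNIV"
  shows "(\<lambda>n. cut (K n) x) \<longlonglongrightarrow> x"
proof -
  let ?f = "\<lambda>k. (cmod (nth2 x k))\<^sup>2"
  have "filterlim K (finite_subsets_at_top UNIV) sequentially"
    unfolding filterlim_finite_subsets_at_top
  proof (intro allI impI)
    fix X :: "'a set" assume "finite X \<and> X \<subseteq> UNIV"
    then have "\<forall>k\<in>X. \<exists>n. k \<in> K n"
      using ex by blast
    then obtain N where N: "\<And>k. k \<in> X \<Longrightarrow> k \<in> K (N k)"
      by metis
    let ?M = "Max (insert 0 (N ` X))"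
    have "X \<subseteq> K n" if "n \<ge> ?M" for n
    proof
      fix k assume "k \<in> X"
      then have "N k \<le> n"
        using \<open>finite X \<and> X \<subseteq> UNIV\<close> that by (meson Max_ge finite_imageI finite_insert image_eqI insertI2 order_trans)
      then show "k \<in> K n"
        using N[OF \<open>k \<in> X\<close>] mono unfolding incseq_def by blast
    qed
    then show "\<forall>\<^sub>F n in sequentially. finite (K n) \<and> X \<subseteq> K n \<and> K n \<subseteq> UNIV"
      using fin by (intro eventually_sequentiallyI[of ?M]) auto
  qed
  then have lim: "(\<lambda>n. sum ?f (K n)) \<longlonglongrightarrow> infsum ?f UNIV"
    using infsum_tendsto[OF nth2_summable[of x UNIV]] filterlim_compose by blast
  have "(norm (x - cut (K n) x))\<^sup>2 = infsum ?f UNIV - sum ?f (K n)" for n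
  proof -
    have "(norm (x - cut (K n) x))\<^sup>2 = infsum ?f (UNIV - K n)"
      unfolding norm_ell2_sq by (rule infsum_cong_neutral) auto
    also have "\<dots> = infsum ?f UNIV - infsum ?f (K n)"
      by (rule infsum_Diff) (auto intro: nth2_summable)
    finally show ?thesis
      by (simp add: fin)
  qed
  then have "(\<lambda>n. (norm (x - cut (K n) x))\<^sup>2) \<longlonglongrightarrow> 0"
    using tendsto_diff[OF tendsto_const[of "infsum ?f UNIV"] lim] by simp
  then have "(\<lambda>n. sqrt ((norm (x - cut (K n) x))\<^sup>2)) \<longlonglongrightarrow> sqrt 0"
    by (rule tendsto_real_sqrt)
  then have "(\<lambda>n. norm (cut (K n) x - x)) \<longlonglongrightarrow> 0"
    by (simp add: norm_minus_commute)
  then show ?thesis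
    by (simp add: LIM_zero_iff tendsto_norm_zero_iff)
qed

subsection \<open>Coercive and compact positive operators\<close>

text \<open>Lax-Milgram by a fixed point: for small \<open>t\<close> the map
  \<open>x - t *\<^sub>R (G x - y)\<close> is a contraction, and its fixed point solves
  \<open>G x = y\<close>. The lower bound on \<open>norm (G x)\<close> makes the inverse a
  contraction as well.\<close>

lemma coercive_imp_bij:
  fixes G :: "'a::{real_inner,complete_space} \<Rightarrow>\<^sub>L 'a"
  assumes co: "\<And>x. (norm x)\<^sup>2 \<le> inner (G x) x"
  shows "bij (blinfun_apply G)" and "\<And>x. norm x \<le> norm (G x)"
proof -
  show le: "norm x \<le> norm (G x)" for x
  proof (cases "x = 0")
    case False
    have "norm x * norm x \<le> norm (G x) * norm x"
      using co[of x] norm_cauchy_schwarz[of "G x" x] by (simp add: power2_eq_square)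
    then show ?thesis
      using False by simp
  qed simp
  have "inj (blinfun_apply G)"
  proof (rule injI)
    fix x y assume "G x = G y"
    then have "norm (x - y) \<le> 0"
      using le[of "x - y"] by (simp add: blinfun.diff_right)
    then show "x = y" by simp
  qed
  moreover have "surj (blinfun_apply G)"
  proof -
    \<comment> \<open>The estimate below produces the factor
      \<open>1 - 2*t + t\<^sup>2 * g\<^sup>2\<close>, which is \<open>1 - t\<close> for this
      \<open>t\<close>. Adding 1 to the norm ensures \<open>g \<ge> 1\<close>, so
      \<open>1 - t\<close> is nonnegative.\<close>
    define g where "g = norm G + 1"
    have g: "g \<ge> 1"
      by (simp add: g_def)
    define t where "t = 1 / g\<^sup>2"
    have t: "0 < t" "t * g\<^sup>2 = 1"
      using g by (auto simp: t_def)
    have t1: "t \<le> 1"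
      using g by (simp add: t_def)
    have contr: "(norm (x - t *\<^sub>R G x))\<^sup>2 \<le> (1 - t) * (norm x)\<^sup>2" for x
    proof -
      have n: "norm (G x) \<le> g * norm x"
        using norm_blinfun[of G x] norm_ge_zero[of x] unfolding g_def distrib_right by linarith
      have "(norm (x - t *\<^sub>R G x))\<^sup>2 = (norm x)\<^sup>2 - 2 * t * inner (G x) x + t\<^sup>2 * (norm (G x))\<^sup>2"
        by (simp only: power2_norm_eq_inner)
          (simp add: inner_diff_left inner_diff_right inner_commute power2_eq_square algebra_simps)
      also have "\<dots> \<le> (norm x)\<^sup>2 - 2 * t * (norm x)\<^sup>2 + t\<^sup>2 * (g * norm x)\<^sup>2"
        using co[of x] t(1) n
        by (intro add_mono diff_mono mult_left_mono power_mono) auto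
      also have "\<dots> = (1 - 2 * t + t * (t * g\<^sup>2)) * (norm x)\<^sup>2"
        by (simp add: power2_eq_square algebra_simps)
      finally show ?thesis
        using t by simp
    qed
    show ?thesis
      unfolding surj_def
    proof
      fix y
      define f where "f = (\<lambda>x. x - t *\<^sub>R (G x - y))"
      have "\<exists>!x. f x = x"
      proof (rule banach_fix_type)
        show "0 \<le> sqrt (1 - t)" "sqrt (1 - t) < 1"
          using t t1 by auto
        show "\<forall>x z. dist (f x) (f z) \<le> sqrt (1 - t) * dist x z"
        proof (intro allI)
          fix x z
          have "f x - f z = (x - z) - t *\<^sub>R G (x - z)"
            by (simp add: f_def blinfun.diff_right algebra_simps)
          then have "(dist (f x) (f z))\<^sup>2 \<le> (1 - t) * (norm (x - z))\<^sup>2"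
            using contr[of "x - z"] by (simp add: dist_norm)
          then have "sqrt ((dist (f x) (f z))\<^sup>2) \<le> sqrt ((1 - t) * (norm (x - z))\<^sup>2)"
            by (rule real_sqrt_le_mono)
          then show "dist (f x) (f z) \<le> sqrt (1 - t) * dist x z"
            by (simp add: real_sqrt_mult dist_norm)
        qed
      qed
      then obtain x where "f x = x" by blast
      then have "G x = y"
        using t by (simp add: f_def)
      then show "\<exists>x. y = G x" by blast
    qed
  qed
  ultimately show "bij (blinfun_apply G)"
    by (simp add: bij_def)
qed

text \<open>Only meaningful for bijective operators with bounded inverse.\<close>

definition binv :: "('a::real_normed_vector \<Rightarrow>\<^sub>L 'a) \<Rightarrow> ('a \<Rightarrow>\<^sub>L 'a)"
  where "binv G = Blinfun (inv (blinfun_apply G))"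

lemma
  fixes G :: "'a::{real_inner,complete_space} \<Rightarrow>\<^sub>L 'a"
  assumes co: "\<And>x. (norm x)\<^sup>2 \<le> inner (G x) x"
  shows binv_right: "G (binv G x) = x" and binv_left: "binv G (G x) = x"
    and norm_binv_le: "norm (binv G) \<le> 1"
proof -
  note bij = coercive_imp_bij[OF co]
  let ?H = "inv (blinfun_apply G)"
  have r: "G (?H x) = x" for x
    using bij(1) by (simp add: bij_is_surj surj_f_inv_f)
  have l: "?H (G x) = x" for x
    using bij(1) by (simp add: bij_is_inj inv_f_f)
  have n: "norm (?H x) \<le> norm x" for x
    using bij(2)[of "?H x"] by (simp add: r)
  have "?H (x + y) = ?H x + ?H y" "?H (c *\<^sub>R x) = c *\<^sub>R ?H x" for x y c
    by (metis r l blinfun.add_right, metis r l blinfun.scaleR_right)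
  then have "bounded_linear ?H"
    by (rule bounded_linear_intro[where K=1]) (simp add: n)
  then have b: "blinfun_apply (binv G) = ?H"
    by (simp add: binv_def bounded_linear_Blinfun_apply)
  show "G (binv G x) = x" "binv G (G x) = x"
    by (simp_all add: b r l)
  show "norm (binv G) \<le> 1"
    by (rule norm_blinfun_bound) (simp_all add: b n)
qed

text \<open>The usual discriminant argument, valid for a form that may degenerate: a violated
  inequality exhibits a vector with negative value.\<close>

lemma form_Cauchy_Schwarz:
  fixes T :: "'a::real_inner \<Rightarrow>\<^sub>L 'a"
  assumes sa: "\<And>x y. inner (T x) y = inner x (T y)" and pos: "\<And>x. 0 \<le> inner (T x) x"
  shows "(inner (T x) y)\<^sup>2 \<le> inner (T x) x * inner (T y) y"
proof (rule ccontr)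
  let ?a = "inner (T x) x" and ?b = "inner (T x) y" and ?c = "inner (T y) y"
  assume "\<not> ?b\<^sup>2 \<le> ?a * ?c"
  then have less: "?a * ?c < ?b\<^sup>2" by simp
  have expand: "inner (T (s *\<^sub>R x - t *\<^sub>R y)) (s *\<^sub>R x - t *\<^sub>R y) = s\<^sup>2 * ?a - 2 * s * t * ?b + t\<^sup>2 * ?c" for s t
  proof -
    have "inner (T y) x = ?b"
      using sa[of y x] by (simp add: inner_commute)
    then show ?thesis
      by (simp add: blinfun.diff_right blinfun.scaleR_right inner_diff_left inner_diff_right power2_eq_square algebra_simps)
  qed
  show False
  proof (cases "?c = 0")
    case True
    then have "?b \<noteq> 0" using less by auto
    \<comment> \<open>With \<open>?c = 0\<close> the form is affine in \<open>t\<close>, and this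
      \<open>t\<close> brings it down to \<open>- ?a - 2\<close>.\<close>
    have "0 \<le> 1\<^sup>2 * ?a - 2 * 1 * ((?a + 1) / ?b) * ?b + ((?a + 1) / ?b)\<^sup>2 * ?c"
      unfolding expand[symmetric] by (rule pos)
    then have "0 \<le> ?a - 2 * (?a + 1)"
      using True \<open>?b \<noteq> 0\<close> by simp
    then show False
      using pos[of x] by simp
  next
    case False
    then have c: "?c > 0"
      using pos[of y] by simp
    \<comment> \<open>The choice \<open>s = ?c\<close>, \<open>t = ?b\<close> is the minimizing
      ratio cleared of its denominator.\<close>
    have "0 \<le> ?c\<^sup>2 * ?a - 2 * ?c * ?b * ?b + ?b\<^sup>2 * ?c"
      unfolding expand[symmetric] by (rule pos)
    also have "\<dots> = ?c * (?a * ?c - ?b\<^sup>2)"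
      by (simp add: power2_eq_square algebra_simps)
    also have "\<dots> < 0"
      using c less by (simp add: mult_pos_neg)
    finally show False by simp
  qed
qed

text \<open>A maximizing sequence for the Rayleigh quotient consists of approximate eigenvectors, because
  \<open>\<parallel>T x\<parallel>\<^sup>2 \<le> \<mu> \<langle>T x, x\<rangle>\<close> when \<open>\<mu>\<close> is the supremum; compactness then makes it converge.\<close>

lemma compact_form_max_eigenvector:
  fixes T :: "'a::real_inner \<Rightarrow>\<^sub>L 'a"
  assumes sa: "\<And>x y. inner (T x) y = inner x (T y)" and pos: "\<And>x. 0 \<le> inner (T x) x"
    and comp: "compact (closure (blinfun_apply T ` cball 0 1))"
    and W: "subspace W" "closed W" "\<And>x. x \<in> W \<Longrightarrow> T x \<in> W"
    and x0: "x0 \<in> W" "norm x0 = 1" "r \<le> inner (T x0) x0" and r: "0 < r"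
  shows "\<exists>f \<mu>. f \<in> W \<and> norm f = 1 \<and> r \<le> \<mu> \<and> T f = \<mu> *\<^sub>R f"
proof -
  define R where "R = (\<lambda>x. inner (T x) x) ` {x\<in>W. norm x = 1}"
  define \<mu> where "\<mu> = Sup R"
  have Rle: "inner (T x) x \<le> norm T" if "norm x = 1" for x
    using norm_cauchy_schwarz[of "T x" x] norm_blinfun[of T x] that by simp
  have bdd: "bdd_above R"
    unfolding R_def using Rle by (intro bdd_aboveI[of _ "norm T"]) auto
  have x0R: "inner (T x0) x0 \<in> R"
    using x0 by (auto simp: R_def)
  have r\<mu>: "r \<le> \<mu>"
    using cSup_upper[OF x0R bdd] x0 by (simp add: \<mu>_def)
  then have \<mu>0: "0 < \<mu>" using r by simp
  have le\<mu>: "inner (T x) x \<le> \<mu> * (norm x)\<^sup>2" if "x \<in> W" for x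
  proof (cases "x = 0")
    case False
    let ?u = "x /\<^sub>R norm x"
    have "inner (T ?u) ?u \<le> \<mu>"
      unfolding \<mu>_def
    proof (rule cSup_upper[OF _ bdd])
      have "?u \<in> {x\<in>W. norm x = 1}"
        using W(1) that False by (simp add: subspace_scale)
      then show "inner (T ?u) ?u \<in> R"
        unfolding R_def by (rule imageI)
    qed
    then have "inner (T x) x / (norm x)\<^sup>2 \<le> \<mu>"
      by (simp add: blinfun.scaleR_right power2_eq_square field_simps)
    then show ?thesis
      using False by (simp add: divide_le_eq)
  qed simp
  \<comment> \<open>Cauchy-Schwarz for the form of \<open>T\<close> at \<open>x\<close> and
    \<open>T x\<close>; invariance of \<open>W\<close> allows the bound by the supremum to be
    applied at \<open>T x\<close>.\<close>
  have Tsq: "(norm (T x))\<^sup>2 \<le> \<mu> * inner (T x) x" if "x \<in> W" for x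
  proof (cases "T x = 0")
    case False
    have "((norm (T x))\<^sup>2)\<^sup>2 = (inner (T x) (T x))\<^sup>2"
      by (simp add: power2_norm_eq_inner)
    also have "\<dots> \<le> inner (T x) x * inner (T (T x)) (T x)"
      by (rule form_Cauchy_Schwarz[OF sa pos])
    also have "\<dots> \<le> inner (T x) x * (\<mu> * (norm (T x))\<^sup>2)"
      by (intro mult_left_mono le\<mu> W pos that)
    finally have "(norm (T x))\<^sup>2 * (norm (T x))\<^sup>2 \<le> (\<mu> * inner (T x) x) * (norm (T x))\<^sup>2"
      by (simp add: power2_eq_square mult_ac)
    then show ?thesis
      by (rule mult_right_le_imp_le) (use False in simp)
  qed (use \<mu>0 in simp)
  have "\<exists>x. x \<in> W \<and> norm x = 1 \<and> \<mu> - 1 / real (Suc n) < inner (T x) x" for n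
  proof -
    have "\<mu> - 1 / real (Suc n) < Sup R"
      by (simp add: \<mu>_def)
    then show ?thesis
      using less_cSup_iff[OF _ bdd] x0R unfolding R_def by blast
  qed
  then obtain f where f: "\<And>n. f n \<in> W" "\<And>n. norm (f n) = 1" "\<And>n. \<mu> - 1 / real (Suc n) < inner (T (f n)) (f n)"
    by metis
  have "T (f n) \<in> closure (blinfun_apply T ` cball 0 1)" for n
    using f(2)[of n] by (intro subsetD[OF closure_subset]) auto
  then obtain y s where s: "strict_mono s" "((\<lambda>n. T (f n)) \<circ> s) \<longlonglongrightarrow> y"
    using comp[unfolded compact_def, rule_format, of "\<lambda>n. T (f n)"] by blast
  have "(\<lambda>n. T (f n) - \<mu> *\<^sub>R f n) \<longlonglongrightarrow> 0"
  proof -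
    have b: "(norm (T (f n) - \<mu> *\<^sub>R f n))\<^sup>2 \<le> \<mu> * (1 / real (Suc n))" for n
    proof -
      have "(norm (T (f n) - \<mu> *\<^sub>R f n))\<^sup>2 = (norm (T (f n)))\<^sup>2 - 2 * \<mu> * inner (T (f n)) (f n) + \<mu>\<^sup>2 * (norm (f n))\<^sup>2"
        by (simp only: power2_norm_eq_inner) (simp add: inner_diff_left inner_diff_right inner_commute power2_eq_square algebra_simps)
      also have "\<dots> \<le> \<mu> * (\<mu> - inner (T (f n)) (f n))"
        using Tsq[OF f(1), of n] by (simp add: f power2_eq_square algebra_simps)
      also have "\<dots> \<le> \<mu> * (1 / real (Suc n))"
        using f(3)[of n] \<mu>0 by (intro mult_left_mono) auto
      finally show ?thesis .
    qed
    have "(\<lambda>n. (norm (T (f n) - \<mu> *\<^sub>R f n))\<^sup>2) \<longlonglongrightarrow> 0"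
    proof (rule tendsto_sandwich[of "\<lambda>_. 0" _ _ "\<lambda>n. \<mu> * (1 / real (Suc n))"])
      have "(\<lambda>n. \<mu> * inverse (real (Suc n))) \<longlonglongrightarrow> \<mu> * 0"
        by (intro tendsto_mult tendsto_const LIMSEQ_inverse_real_of_nat)
      then show "(\<lambda>n. \<mu> * (1 / real (Suc n))) \<longlonglongrightarrow> 0"
        by (simp add: inverse_eq_divide)
    qed (use b in auto)
    then have "(\<lambda>n. sqrt ((norm (T (f n) - \<mu> *\<^sub>R f n))\<^sup>2)) \<longlonglongrightarrow> sqrt 0"
      by (rule tendsto_real_sqrt)
    then show ?thesis
      by (simp add: tendsto_norm_zero_iff)
  qed
  then have "((\<lambda>n. T (f n) - \<mu> *\<^sub>R f n) \<circ> s) \<longlonglongrightarrow> 0"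
    by (rule LIMSEQ_subseq_LIMSEQ[OF _ s(1)])
  \<comment> \<open>Along \<open>s\<close> both \<open>T (f n)\<close> and its difference from the
    multiple of \<open>f n\<close> converge, hence so does that multiple; positivity of
    \<open>\<mu>\<close> then frees \<open>f n\<close> itself.\<close>
  from tendsto_diff[OF s(2) this] have "(\<lambda>n. \<mu> *\<^sub>R f (s n)) \<longlonglongrightarrow> y"
    by (simp add: o_def)
  from tendsto_scaleR[OF tendsto_const[of "1 / \<mu>"] this]
  have lim: "(\<lambda>n. f (s n)) \<longlonglongrightarrow> y /\<^sub>R \<mu>"
    using \<mu>0 by (simp add: divide_inverse)
  let ?e = "y /\<^sub>R \<mu>"
  have "?e \<in> W"
    using closed_sequentially[OF W(2) _ lim] f(1) by blast
  moreover have "norm ?e = 1"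
    using LIMSEQ_unique[OF tendsto_norm[OF lim]] by (simp add: f)
  moreover have "T ?e = y"
  proof (rule LIMSEQ_unique)
    show "(\<lambda>n. T (f (s n))) \<longlonglongrightarrow> T ?e"
      by (intro blinfun.tendsto tendsto_const lim)
    show "(\<lambda>n. T (f (s n))) \<longlonglongrightarrow> y"
      using s(2) by (simp add: o_def)
  qed
  then have "T ?e = \<mu> *\<^sub>R ?e"
    using \<mu>0 by simp
  ultimately show ?thesis
    using r\<mu> by blast
qed

subsection \<open>Min-max characterization of eigenvalues\<close>

text \<open>Gaussian elimination: equation \<open>j\<close> expresses an unknown \<open>p\<close>
  with nonzero coefficient through the others, and the reduced system \<open>?A\<close> still has
  more unknowns than equations.\<close>

lemma homogeneous_system_nontrivial:
  fixes A :: "'l \<Rightarrow> 'k \<Rightarrow> 'f::field"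
  assumes "finite N" "finite I" "card N < card I"
  shows "\<exists>c. (\<exists>i\<in>I. c i \<noteq> 0) \<and> (\<forall>l\<in>N. (\<Sum>i\<in>I. c i * A l i) = 0)"
  using assms
proof (induction N arbitrary: I A rule: finite_induct)
  case empty
  then have "I \<noteq> {}" by auto
  then show ?case by (intro exI[of _ "\<lambda>_. 1"]) auto
next
  case (insert j N)
  show ?case
  proof (cases "\<exists>p\<in>I. A j p \<noteq> 0")
    case False
    obtain c where "\<exists>i\<in>I. c i \<noteq> 0" "\<forall>l\<in>N. (\<Sum>i\<in>I. c i * A l i) = 0"
      using insert.IH[of I A] insert.prems insert.hyps by auto
    then show ?thesis
      using False by (intro exI[of _ c]) auto
  next
    case True
    then obtain p where p: "p \<in> I" "A j p \<noteq> 0" by blast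
    let ?I = "I - {p}"
    let ?A = "\<lambda>l i. A l i - A j i / A j p * A l p"
    have "card N < card ?I" "finite ?I"
      using insert.prems insert.hyps p by auto
    then obtain c where c: "\<exists>i\<in>?I. c i \<noteq> 0" "\<And>l. l \<in> N \<Longrightarrow> (\<Sum>i\<in>?I. c i * ?A l i) = 0"
      using insert.IH[of ?I ?A] by blast
    define d where "d = c(p := - (\<Sum>i\<in>?I. c i * A j i) / A j p)"
    have split: "(\<Sum>i\<in>I. d i * A l i) = d p * A l p + (\<Sum>i\<in>?I. c i * A l i)" for l
    proof -
      have "(\<Sum>i\<in>?I. d i * A l i) = (\<Sum>i\<in>?I. c i * A l i)"
        by (rule sum.cong) (auto simp: d_def)
      then show ?thesis
        using insert.prems p by (simp add: sum.remove[of I p "\<lambda>i. d i * A l i"])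
    qed
    have "(\<Sum>i\<in>I. d i * A l i) = 0" if "l \<in> insert j N" for l
    proof (cases "l = j")
      case True
      then show ?thesis
        unfolding True split using p by (simp add: d_def)
    next
      case False
      then have "(\<Sum>i\<in>?I. c i * ?A l i) = 0"
        using c(2) that by blast
      moreover have "(\<Sum>i\<in>?I. c i * ?A l i) = (\<Sum>i\<in>?I. c i * A l i) - (\<Sum>i\<in>?I. c i * A j i) / A j p * A l p"
        by (simp add: right_diff_distrib sum_subtractf sum_distrib_left sum_divide_distrib mult_ac)
      ultimately show ?thesis
        unfolding split by (simp add: d_def)
    qed
    moreover have "\<exists>i\<in>I. d i \<noteq> 0"
      using c(1) by (auto simp: d_def)
    ultimately show ?thesis by blast
  qed
qed

text \<open>Both parts of \<open>cin\<close> become real inner products, so continuity of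
  \<open>inner\<close> yields closedness and limits for \<open>cin\<close>.\<close>

lemma Im_cin: "Im (cin x y) = inner x (cscale \<i> y)"
  by (simp add: inner_ell2_def)

text \<open>Each new coordinate adds a compact disc in the direction of a unit vector, and a sum of
  two compact sets is compact.\<close>

lemma cut_cball_subset_compact:
  assumes "finite K"
  shows "\<exists>C. compact C \<and> (\<forall>x. norm x \<le> 1 \<longrightarrow> cut K x \<in> C)"
  using assms
proof (induction K rule: finite_induct)
  case empty
  have "cut {} x = 0" for x :: "'a ell2"
    by (rule ell2_eqI) simp
  then show ?case by (intro exI[of _ "{0}"]) auto
next
  case (insert k K)
  then obtain C where C: "compact C" "\<And>x. norm x \<le> 1 \<Longrightarrow> cut K x \<in> C" by blast
  define e :: "'a ell2" where "e = Abs_ell2 (indicator {k})"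
  have ne: "nth2 e = indicator {k}"
    unfolding e_def
    by (rule nth2_Abs, rule finite_nonzero_values_imp_summable_on)
      (auto intro!: finite_subset[of _ "{k}"] simp: indicator_def split: if_splits)
  have "bounded_linear (\<lambda>z. cscale z e)"
    by (rule bounded_linear_intro[where K="norm e"])
      (auto intro!: ell2_eqI simp: algebra_simps scaleR_conv_of_real)
  then have "compact ((\<lambda>z. cscale z e) ` cball 0 1)"
    by (intro compact_continuous_image linear_continuous_on) auto
  then have "compact {x + y |x y. x \<in> (\<lambda>z. cscale z e) ` cball 0 1 \<and> y \<in> C}"
    using C(1) by (rule compact_sums)
  moreover have "cut (insert k K) x \<in> {x + y |x y. x \<in> (\<lambda>z. cscale z e) ` cball 0 1 \<and> y \<in> C}"
    if "norm x \<le> 1" for x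
  proof -
    have "cut (insert k K) x = cscale (nth2 x k) e + cut K x"
      using insert.hyps by (intro ell2_eqI) (auto simp: ne indicator_def)
    moreover have "nth2 x k \<in> cball 0 1"
      using norm_nth2_le[of x k] that by simp
    ultimately show ?thesis
      using C(2)[OF that] by blast
  qed
  ultimately show ?case by blast
qed

text \<open>An \<open>e/4\<close>-net for the image of the truncated ball is an \<open>e\<close>-net
  for the closure: passing from the closure to the image, replacing \<open>T\<close> by the
  finite-rank operator, and choosing the net point each cost at most \<open>e/4\<close>.\<close>

lemma compact_closure_image_if_finite_rank_approx:
  fixes T :: "'i ell2 \<Rightarrow>\<^sub>L 'i ell2"
  assumes "\<And>e. e > 0 \<Longrightarrow> \<exists>K U. finite K \<and> norm (T - (U o\<^sub>L cut K)) \<le> e"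
  shows "compact (closure (blinfun_apply T ` cball 0 1))"
  unfolding compact_eq_totally_bounded complete_eq_closed
proof (intro conjI allI impI)
  fix e :: real assume "e > 0"
  then obtain K and U :: "'i ell2 \<Rightarrow>\<^sub>L 'i ell2" where K: "finite K" "norm (T - (U o\<^sub>L cut K)) \<le> e / 4"
    using assms[of "e / 4"] by auto
  obtain C where C: "compact C" "\<And>x. norm x \<le> 1 \<Longrightarrow> cut K x \<in> C"
    using cut_cball_subset_compact[OF K(1)] by blast
  have "compact (U ` C)"
    using C(1) by (intro compact_continuous_image linear_continuous_on blinfun.bounded_linear_right)
  then obtain F where F: "finite F" "U ` C \<subseteq> (\<Union>x\<in>F. ball x (e/4))"
    using \<open>e > 0\<close> unfolding compact_eq_totally_bounded by (metis divide_pos_pos zero_less_numeral)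
  have "closure (blinfun_apply T ` cball 0 1) \<subseteq> (\<Union>x\<in>F. ball x e)"
  proof
    fix y assume "y \<in> closure (blinfun_apply T ` cball 0 1)"
    then obtain x where x: "norm x \<le> 1" "dist (T x) y < e/4"
      using \<open>e > 0\<close> unfolding closure_approachable by (metis divide_pos_pos imageE mem_cball_0 zero_less_numeral)
    obtain z where z: "z \<in> F" "dist z (U (cut K x)) < e/4"
      using F(2) C(2)[OF x(1)] by (auto simp: subset_iff)
    have "norm ((T - (U o\<^sub>L cut K)) x) \<le> e/4 * 1"
      using norm_blinfun[of "T - (U o\<^sub>L cut K)" x] K(2) x(1)
      by (meson mult_mono norm_ge_zero order_trans)
    then have "dist (U (cut K x)) (T x) \<le> e/4"
      by (simp add: blinfun.diff_left dist_norm norm_minus_commute)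
    then have "dist z y < e"
      using x z dist_triangle[of z y "U (cut K x)"] dist_triangle[of "U (cut K x)" y "T x"] \<open>e > 0\<close> by linarith
    then show "y \<in> (\<Union>x\<in>F. ball x e)"
      using z by auto
  qed
  then show "\<exists>k. finite k \<and> closure (blinfun_apply T ` cball 0 1) \<subseteq> (\<Union>x\<in>k. ball x e)"
    using F(1) by blast
qed simp

section \<open>Compact positive operators and two descriptions of their eigenvalues\<close>

definition compact_positive :: "('i ell2 \<Rightarrow>\<^sub>L 'i ell2) \<Rightarrow> bool" where
  "compact_positive T \<longleftrightarrow> (\<forall>z x. T (cscale z x) = cscale z (T x)) \<and> (\<forall>x y. cin (T x) y = cin x (T y))
     \<and> (\<forall>x. 0 \<le> inner (T x) x) \<and> compact (closure (blinfun_apply T ` cball 0 1))"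

definition orthonormal :: "nat \<Rightarrow> (nat \<Rightarrow> 'i ell2) \<Rightarrow> bool" where
  "orthonormal k e \<longleftrightarrow> (\<forall>i<k. \<forall>j<k. cin (e i) (e j) = (if i = j then 1 else 0))"

text \<open>The set in the definition of \<open>sdown\<close>, transcribed to coefficients.\<close>

definition eigen_levels :: "('i ell2 \<Rightarrow>\<^sub>L 'i ell2) \<Rightarrow> nat \<Rightarrow> real set" where
  "eigen_levels T k = {r. 0 < r \<and> (\<exists>e \<mu>. orthonormal k e \<and> (\<forall>i<k. r \<le> \<mu> i \<and> T (e i) = \<mu> i *\<^sub>R e i))}"

text \<open>The max-min side of Courant-Fischer: the Rayleigh quotient is at least \<open>r\<close>
  on a \<open>k\<close>-dimensional subspace. It depends on \<open>T\<close> only through its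
  quadratic form and is monotone in it.\<close>

definition form_levels :: "('i ell2 \<Rightarrow>\<^sub>L 'i ell2) \<Rightarrow> nat \<Rightarrow> real set" where
  "form_levels T k = {r. 0 < r \<and> (\<exists>e. orthonormal k e \<and>
     (\<forall>c. let x = \<Sum>i<k. cscale (c i) (e i) in r * (norm x)\<^sup>2 \<le> inner (T x) x))}"

lemma cin_lincomb_orthonormal:
  assumes "orthonormal k e"
  shows "cin (\<Sum>i<k. cscale (c i) (e i)) (\<Sum>i<k. cscale (d i) (e i)) = (\<Sum>i<k. c i * cnj (d i))"
proof -
  have "cin (\<Sum>i<k. cscale (c i) (e i)) (\<Sum>i<k. cscale (d i) (e i))
      = (\<Sum>i<k. \<Sum>j<k. c i * (cnj (d j) * cin (e i) (e j)))"
    unfolding cin_sum_left by (simp add: cin_sum_right sum_distrib_left mult.left_commute)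
  also have "\<dots> = (\<Sum>i<k. \<Sum>j<k. if i = j then c i * cnj (d j) else 0)"
    using assms by (intro sum.cong refl) (auto simp: orthonormal_def)
  also have "\<dots> = (\<Sum>i<k. c i * cnj (d i))"
    by (simp add: sum.delta')
  finally show ?thesis .
qed

lemma norm_lincomb_orthonormal:
  assumes "orthonormal k e"
  shows "(norm (\<Sum>i<k. cscale (c i) (e i)))\<^sup>2 = (\<Sum>i<k. (cmod (c i))\<^sup>2)"
proof -
  have "cin (\<Sum>i<k. cscale (c i) (e i)) (\<Sum>i<k. cscale (c i) (e i)) = complex_of_real (\<Sum>i<k. (cmod (c i))\<^sup>2)"
    unfolding cin_lincomb_orthonormal[OF assms] complex_norm_square[symmetric] by simp
  then show ?thesis
    unfolding cin_self_norm of_real_eq_iff .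
qed

lemma eigen_levels_subset_form_levels:
  fixes T :: "'i ell2 \<Rightarrow>\<^sub>L 'i ell2"
  assumes lin: "\<And>z x. T (cscale z x) = cscale z (T x)"
  shows "eigen_levels T k \<subseteq> form_levels T k"
proof
  fix r assume "r \<in> eigen_levels T k"
  then obtain e \<mu> where r: "0 < r" and e: "orthonormal k e"
    and ev: "\<And>i. i < k \<Longrightarrow> r \<le> \<mu> i" "\<And>i. i < k \<Longrightarrow> T (e i) = \<mu> i *\<^sub>R e i"
    by (auto simp: eigen_levels_def)
  have "r * (norm (\<Sum>i<k. cscale (c i) (e i)))\<^sup>2
      \<le> inner (T (\<Sum>i<k. cscale (c i) (e i))) (\<Sum>i<k. cscale (c i) (e i))" for c
  proof -
    have "T (\<Sum>i<k. cscale (c i) (e i)) = (\<Sum>i<k. cscale (c i * complex_of_real (\<mu> i)) (e i))"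
      by (auto simp: blinfun.sum_right lin ev scaleR_ell2_def intro!: sum.cong ell2_eqI)
    then have "inner (T (\<Sum>i<k. cscale (c i) (e i))) (\<Sum>i<k. cscale (c i) (e i))
        = Re (\<Sum>i<k. c i * complex_of_real (\<mu> i) * cnj (c i))"
      by (simp add: inner_ell2_def cin_lincomb_orthonormal[OF e])
    also have "\<dots> = (\<Sum>i<k. \<mu> i * (cmod (c i))\<^sup>2)"
      unfolding Re_sum
    proof (rule sum.cong)
      fix i
      have "c i * complex_of_real (\<mu> i) * cnj (c i) = complex_of_real (\<mu> i) * (c i * cnj (c i))"
        by (simp add: mult_ac)
      then show "Re (c i * complex_of_real (\<mu> i) * cnj (c i)) = \<mu> i * (cmod (c i))\<^sup>2"
        unfolding complex_norm_square[symmetric] by (metis Re_complex_of_real of_real_mult)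
    qed simp
    also have "\<dots> \<ge> r * (norm (\<Sum>i<k. cscale (c i) (e i)))\<^sup>2"
      unfolding norm_lincomb_orthonormal[OF e] sum_distrib_left
      by (intro sum_mono mult_right_mono) (auto simp: ev)
    finally show ?thesis .
  qed
  then show "r \<in> form_levels T k"
    using r e unfolding form_levels_def Let_def by blast
qed

text \<open>Dimension count: the span of \<open>k\<close> orthonormal vectors meets the common
  kernel of fewer than \<open>k\<close> functionals. The functionals are products with eigenvectors
  in one use and coordinates in another.\<close>

lemma orthonormal_lincomb_vanishing:
  fixes l :: "'l \<Rightarrow> 'i ell2 \<Rightarrow> complex"
  assumes e: "orthonormal k e" and N: "finite N" "card N < k"
    and lin: "\<And>j c. j \<in> N \<Longrightarrow> l j (\<Sum>i<k. cscale (c i) (e i)) = (\<Sum>i<k. c i * l j (e i))"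
  shows "\<exists>c. (\<Sum>i<k. cscale (c i) (e i)) \<noteq> 0 \<and> (\<forall>j\<in>N. l j (\<Sum>i<k. cscale (c i) (e i)) = 0)"
proof -
  obtain c where c: "\<exists>i\<in>{..<k}. c i \<noteq> 0" "\<forall>j\<in>N. (\<Sum>i<k. c i * l j (e i)) = 0"
    using homogeneous_system_nontrivial[of N "{..<k}" "\<lambda>j i. l j (e i)"] N by auto
  have "(norm (\<Sum>i<k. cscale (c i) (e i)))\<^sup>2 \<noteq> 0"
    unfolding norm_lincomb_orthonormal[OF e] using c(1) by (subst sum_nonneg_eq_0_iff) auto
  then show ?thesis
    using c(2) lin by (intro exI[of _ c]) auto
qed

text \<open>After \<open>j < k\<close> eigenvectors, their orthogonal complement \<open>W\<close> is
  invariant by self-adjointness and meets the span of \<open>e\<close> nontrivially. The Rayleigh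
  quotient there is at least \<open>r\<close>, so maximizing it over \<open>W\<close> yields the
  next eigenvector with eigenvalue at least \<open>r\<close>.\<close>

lemma form_levels_subset_eigen_levels:
  assumes T: "compact_positive T"
  shows "form_levels T k \<subseteq> eigen_levels T k"
proof
  fix r assume "r \<in> form_levels T k"
  then obtain e where r: "0 < r" and e: "orthonormal k e"
    and form: "\<And>c. r * (norm (\<Sum>i<k. cscale (c i) (e i)))\<^sup>2
      \<le> inner (T (\<Sum>i<k. cscale (c i) (e i))) (\<Sum>i<k. cscale (c i) (e i))"
    by (auto simp: form_levels_def Let_def)
  have csa: "cin (T x) y = cin x (T y)" for x y
    using T by (simp add: compact_positive_def)
  have "j \<le> k \<Longrightarrow> \<exists>g \<mu>. orthonormal j g \<and> (\<forall>i<j. r \<le> \<mu> i \<and> T (g i) = \<mu> i *\<^sub>R g i)" for j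
  proof (induction j)
    case 0
    then show ?case by (auto simp: orthonormal_def)
  next
    case (Suc j)
    then obtain g \<mu> where g: "orthonormal j g"
      and ev: "\<And>i. i < j \<Longrightarrow> r \<le> \<mu> i" "\<And>i. i < j \<Longrightarrow> T (g i) = \<mu> i *\<^sub>R g i"
      by auto
    define W where "W = {x. \<forall>i\<in>{..<j}. cin x (g i) = 0}"
    \<comment> \<open>Each complex orthogonality condition splits into two real ones, from which
      closedness can be read off.\<close>
    have W_alt: "W = (\<Inter>i\<in>{..<j}. {x. inner x (g i) = 0} \<inter> {x. inner x (cscale \<i> (g i)) = 0})"
      unfolding W_def by (auto simp: complex_eq_iff Im_cin inner_ell2_def[symmetric])
    have "closed W"
      unfolding W_alt by (intro closed_INT ballI closed_Int closed_Collect_eq continuous_intros)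
    moreover have "subspace W"
      by (auto simp: subspace_def W_def cin_add_left scaleR_ell2_def)
    moreover have "T x \<in> W" if "x \<in> W" for x
      using that by (auto simp: W_def csa ev scaleR_ell2_def)
    moreover obtain c where c: "(\<Sum>i<k. cscale (c i) (e i)) \<noteq> 0" "(\<Sum>i<k. cscale (c i) (e i)) \<in> W"
      using orthonormal_lincomb_vanishing[OF e, of "{..<j}" "\<lambda>i x. cin x (g i)"] Suc.prems
      unfolding W_def by (auto simp: cin_sum_left)
    define x where "x = (\<Sum>i<k. cscale (c i) (e i))"
    define u where "u = x /\<^sub>R norm x"
    have x: "x \<noteq> 0" "x \<in> W" "r * (norm x)\<^sup>2 \<le> inner (T x) x"
      using c form[of c] by (auto simp: x_def)
    have "u \<in> W" "norm u = 1"
      using x \<open>subspace W\<close> by (auto simp: u_def subspace_scale)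
    moreover have "r \<le> inner (T u) u"
      using x(1,3) by (simp add: u_def blinfun.scaleR_right field_simps power2_eq_square)
    ultimately obtain f \<nu> where f: "f \<in> W" "norm f = 1" "r \<le> \<nu>" "T f = \<nu> *\<^sub>R f"
      using compact_form_max_eigenvector[of T W u r] T r
      unfolding compact_positive_def inner_ell2_def by metis
    have fg: "cin f (g i) = 0" "cin (g i) f = 0" if "i < j" for i
      using f(1) that cin_commute[of "g i" f] by (auto simp: W_def)
    have "orthonormal (Suc j) (g(j := f))"
      using g fg f(2) by (auto simp: orthonormal_def less_Suc_eq cin_self_norm)
    moreover have "\<forall>i<Suc j. r \<le> (\<mu>(j := \<nu>)) i \<and> T ((g(j := f)) i) = (\<mu>(j := \<nu>)) i *\<^sub>R (g(j := f)) i"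
      using ev f by (auto simp: less_Suc_eq)
    ultimately show ?case by blast
  qed
  from this[of k] show "r \<in> eigen_levels T k"
    using r by (auto simp: eigen_levels_def)
qed

definition sval :: "('i ell2 \<Rightarrow>\<^sub>L 'i ell2) \<Rightarrow> nat \<Rightarrow> real"
  where "sval T k = Sup (insert 0 (eigen_levels T k))"

lemma sval_eq_form_levels:
  assumes "compact_positive T"
  shows "sval T k = Sup (insert 0 (form_levels T k))"
  using form_levels_subset_eigen_levels[OF assms, of k] eigen_levels_subset_form_levels[of T k] assms
  unfolding sval_def compact_positive_def by (metis subset_antisym)

lemma form_levels_witness:
  assumes "r \<in> form_levels T k" "k \<ge> 1"
  obtains x where "norm x = 1" "r \<le> inner (T x) x"
proof -
  obtain e where e: "orthonormal k e"
    and form: "\<And>c. r * (norm (\<Sum>i<k. cscale (c i) (e i)))\<^sup>2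
      \<le> inner (T (\<Sum>i<k. cscale (c i) (e i))) (\<Sum>i<k. cscale (c i) (e i))"
    using assms(1) by (auto simp: form_levels_def Let_def)
  obtain c where c: "(\<Sum>i<k. cscale (c i) (e i)) \<noteq> 0"
    using orthonormal_lincomb_vanishing[OF e, of "{}" "\<lambda>_ _. 0"] assms(2) by auto
  let ?x = "\<Sum>i<k. cscale (c i) (e i)"
  show thesis
  proof
    show "norm (?x /\<^sub>R norm ?x) = 1"
      using c by simp
    show "r \<le> inner (T (?x /\<^sub>R norm ?x)) (?x /\<^sub>R norm ?x)"
      using c form[of c] by (simp add: blinfun.scaleR_right field_simps power2_eq_square)
  qed
qed

text \<open>For \<open>k = 0\<close> every positive number is a level, hence the recurring
  assumption \<open>k \<ge> 1\<close>.\<close>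

lemma bdd_above_form_levels:
  assumes "k \<ge> 1"
  shows "bdd_above (insert 0 (form_levels T k))"
proof (rule bdd_aboveI[of _ "norm T"])
  fix r assume "r \<in> insert 0 (form_levels T k)"
  then show "r \<le> norm T"
  proof
    assume "r \<in> form_levels T k"
    then obtain x where "norm x = 1" "r \<le> inner (T x) x"
      using form_levels_witness assms by blast
    then show ?thesis
      using norm_cauchy_schwarz[of "T x" x] norm_blinfun[of T x] by simp
  qed simp
qed

lemma sval_nonneg:
  assumes "compact_positive T" "k \<ge> 1"
  shows "0 \<le> sval T k"
  unfolding sval_eq_form_levels[OF assms(1)]
  using bdd_above_form_levels[OF assms(2)] by (intro cSup_upper) auto

text \<open>Weyl's monotonicity: an orthonormal family witnessing level \<open>r\<close> for
  \<open>T\<close> witnesses level \<open>r - \<epsilon>\<close> for \<open>T'\<close>. Applied in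
  both directions it gives the Lipschitz bound in the operator norm.\<close>

lemma sval_le_add:
  fixes T T' :: "'i ell2 \<Rightarrow>\<^sub>L 'i ell2"
  assumes T: "compact_positive T" "compact_positive T'" and k: "k \<ge> 1" and eps: "0 \<le> \<epsilon>"
    and le: "\<And>x. inner (T x) x \<le> inner (T' x) x + \<epsilon> * (norm x)\<^sup>2"
  shows "sval T k \<le> sval T' k + \<epsilon>"
  unfolding sval_eq_form_levels[OF T(1)]
proof (rule cSup_least)
  fix r assume "r \<in> insert 0 (form_levels T k)"
  \<comment> \<open>Levels are positive by definition, so \<open>r - \<epsilon>\<close> can be a
    level only when \<open>r\<close> exceeds \<open>\<epsilon>\<close>; smaller \<open>r\<close> are
    covered by nonnegativity of \<open>sval\<close>.\<close>
  then consider "r \<le> \<epsilon>" | "r \<in> form_levels T k" "\<epsilon> < r"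
    using eps by fastforce
  then show "r \<le> sval T' k + \<epsilon>"
  proof cases
    case 1
    then show ?thesis using sval_nonneg[OF T(2) k] by simp
  next
    case 2
    have "r - \<epsilon> \<in> form_levels T' k"
    proof -
      have "(r - \<epsilon>) * (norm x)\<^sup>2 \<le> inner (T' x) x" if "r * (norm x)\<^sup>2 \<le> inner (T x) x" for x
        using le[of x] that by (simp add: algebra_simps)
      then show ?thesis
        using 2 unfolding form_levels_def Let_def by auto
    qed
    then have "r - \<epsilon> \<le> sval T' k"
      unfolding sval_eq_form_levels[OF T(2)]
      by (intro cSup_upper bdd_above_form_levels k) auto
    then show ?thesis by simp
  qed
qed simp

lemma sval_diff_le:
  assumes T: "compact_positive T" "compact_positive T'" and k: "k \<ge> 1"
  shows "\<bar>sval T k - sval T' k\<bar> \<le> norm (T - T')"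
proof -
  have le: "inner (T x) x \<le> inner (T' x) x + norm (T - T') * (norm x)\<^sup>2" for T T' :: "'a ell2 \<Rightarrow>\<^sub>L 'a ell2" and x
  proof -
    have "inner (T x) x - inner (T' x) x = inner ((T - T') x) x"
      by (simp add: blinfun.diff_left inner_diff_left)
    also have "\<dots> \<le> norm ((T - T') x) * norm x"
      by (rule norm_cauchy_schwarz)
    also have "\<dots> \<le> norm (T - T') * norm x * norm x"
      by (intro mult_right_mono norm_blinfun) auto
    finally show ?thesis by (simp add: power2_eq_square mult.assoc)
  qed
  show ?thesis
    using sval_le_add[OF T k norm_ge_zero[of "T - T'"] le[of T _ T']]
      sval_le_add[OF T(2,1) k norm_ge_zero[of "T' - T"] le[of T' _ T]]
    by (simp add: norm_minus_commute)
qed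

text \<open>If \<open>k\<close> exceeds the size of \<open>N\<close>, any orthonormal family of
  length \<open>k\<close> spans a nonzero \<open>x\<close> such that \<open>Q x\<close> vanishes on
  \<open>N\<close>; there the multiplier is at most \<open>b\<close>, so no level can exceed the
  square of \<open>b\<close>.\<close>

lemma sval_le_multiplier:
  fixes T Q :: "'i ell2 \<Rightarrow>\<^sub>L 'i ell2"
  assumes T: "compact_positive T" and k: "k \<ge> 1"
    and Q: "norm Q \<le> 1" "\<And>z x. Q (cscale z x) = cscale z (Q x)"
    and le: "\<And>x. inner (T x) x \<le> (norm (diag m (Q x)))\<^sup>2"
    and m: "\<And>i. cmod (m i) \<le> B"
    and N: "finite N" "card N < k" "\<And>i. i \<notin> N \<Longrightarrow> cmod (m i) \<le> b" "0 \<le> b"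
  shows "sval T k \<le> b\<^sup>2"
  unfolding sval_eq_form_levels[OF T]
proof (rule cSup_least)
  fix r assume "r \<in> insert 0 (form_levels T k)"
  then show "r \<le> b\<^sup>2"
  proof
    assume "r \<in> form_levels T k"
    then obtain e where e: "orthonormal k e"
      and form: "\<And>c. r * (norm (\<Sum>i<k. cscale (c i) (e i)))\<^sup>2
        \<le> inner (T (\<Sum>i<k. cscale (c i) (e i))) (\<Sum>i<k. cscale (c i) (e i))"
      by (auto simp: form_levels_def Let_def)
    obtain c where c: "(\<Sum>i<k. cscale (c i) (e i)) \<noteq> 0" "\<forall>j\<in>N. nth2 (Q (\<Sum>i<k. cscale (c i) (e i))) j = 0"
      using orthonormal_lincomb_vanishing[OF e N(1,2), of "\<lambda>j x. nth2 (Q x) j"]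
      by (auto simp: blinfun.sum_right Q(2))
    define x where "x = (\<Sum>i<k. cscale (c i) (e i))"
    have "diag m (Q x) = (diag m - (diag m o\<^sub>L cut N)) (Q x)"
      using c(2) m by (intro ell2_eqI) (auto simp: x_def blinfun.diff_left nth2_diag[where B=B])
    then have "norm (diag m (Q x)) \<le> norm (diag m - (diag m o\<^sub>L cut N)) * norm (Q x)"
      by (metis norm_blinfun)
    also have "\<dots> \<le> b * (1 * norm x)"
    proof (intro mult_mono norm_diag_cut_le[of m B])
      show "norm (Q x) \<le> 1 * norm x"
        using norm_blinfun[of Q x] Q(1) by (meson mult_right_mono norm_ge_zero order_trans)
    qed (use m N in auto)
    finally have "(norm (diag m (Q x)))\<^sup>2 \<le> (b * norm x)\<^sup>2"
      by (intro power_mono) auto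
    then have "r * (norm x)\<^sup>2 \<le> b\<^sup>2 * (norm x)\<^sup>2"
      using form[of c] le[of x] by (simp add: x_def power_mult_distrib)
    then show ?thesis
      using c(1) by (simp add: x_def)
  qed simp
qed simp

lemma borel_measurable_cnj [measurable]:
  assumes "f \<in> borel_measurable M"
  shows "(\<lambda>x. cnj (f x)) \<in> borel_measurable M"
proof -
  have "cnj \<in> borel_measurable borel"
    by (intro borel_measurable_continuous_onI continuous_intros)
  from measurable_compose[OF assms this] show ?thesis .
qed

subsection \<open>Square-integrable functions on the box\<close>

text \<open>Members of \<open>L2\<close> are functions on the whole space whose values matter only
  on the box; the restricted measure replaces set integrals by ordinary ones.\<close>

abbreviation Mbox :: "real \<Rightarrow> (real^'d) measure"
  where "Mbox L \<equiv> lebesgue_on (sqbox L)"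

lemma sqbox_eq_cbox: "sqbox L = cbox (\<chi> i. - (2 * L)) (\<chi> i. 2 * L)"
  unfolding set_eq_iff by (simp add: sqbox_def cube_def mem_box_cart abs_le_iff minus_le_iff conj_commute)

lemma sqbox_sets [simp, measurable]: "sqbox L \<in> sets lebesgue"
  by (simp add: sqbox_eq_cbox)

lemma sqbox_lmeasurable [simp]: "sqbox L \<in> lmeasurable"
  by (simp add: sqbox_eq_cbox)

lemma finite_measure_Mbox: "finite_measure (Mbox L)"
  by (rule finite_measure_lebesgue_on) simp

lemma Mbox_measurable: "f \<in> borel_measurable lebesgue \<Longrightarrow> f \<in> borel_measurable (Mbox L)"
  by (rule measurable_restrict_space1)

lemma ip_eq: "ip L f g = (LINT x|Mbox L. f x * cnj (g x))"
  unfolding ip_def set_lebesgue_integral_def by (subst integral_restrict_space) auto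

lemma L2_iff: "f \<in> L2 L \<longleftrightarrow> f \<in> borel_measurable lebesgue \<and> integrable (Mbox L) (\<lambda>x. (cmod (f x))\<^sup>2)"
  unfolding L2_def set_integrable_def by (subst integrable_restrict_space) auto

lemma AE_Mbox: "(AE x in Mbox L. P x) \<longleftrightarrow> (AE x in lebesgue. x \<in> sqbox L \<longrightarrow> P x)"
  by (rule AE_restrict_space_iff) simp

lemma L2_measurable [measurable_dest]: "f \<in> L2 L \<Longrightarrow> f \<in> borel_measurable lebesgue"
  by (simp add: L2_iff)

lemma L2_measurable_Mbox: "f \<in> L2 L \<Longrightarrow> f \<in> borel_measurable (Mbox L)"
  by (intro Mbox_measurable L2_measurable)

lemma L2_prod_integrable:
  assumes "f \<in> L2 L" "g \<in> L2 L"
  shows "integrable (Mbox L) (\<lambda>x. f x * cnj (g x))"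
proof (rule Bochner_Integration.integrable_bound)
  show "integrable (Mbox L) (\<lambda>x. (cmod (f x))\<^sup>2 + (cmod (g x))\<^sup>2)"
    using assms by (intro Bochner_Integration.integrable_add) (auto simp: L2_iff)
  note [measurable] = assms[THEN L2_measurable_Mbox]
  show "(\<lambda>x. f x * cnj (g x)) \<in> borel_measurable (Mbox L)"
    by measurable
  have "cmod (f x) * cmod (g x) \<le> (cmod (f x))\<^sup>2 + (cmod (g x))\<^sup>2" for x
    using sum_squares_bound[of "cmod (f x)" "cmod (g x)"] mult_nonneg_nonneg[of "cmod (f x)" "cmod (g x)"]
    by (simp del: mult_nonneg_nonneg)
  then show "AE x in Mbox L. norm (f x * cnj (g x)) \<le> norm ((cmod (f x))\<^sup>2 + (cmod (g x))\<^sup>2)"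
    by (simp add: norm_mult)
qed

lemma L2_bounded:
  assumes "f \<in> borel_measurable lebesgue" "\<And>x. cmod (f x) \<le> B"
  shows "f \<in> L2 L"
  unfolding L2_iff
proof (intro conjI assms)
  interpret finite_measure "Mbox L" by (rule finite_measure_Mbox)
  note [measurable] = Mbox_measurable[OF assms(1)]
  show "integrable (Mbox L) (\<lambda>x. (cmod (f x))\<^sup>2)"
    by (rule integrable_const_bound[of _ "B\<^sup>2"]) (use assms(2) in \<open>auto intro!: power_mono\<close>)
qed

lemma L2_mult_bounded:
  assumes f: "f \<in> L2 L" and m: "m \<in> borel_measurable lebesgue" "\<And>x. cmod (m x) \<le> B"
  shows "(\<lambda>x. m x * f x) \<in> L2 L"
  unfolding L2_iff
proof
  note [measurable] = L2_measurable[OF f] m(1)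
  show "(\<lambda>x. m x * f x) \<in> borel_measurable lebesgue"
    by measurable
  note [measurable] = Mbox_measurable[OF this]
  show "integrable (Mbox L) (\<lambda>x. (cmod (m x * f x))\<^sup>2)"
  proof (rule Bochner_Integration.integrable_bound)
    show "integrable (Mbox L) (\<lambda>x. B\<^sup>2 * (cmod (f x))\<^sup>2)"
      using f by (intro integrable_mult_right) (simp add: L2_iff)
    show "(\<lambda>x. (cmod (m x * f x))\<^sup>2) \<in> borel_measurable (Mbox L)"
      by measurable
    show "AE x in Mbox L. norm ((cmod (m x * f x))\<^sup>2) \<le> norm (B\<^sup>2 * (cmod (f x))\<^sup>2)"
      using m(2) by (auto simp: norm_mult power_mult_distrib intro!: mult_right_mono power_mono)
  qed
qed

lemma L2_cmult: "f \<in> L2 L \<Longrightarrow> (\<lambda>x. c * f x) \<in> L2 L"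
  by (rule L2_mult_bounded[where B="cmod c"]) auto

lemma L2_add:
  assumes "f \<in> L2 L" "g \<in> L2 L"
  shows "(\<lambda>x. f x + g x) \<in> L2 L"
  unfolding L2_iff
proof
  note [measurable] = assms[THEN L2_measurable]
  show "(\<lambda>x. f x + g x) \<in> borel_measurable lebesgue"
    by measurable
  note [measurable] = Mbox_measurable[OF this]
  show "integrable (Mbox L) (\<lambda>x. (cmod (f x + g x))\<^sup>2)"
  proof (rule Bochner_Integration.integrable_bound)
    show "integrable (Mbox L) (\<lambda>x. 2 * (cmod (f x))\<^sup>2 + 2 * (cmod (g x))\<^sup>2)"
      using assms by (intro Bochner_Integration.integrable_add integrable_mult_right) (auto simp: L2_iff)
    show "(\<lambda>x. (cmod (f x + g x))\<^sup>2) \<in> borel_measurable (Mbox L)"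
      by measurable
    have "(cmod (f x + g x))\<^sup>2 \<le> 2 * (cmod (f x))\<^sup>2 + 2 * (cmod (g x))\<^sup>2" for x
    proof -
      have "(cmod (f x + g x))\<^sup>2 \<le> (cmod (f x) + cmod (g x))\<^sup>2"
        by (intro power_mono norm_triangle_ineq) auto
      also have "\<dots> \<le> 2 * (cmod (f x))\<^sup>2 + 2 * (cmod (g x))\<^sup>2"
        using sum_squares_bound[of "cmod (f x)" "cmod (g x)"] by (simp add: power2_sum)
      finally show ?thesis .
    qed
    then show "AE x in Mbox L. norm ((cmod (f x + g x))\<^sup>2) \<le> norm (2 * (cmod (f x))\<^sup>2 + 2 * (cmod (g x))\<^sup>2)"
      by auto
  qed
qed

lemma L2_diff: "f \<in> L2 L \<Longrightarrow> g \<in> L2 L \<Longrightarrow> (\<lambda>x. f x - g x) \<in> L2 L"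
  using L2_add[of f L "\<lambda>x. (-1) * g x"] L2_cmult[of g L "-1"] by simp

lemma L2_sum: "(\<And>i. i \<in> A \<Longrightarrow> f i \<in> L2 L) \<Longrightarrow> (\<lambda>x. \<Sum>i\<in>A. f i x) \<in> L2 L"
proof (induction A rule: infinite_finite_induct)
  case (insert i A)
  then show ?case using L2_add[of "f i" L "\<lambda>x. \<Sum>i\<in>A. f i x"] by simp
qed (auto intro: L2_bounded[where B=0])

lemma ip_cmult_left: "ip L (\<lambda>x. c * f x) h = c * ip L f h"
  unfolding ip_eq by (simp add: mult.assoc)

lemma ip_commute: "ip L g f = cnj (ip L f g)"
  using Bochner_Integration.integral_cnj[of "Mbox L" "\<lambda>x. f x * cnj (g x)"] by (simp add: ip_eq mult.commute)

lemma ip_diff_left: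
  assumes "f \<in> L2 L" "g \<in> L2 L" "h \<in> L2 L"
  shows "ip L (\<lambda>x. f x - g x) h = ip L f h - ip L g h"
  unfolding ip_eq using assms by (simp add: left_diff_distrib L2_prod_integrable)

lemma ip_sum_left:
  assumes "\<And>i. i \<in> A \<Longrightarrow> f i \<in> L2 L" "h \<in> L2 L"
  shows "ip L (\<lambda>x. \<Sum>i\<in>A. f i x) h = (\<Sum>i\<in>A. ip L (f i) h)"
  unfolding ip_eq using assms by (simp add: sum_distrib_right L2_prod_integrable)

lemma ip_self: "ip L f f = complex_of_real (LINT x|Mbox L. (cmod (f x))\<^sup>2)"
  unfolding ip_eq complex_norm_square[symmetric] by (rule integral_complex_of_real)

lemma ip_cong_AE:
  assumes "f \<in> L2 L" "f' \<in> L2 L" "h \<in> L2 L" "AE x in Mbox L. f x = f' x"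
  shows "ip L f h = ip L f' h"
  unfolding ip_eq
proof (rule integral_cong_AE)
  note [measurable] = assms(1-3)[THEN L2_measurable_Mbox]
  show "(\<lambda>x. f x * cnj (h x)) \<in> borel_measurable (Mbox L)" "(\<lambda>x. f' x * cnj (h x)) \<in> borel_measurable (Mbox L)"
    by measurable
qed (use assms(4) in auto)

lemma ip_Cauchy_Schwarz:
  assumes f: "f \<in> L2 L" and g: "g \<in> L2 L"
  shows "(cmod (ip L f g))\<^sup>2 \<le> Re (ip L f f) * Re (ip L g g)"
proof -
  define x where "x = cmod (ip L f g)"
  define a where "a = Re (ip L f f)"
  define b where "b = Re (ip L g g)"
  have a_eq: "a = (LINT x|Mbox L. (cmod (f x))\<^sup>2)" and b_eq: "b = (LINT x|Mbox L. (cmod (g x))\<^sup>2)"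
    by (simp_all add: a_def b_def ip_self)
  have a0: "0 \<le> a" and b0: "0 \<le> b" and x0: "0 \<le> x"
    by (simp_all add: a_eq b_eq x_def)
  \<comment> \<open>The arithmetic-geometric inequality, integrated with a free parameter
    \<open>t\<close> to be optimized.\<close>
  have key: "2 * x \<le> t * a + b / t" if "t > 0" for t
  proof -
    have "2 * x \<le> 2 * (LINT x|Mbox L. cmod (f x * cnj (g x)))"
      unfolding x_def ip_eq by simp
    also have "\<dots> = (LINT x|Mbox L. 2 * cmod (f x * cnj (g x)))"
      by simp
    also have "\<dots> \<le> (LINT x|Mbox L. t * (cmod (f x))\<^sup>2 + (1/t) * (cmod (g x))\<^sup>2)"
    proof (rule integral_mono)
      show "integrable (Mbox L) (\<lambda>x. 2 * cmod (f x * cnj (g x)))"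
        using L2_prod_integrable[OF f g] by (intro integrable_mult_right integrable_norm)
      show "integrable (Mbox L) (\<lambda>x. t * (cmod (f x))\<^sup>2 + (1/t) * (cmod (g x))\<^sup>2)"
        using f g by (intro Bochner_Integration.integrable_add integrable_mult_right) (auto simp: L2_iff)
      show "2 * cmod (f x * cnj (g x)) \<le> t * (cmod (f x))\<^sup>2 + (1/t) * (cmod (g x))\<^sup>2" for x
        using sum_squares_bound[of "sqrt t * cmod (f x)" "cmod (g x) / sqrt t"] \<open>t > 0\<close>
        by (simp add: norm_mult power_mult_distrib power_divide)
    qed
    also have "\<dots> = t * a + b / t"
      unfolding a_eq b_eq using f g by (subst Bochner_Integration.integral_add) (auto simp: L2_iff)
    finally show ?thesis .
  qed
  have "x\<^sup>2 \<le> a * b"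
  proof (cases "x = 0")
    case False
    then have x: "x > 0" using x0 by simp
    show ?thesis
    proof (cases "a = 0")
      case True
      \<comment> \<open>With \<open>a = 0\<close> only \<open>b / t\<close> is left, and this
        \<open>t\<close> makes it smaller than \<open>x\<close>; the added 1 keeps \<open>t\<close>
        positive when \<open>b = 0\<close>.\<close>
      have "b * x + x * 2 \<le> 0"
        using True key[of "(b + 1) / x"] x b0 by (simp add: field_simps)
      moreover have "0 \<le> b * x"
        using b0 x by simp
      ultimately show ?thesis
        using x by linarith
    next
      case False
      \<comment> \<open>The choice \<open>t = x / a\<close> turns the bound into
        \<open>2 * x \<le> x + a * b / x\<close>.\<close>
      then show ?thesis
        using key[of "x / a"] x a0 by (simp add: field_simps power2_eq_square)
    qed
  qed (use a0 b0 in simp)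
  then show ?thesis
    by (simp add: x_def a_def b_def)
qed

subsection \<open>Orthonormality of the exponentials\<close>

lemma phi_eq_exp_prod: "phi L k x = complex_of_real ((4*L) powr (- real CARD('d) / 2)) *
   (\<Prod>l\<in>UNIV. cis (pi / (2*L) * real_of_int (k$l) * x$l))" for k :: "int^'d"
  by (simp add: phi_def cis_conv_exp exp_sum[symmetric] sum_distrib_left mult_ac)

lemma phi_measurable [measurable]: "phi L k \<in> borel_measurable borel"
  unfolding phi_def by measurable

lemma norm_phi: "cmod (phi L k x) = (4*L) powr (- real CARD('d) / 2)" for k :: "int^'d"
  unfolding phi_eq_exp_prod by (simp add: norm_mult prod_norm[symmetric])

lemma phi_L2 [simp]: "phi L k \<in> L2 L"
  by (rule L2_bounded[where B="(4*L) powr (- real CARD('d) / 2)"])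
    (auto simp: norm_phi intro!: measurable_completion)

lemma integral_cis_interval:
  assumes "L > 0"
  shows "(LINT t|lborel. indicator {-(2*L)..2*L} t *\<^sub>R cis (pi / (2*L) * real_of_int n * t))
     = (if n = 0 then complex_of_real (4*L) else 0)"
proof (cases "n = 0")
  case True
  then show ?thesis using assms by (simp add: scaleR_conv_of_real)
next
  case False
  define c where "c = pi / (2*L) * real_of_int n"
  have c: "c \<noteq> 0" using False assms by (simp add: c_def)
  define F where "F = (\<lambda>t. cis (c * t) / (\<i> * complex_of_real c))"
  have "(LINT t|lborel. indicator {-(2*L)..2*L} t *\<^sub>R cis (c * t)) = F (2*L) - F (-(2*L))"
  proof (rule integral_FTC_Icc)
    show "-(2*L) \<le> 2*L" using assms by simp
    show "(F has_vector_derivative cis (c * t)) (at t within {-(2*L)..2*L})" for t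
    proof -
      have "((\<lambda>z. exp (\<i> * complex_of_real c * z) / (\<i> * complex_of_real c)) has_field_derivative
          exp (\<i> * complex_of_real c * complex_of_real t)) (at (complex_of_real t))"
        using c by (auto intro!: derivative_eq_intros)
      from has_vector_derivative_real_field[OF this]
      show ?thesis
        by (simp add: F_def cis_conv_exp mult.assoc)
    qed
    show "continuous_on {-(2*L)..2*L} (\<lambda>t. cis (c * t))"
      by (intro continuous_intros)
  qed
  \<comment> \<open>The interval has length \<open>4*L\<close>, so the phase changes by
    \<open>2 * pi * n\<close>, a whole number of turns.\<close>
  also have "cis (c * (2*L)) = cis (c * (-(2*L)))"
  proof -
    have "cis (c * (2*L)) = cis (c * (-(2*L))) * cis (2 * pi * real_of_int n)"
      unfolding cis_mult using assms by (simp add: c_def)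
    then show ?thesis by (simp add: cis_multiple_2pi)
  qed
  then have "F (2*L) - F (-(2*L)) = 0"
    by (simp add: F_def)
  finally show ?thesis using False by (simp add: c_def)
qed

text \<open>\<open>lborel\<close> on vectors is the image of a product measure indexed by
  \<open>Basis\<close>. The factors are therefore reindexed from coordinates to the unit vectors
  \<open>axis l 1\<close> before Fubini for finite products applies.\<close>

lemma integral_lborel_vec_prod:
  fixes f :: "'d::finite \<Rightarrow> real \<Rightarrow> complex"
  assumes f: "\<And>l. integrable lborel (f l)"
  shows "(LINT x|(lborel :: (real^'d) measure). (\<Prod>l\<in>UNIV. f l (x$l))) = (\<Prod>l\<in>UNIV. LINT t|lborel. f l t)"
proof -
  define g where "g = (\<lambda>b::real^'d. f (SOME l. b = axis l 1))"
  have ax: "(SOME j. axis l (1::real) = axis j 1) = l" for l :: 'd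
    by (metis (mono_tags, lifting) axis_eq_axis someI_ex zero_neq_one)
  have inj: "inj (\<lambda>l::'d. axis l (1::real))"
    by (auto simp: inj_on_def axis_eq_axis)
  have Basis: "(Basis :: (real^'d) set) = range (\<lambda>l. axis l 1)"
    by (auto simp: Basis_vec_def)
  have re: "(\<Prod>b\<in>Basis. h (g b) b) = (\<Prod>l\<in>UNIV. h (f l) (axis l 1))" for h :: "_ \<Rightarrow> real^'d \<Rightarrow> complex"
    unfolding Basis by (subst prod.reindex[OF inj]) (simp add: g_def ax)
  interpret product_sigma_finite "\<lambda>b::real^'d. (lborel :: real measure)"
    by unfold_locales
  have gm: "g b \<in> borel_measurable borel" for b
    using f[THEN borel_measurable_integrable] by (simp add: g_def)
  have "(LINT x|(lborel :: (real^'d) measure). (\<Prod>l\<in>UNIV. f l (x$l)))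
      = (LINT x|(lborel :: (real^'d) measure). (\<Prod>b\<in>Basis. g b (inner x b)))"
    using re[of "\<lambda>f b. f (inner _ b)"] by (simp add: inner_axis)
  also have "\<dots> = (LINT y|(\<Pi>\<^sub>M b\<in>(Basis :: (real^'d) set). lborel). (\<Prod>b\<in>Basis. g b (inner (\<Sum>b\<in>Basis. y b *\<^sub>R b) b)))"
    unfolding lborel_eq[where 'a="real^'d"]
    by (rule integral_distr) (use gm in \<open>measurable\<close>)
  also have "\<dots> = (LINT y|(\<Pi>\<^sub>M b\<in>(Basis :: (real^'d) set). lborel). (\<Prod>b\<in>Basis. g b (y b)))"
    by (intro Bochner_Integration.integral_cong prod.cong refl) (simp add: inner_sum_left_Basis)
  also have "\<dots> = (\<Prod>b\<in>Basis. LINT t|lborel. g b t)"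
    by (rule product_integral_prod) (auto simp: g_def f)
  also have "\<dots> = (\<Prod>l\<in>UNIV. LINT t|lborel. f l t)"
    using re[of "\<lambda>f b. LINT t|lborel. f t"] by simp
  finally show ?thesis .
qed

lemma ip_phi_phi:
  fixes k j :: "int^'d"
  assumes "L > 0"
  shows "ip L (phi L k) (phi L j) = (if k = j then 1 else 0)"
proof -
  define f where "f = (\<lambda>(l::'d) t. indicator {-(2*L)..2*L} t *\<^sub>R cis (pi / (2*L) * real_of_int (k$l - j$l) * t))"
  define C where "C = (4*L) powr (- real CARD('d) / 2)"
  \<comment> \<open>\<open>C\<close> normalizes a single exponential; two such factors cancel the
    volume of the box.\<close>
  have CC: "C * C * (4*L) ^ CARD('d) = 1"
  proof -
    have "C * C = (4*L) powr (- real CARD('d))"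
      by (simp add: C_def powr_add[symmetric])
    then show ?thesis
      using assms by (simp add: powr_minus powr_realpow field_simps)
  qed
  have f_int: "integrable lborel (f l)" for l
    unfolding f_def
    by (rule borel_integrable_atLeastAtMost'[unfolded set_integrable_def]) (intro continuous_intros)
  have ind: "indicator (sqbox L) x = (\<Prod>l\<in>UNIV. indicator {-(2*L)..2*L} (x$l) :: real)" for x :: "real^'d"
    by (auto simp: sqbox_eq_cbox mem_box_cart indicator_def)
  have pt: "indicator (sqbox L) x *\<^sub>R (phi L k x * cnj (phi L j x)) = complex_of_real (C * C) * (\<Prod>l\<in>UNIV. f l (x$l))" for x
  proof -
    have "phi L k x * cnj (phi L j x) = complex_of_real (C * C) *
        (\<Prod>l\<in>UNIV. cis (pi / (2*L) * real_of_int (k$l - j$l) * x$l))"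
      unfolding phi_eq_exp_prod C_def[symmetric]
      by (simp add: cis_cnj cis_mult prod.distrib[symmetric] algebra_simps)
    then show ?thesis
      unfolding ind f_def by (simp add: scaleR_conv_of_real prod.distrib)
  qed
  have "ip L (phi L k) (phi L j) = (LINT x|lebesgue. complex_of_real (C * C) * (\<Prod>l\<in>UNIV. f l (x$l)))"
    unfolding ip_def set_lebesgue_integral_def pt ..
  also have "\<dots> = complex_of_real (C * C) * (LINT x|lborel. (\<Prod>l\<in>UNIV. f l ((x::real^'d)$l)))"
  proof -
    have [measurable]: "f l \<in> borel_measurable borel" for l
      using f_int[THEN borel_measurable_integrable] by simp
    show ?thesis
      by (subst integral_completion) (simp_all, measurable)
  qed
  also have "\<dots> = complex_of_real (C * C) * (\<Prod>l\<in>UNIV. if k$l - j$l = 0 then complex_of_real (4*L) else 0)"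
    unfolding integral_lborel_vec_prod[OF f_int] unfolding f_def integral_cis_interval[OF assms] ..
  also have "\<dots> = (if k = j then 1 else 0)"
  proof (cases "k = j")
    case True
    then show ?thesis
      using CC by (simp flip: of_real_mult of_real_power)
  next
    case False
    then obtain l where "k$l \<noteq> j$l" by (auto simp: vec_eq_iff)
    then show ?thesis
      using False by (auto intro!: bexI[of _ l])
  qed
  finally show ?thesis .
qed

subsection \<open>Completeness of the exponentials\<close>

text \<open>The exponentials without their normalizing factor: as characters they multiply to
  characters, so their span is an algebra.\<close>

definition trigE :: "real \<Rightarrow> int^'d \<Rightarrow> real^'d \<Rightarrow> complex" where
  "trigE L k x = (\<Prod>l\<in>UNIV. cis (pi / (2*L) * real_of_int (k$l) * x$l))"

lemma phi_eq_trigE: "phi L k x = complex_of_real ((4*L) powr (- real CARD('d) / 2)) * trigE L k x"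
  for k :: "int^'d"
  by (simp add: phi_eq_exp_prod trigE_def)

lemma trigE_add: "trigE L (k + j) x = trigE L k x * trigE L j x"
  by (simp add: trigE_def cis_mult prod.distrib[symmetric] algebra_simps)

lemma trigE_0 [simp]: "trigE L 0 x = 1"
  by (simp add: trigE_def)

lemma cnj_trigE: "cnj (trigE L k x) = trigE L (- k) x"
  by (simp add: trigE_def cis_cnj)

lemma trigE_axis: "trigE L (axis l n) x = cis (pi / (2*L) * real_of_int n * x$l)"
proof -
  have "trigE L (axis l n) x = (\<Prod>j\<in>UNIV. if j = l then cis (pi / (2*L) * real_of_int n * x$l) else 1)"
    unfolding trigE_def by (intro prod.cong) (auto simp: axis_def)
  then show ?thesis by simp
qed

inductive_set trig_poly :: "real \<Rightarrow> (real^'d \<Rightarrow> complex) set" for L where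
  mono: "(\<lambda>x. c * trigE L k x) \<in> trig_poly L"
| add: "p \<in> trig_poly L \<Longrightarrow> q \<in> trig_poly L \<Longrightarrow> (\<lambda>x. p x + q x) \<in> trig_poly L"

lemma trig_poly_const: "(\<lambda>x. c) \<in> trig_poly L"
  using trig_poly.mono[of c L 0] by simp

lemma trig_poly_mult:
  assumes "p \<in> trig_poly L" "q \<in> trig_poly L"
  shows "(\<lambda>x. p x * q x) \<in> trig_poly L"
  using assms(1)
proof induction
  case (mono c k)
  show ?case
    using assms(2)
  proof induction
    case (mono d j)
    have "(\<lambda>x. c * trigE L k x * (d * trigE L j x)) = (\<lambda>x. (c * d) * trigE L (k + j) x)"
      by (simp add: trigE_add mult_ac)
    then show ?case by (simp only: trig_poly.mono)
  next
    case (add p q)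
    then show ?case using trig_poly.add by (simp only: distrib_left) blast
  qed
next
  case (add p q)
  then show ?case using trig_poly.add by (simp only: distrib_right) blast
qed

lemma trig_poly_sum: "(\<And>i. i \<in> A \<Longrightarrow> p i \<in> trig_poly L) \<Longrightarrow> (\<lambda>x. \<Sum>i\<in>A. p i x) \<in> trig_poly L"
proof (induction A rule: infinite_finite_induct)
  case (insert i A)
  then show ?case using trig_poly.add[of "p i" L "\<lambda>x. \<Sum>i\<in>A. p i x"] by simp
qed (simp_all add: trig_poly_const)

text \<open>Periodicity is encoded by passing to the torus in complex coordinates. Polynomials in
  the real and imaginary parts of these coordinates pull back to trigonometric polynomials, so
  Stone-Weierstrass on a compact set is available.\<close>

definition torus_map :: "real \<Rightarrow> real^'d \<Rightarrow> complex^'d" where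
  "torus_map L x = (\<chi> l. cis (pi / (2*L) * x$l))"

lemma trig_poly_cos_sin:
  "(\<lambda>x. complex_of_real (cos (pi / (2*L) * x$l))) \<in> trig_poly L"
  "(\<lambda>x. complex_of_real (sin (pi / (2*L) * x$l))) \<in> trig_poly L"
proof -
  have "(\<lambda>x. complex_of_real (cos (pi / (2*L) * x$l)))
      = (\<lambda>x. (1/2) * trigE L (axis l 1) x + (1/2) * trigE L (axis l (-1)) x)"
    by (simp add: fun_eq_iff trigE_axis complex_eq_iff)
  then show "(\<lambda>x. complex_of_real (cos (pi / (2*L) * x$l))) \<in> trig_poly L"
    by (simp only: trig_poly.intros)
  have "(\<lambda>x. complex_of_real (sin (pi / (2*L) * x$l)))
      = (\<lambda>x. (-\<i>/2) * trigE L (axis l 1) x + (\<i>/2) * trigE L (axis l (-1)) x)"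
    by (simp add: fun_eq_iff trigE_axis complex_eq_iff)
  then show "(\<lambda>x. complex_of_real (sin (pi / (2*L) * x$l))) \<in> trig_poly L"
    by (simp only: trig_poly.intros)
qed

lemma bounded_linear_complex_vec_expand:
  fixes f :: "complex^'d \<Rightarrow> real"
  assumes "bounded_linear f"
  shows "f z = (\<Sum>l\<in>UNIV. f (axis l 1) * Re (z$l) + f (axis l \<i>) * Im (z$l))"
proof -
  interpret bounded_linear f by fact
  have "z = (\<Sum>l\<in>UNIV. Re (z$l) *\<^sub>R axis l 1 + Im (z$l) *\<^sub>R axis l \<i>)"
    by (auto simp: vec_eq_iff axis_def sum.distrib if_distrib complex_eq_iff cong: if_cong)
  then have "f z = f (\<Sum>l\<in>UNIV. Re (z$l) *\<^sub>R axis l 1 + Im (z$l) *\<^sub>R axis l \<i>)"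
    by simp
  then show ?thesis
    by (simp add: sum add scaleR mult.commute)
qed

lemma real_polynomial_trig_poly:
  assumes "real_polynomial_function p"
  shows "(\<lambda>x. complex_of_real (p (torus_map L x))) \<in> trig_poly L"
  using assms
proof induction
  case (linear f)
  have "(\<lambda>x. complex_of_real (f (torus_map L x))) = (\<lambda>x. \<Sum>l\<in>UNIV.
      complex_of_real (f (axis l 1)) * complex_of_real (cos (pi / (2*L) * x$l)) +
      complex_of_real (f (axis l \<i>)) * complex_of_real (sin (pi / (2*L) * x$l)))"
    by (subst bounded_linear_complex_vec_expand[OF linear]) (simp add: torus_map_def)
  also have "\<dots> \<in> trig_poly L"
    by (intro trig_poly_sum trig_poly.add trig_poly_mult trig_poly_const trig_poly_cos_sin)
  finally show ?case .
next
  case (const c)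
  then show ?case by (simp add: trig_poly_const)
next
  case (add f g)
  then show ?case by (simp add: trig_poly.add)
next
  case (mult f g)
  then show ?case by (simp add: trig_poly_mult)
qed

lemma L2_integrable:
  assumes "f \<in> L2 L"
  shows "integrable (Mbox L) f"
proof -
  have "(\<lambda>_. 1) \<in> L2 L"
    by (rule L2_bounded[where B=1]) auto
  from L2_prod_integrable[OF assms this] show ?thesis by simp
qed

lemma torus_map_measurable: "torus_map L \<in> borel_measurable borel"
  unfolding torus_map_def by (intro borel_measurable_continuous_onI continuous_intros)

lemma compact_torus: "compact {z :: complex^'d. \<forall>l. cmod (z$l) = 1}"
proof -
  have "closed {z :: complex^'d. \<forall>l. cmod (z$l) = 1}"
    by (intro closed_Collect_all closed_Collect_eq continuous_intros)
  moreover have "bounded {z :: complex^'d. \<forall>l. cmod (z$l) = 1}"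
    unfolding bounded_iff
  proof (intro exI ballI)
    fix z :: "complex^'d" assume "z \<in> {z. \<forall>l. cmod (z$l) = 1}"
    then show "norm z \<le> (\<Sum>l\<in>(UNIV::'d set). 1)"
      using L2_set_le_sum[of UNIV "\<lambda>l. cmod (z$l)"] by (simp add: norm_vec_def)
  qed
  ultimately show ?thesis by (simp add: compact_eq_bounded_closed)
qed

text \<open>The torus glues opposite faces, so one of the points has to lie in the open box:
  coordinates then differ by less than the period \<open>4*L\<close>.\<close>

lemma torus_map_inj:
  assumes L: "L > 0" and x: "x \<in> sqbox L" and y: "y \<in> box (\<chi> i. - (2 * L)) (\<chi> i. 2 * L)" and eq: "torus_map L x = torus_map L y"
  shows "x = y"
proof -
  have "x$l = y$l" for l
  proof -
    have "cis (pi / (2*L) * x$l) = cis (pi / (2*L) * y$l)"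
      using eq by (simp add: torus_map_def vec_eq_iff)
    then have "sin (pi / (2*L) * x$l) = sin (pi / (2*L) * y$l) \<and> cos (pi / (2*L) * x$l) = cos (pi / (2*L) * y$l)"
      by (simp add: complex_eq_iff)
    then obtain n :: int where "pi / (2*L) * x$l = pi / (2*L) * y$l + 2 * pi * of_int n"
      using sin_cos_eq_iff by metis
    then have "pi * x$l = pi * (y$l + 4 * L * of_int n)"
      using L by (simp add: field_simps)
    then have n: "x$l = y$l + 4 * L * of_int n"
      by simp
    have "\<bar>x$l\<bar> \<le> 2*L"
      using x by (auto simp: sqbox_def cube_def)
    moreover have "\<bar>y$l\<bar> < 2*L"
      using y by (simp add: mem_box_cart abs_less_iff minus_less_iff)
    ultimately have "\<bar>4 * L * of_int n\<bar> < 4 * L * 1"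
      using n by linarith
    then have "\<bar>of_int n :: real\<bar> < 1"
      using L by (simp add: abs_mult)
    then have "n = 0" by linarith
    then show ?thesis using n by simp
  qed
  then show ?thesis by (simp add: vec_eq_iff)
qed

text \<open>Inner regularity: if \<open>h\<close> were positive on a set of positive measure, it
  would be positive on a compact set of positive measure, where its integral could not vanish. The
  boundary of the box is a null set.\<close>

lemma real_zero_on_compacts_nonpos:
  fixes h :: "real^'d \<Rightarrow> real"
  assumes hm: "h \<in> borel_measurable lebesgue" and hi: "integrable (Mbox L) h"
    and h0: "\<And>A. compact A \<Longrightarrow> A \<subseteq> box (\<chi> i. - (2 * L)) (\<chi> i. 2 * L) \<Longrightarrow> (LINT x|Mbox L. h x * indicator A x) = 0"
  shows "AE x in Mbox L. h x \<le> 0"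
proof -
  let ?B = "box (\<chi> i. - (2 * L)) (\<chi> i. 2 * L) :: (real^'d) set"
  define E where "E = {x \<in> ?B. h x > 0}"
  have "?B \<in> sets lebesgue" by simp
  then have Em: "E \<in> sets lebesgue"
    unfolding E_def using hm by measurable
  have "E \<in> null_sets lebesgue"
  proof (rule ccontr)
    assume "E \<notin> null_sets lebesgue"
    then have E0: "emeasure lebesgue E > 0"
      using Em by (auto simp: null_sets_def zero_less_iff_neq_zero)
    have Efin: "emeasure lebesgue E < \<infinity>"
    proof -
      have "emeasure lebesgue E \<le> emeasure lebesgue ?B"
        by (rule emeasure_mono) (auto simp: E_def)
      also have "\<dots> < \<infinity>"
        using emeasure_lborel_box_finite[of "\<chi> i. - (2 * L)" "\<chi> i. 2 * L"] by simp
      finally show ?thesis .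
    qed
    define e where "e = enn2real (emeasure lebesgue E)"
    have e: "e > 0" "emeasure lebesgue E = ennreal e"
      using E0 Efin by (auto simp: e_def enn2real_positive_iff)
    \<comment> \<open>The part of \<open>E\<close> outside \<open>A\<close> has less than the
      measure of \<open>E\<close>, so \<open>A\<close> cannot be a null set.\<close>
    obtain A where A: "closed A" "A \<subseteq> E" "emeasure lebesgue (E - A) < ennreal e"
      using sets_lebesgue_inner_closed[OF Em e(1)] by metis
    have "A \<subseteq> ?B" using A(2) by (auto simp: E_def)
    then have Ac: "compact A"
      using A(1) bounded_subset[OF bounded_box] by (auto simp: compact_eq_bounded_closed)
    have Am: "A \<in> sets lebesgue" using Ac by (simp add: borel_compact)
    have "(LINT x|Mbox L. h x * indicator A x) = 0"
      using h0 Ac \<open>A \<subseteq> ?B\<close> by blast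
    moreover have "integrable (Mbox L) (\<lambda>x. h x * indicator A x)"
    proof (rule Bochner_Integration.integrable_bound[OF hi])
      show "(\<lambda>x. h x * indicator A x) \<in> borel_measurable (Mbox L)"
        using hm Am by (intro Mbox_measurable) simp
    qed (auto simp: indicator_def)
    moreover have pos: "0 \<le> h x * indicator A x" for x
      using A(2) by (auto simp: indicator_def E_def)
    ultimately have "AE x in Mbox L. h x * indicator A x = 0"
      using integral_nonneg_eq_0_iff_AE by blast
    then have "AE x in lebesgue. x \<in> sqbox L \<longrightarrow> h x * indicator A x = 0"
      by (simp add: AE_Mbox)
    moreover have "?B \<subseteq> sqbox L"
      unfolding sqbox_eq_cbox by (rule box_subset_cbox)
    ultimately have "AE x in lebesgue. x \<notin> A"
      using A(2) \<open>A \<subseteq> ?B\<close> by (auto simp: E_def indicator_def elim!: eventually_mono split: if_splits)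
    then have "emeasure lebesgue A = 0"
      using AE_iff_measurable[OF Am, of "\<lambda>x. x \<notin> A"] by simp
    then have "emeasure lebesgue E = emeasure lebesgue (E - A)"
      using Em Am by (metis emeasure_Diff_null_set null_setsI)
    then show False using A(3) e by simp
  qed
  moreover have "sqbox L - ?B \<in> null_sets lebesgue"
    unfolding sqbox_eq_cbox using negligible_frontier_interval negligible_iff_null_sets by blast
  ultimately have "E \<union> (sqbox L - ?B) \<in> null_sets lebesgue" by (rule null_sets.Un)
  then have "AE x in lebesgue. x \<notin> E \<union> (sqbox L - ?B)"
    by (rule AE_not_in)
  then show ?thesis
    unfolding AE_Mbox by (rule eventually_mono) (auto simp: E_def not_less)
qed

section \<open>Functions whose Fourier coefficients all vanish\<close>

context
  fixes L :: real and f :: "real^'d \<Rightarrow> complex"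
  assumes L: "L > 0" and f: "f \<in> L2 L" and coef0: "\<And>k. coef L f k = 0"
begin

lemma coef0_trig_poly:
  assumes "p \<in> trig_poly L"
  shows "integrable (Mbox L) (\<lambda>x. f x * p x) \<and> (LINT x|Mbox L. f x * p x) = 0"
  using assms
proof induction
  case (mono c k)
  define C where "C = complex_of_real ((4*L) powr (- real CARD('d) / 2))"
  have C: "C \<noteq> 0" "cnj C = C" using L by (auto simp: C_def)
  have eq: "(\<lambda>x. f x * (c * trigE L k x)) = (\<lambda>x. (c / C) * (f x * cnj (phi L (- k) x)))"
    unfolding phi_eq_trigE C_def[symmetric] using C by (simp add: cnj_trigE mult.left_commute)
  have "(LINT x|Mbox L. f x * cnj (phi L (- k) x)) = 0"
    using coef0[of "- k"] by (simp add: coef_def ip_eq)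
  moreover have "integrable (Mbox L) (\<lambda>x. f x * cnj (phi L (- k) x))"
    by (intro L2_prod_integrable f phi_L2)
  ultimately show ?case unfolding eq by simp
next
  case (add p q)
  then show ?case by (simp add: distrib_left)
qed

text \<open>Uniform approximation by trigonometric polynomials, which integrate to 0 against
  \<open>f\<close>, bounds the integral by \<open>e\<close> times the integral of
  \<open>cmod (f x)\<close>, for every positive \<open>e\<close>.\<close>

lemma coef0_continuous:
  assumes g: "continuous_on UNIV (g :: complex^'d \<Rightarrow> real)"
  shows "(LINT x|Mbox L. f x * complex_of_real (g (torus_map L x))) = 0"
proof -
  let ?I = "LINT x|Mbox L. f x * complex_of_real (g (torus_map L x))"
  let ?X = "{z :: complex^'d. \<forall>l. cmod (z$l) = 1}"
  have tX: "torus_map L x \<in> ?X" for x by (simp add: torus_map_def)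
  have gm: "(\<lambda>x. g (torus_map L x)) \<in> borel_measurable borel"
    by (rule measurable_compose[OF torus_map_measurable]) (rule borel_measurable_continuous_onI[OF g])
  have "continuous_on ?X g" using g continuous_on_subset by blast
  then have "bounded (g ` ?X)"
    using compact_torus compact_imp_bounded compact_continuous_image by blast
  then obtain B where B: "\<And>z. z \<in> ?X \<Longrightarrow> norm (g z) \<le> B"
    by (auto simp: bounded_iff)
  have gL2: "(\<lambda>x. complex_of_real (g (torus_map L x))) \<in> L2 L"
    by (rule L2_bounded[where B=B])
      (use B tX gm in \<open>auto intro!: measurable_completion borel_measurable_of_real\<close>)
  have int_g: "integrable (Mbox L) (\<lambda>x. f x * complex_of_real (g (torus_map L x)))"
    using L2_prod_integrable[OF f gL2] by simp
  have "cmod ?I \<le> e * (LINT x|Mbox L. cmod (f x))" if "e > 0" for e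
  proof -
    obtain p where p: "real_polynomial_function p" "\<And>z. z \<in> ?X \<Longrightarrow> \<bar>g z - p z\<bar> < e"
      using Stone_Weierstrass_real_polynomial_function[OF compact_torus \<open>continuous_on ?X g\<close> \<open>e > 0\<close>] by blast
    let ?p = "\<lambda>x. complex_of_real (p (torus_map L x))"
    have tp: "integrable (Mbox L) (\<lambda>x. f x * ?p x)" "(LINT x|Mbox L. f x * ?p x) = 0"
      using coef0_trig_poly[OF real_polynomial_trig_poly[OF p(1)]] by auto
    have "?I = (LINT x|Mbox L. f x * complex_of_real (g (torus_map L x)) - f x * ?p x)"
      using int_g tp by simp
    also have "cmod \<dots> \<le> (LINT x|Mbox L. e * cmod (f x))"
    proof (rule order_trans[OF integral_norm_bound integral_mono])
      show "integrable (Mbox L) (\<lambda>x. cmod (f x * complex_of_real (g (torus_map L x)) - f x * ?p x))"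
        using int_g tp by (intro integrable_norm) simp
      show "integrable (Mbox L) (\<lambda>x. e * cmod (f x))"
        using L2_integrable[OF f] by simp
      fix x
      have "cmod (f x * complex_of_real (g (torus_map L x)) - f x * ?p x)
          = cmod (f x) * \<bar>g (torus_map L x) - p (torus_map L x)\<bar>"
        by (simp add: right_diff_distrib[symmetric] norm_mult flip: of_real_diff)
      also have "\<dots> \<le> cmod (f x) * e"
        using p(2)[OF tX, of x] by (intro mult_left_mono) auto
      finally show "cmod (f x * complex_of_real (g (torus_map L x)) - f x * ?p x) \<le> e * cmod (f x)"
        by (simp add: mult.commute)
    qed
    finally show ?thesis by simp
  qed
  note le = this
  define J where "J = (LINT x|Mbox L. cmod (f x))"
  have J: "0 \<le> J" by (simp add: J_def)
  show ?thesis
  proof (rule ccontr)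
    assume "?I \<noteq> 0"
    then have I: "0 < cmod ?I" by simp
    \<comment> \<open>The added 1 avoids division by 0 if \<open>J = 0\<close>, and the factor 2
      makes \<open>e * J\<close> strictly smaller than the modulus of the integral.\<close>
    define e where "e = cmod ?I / (2 * (J + 1))"
    have "e > 0"
      using I J by (simp add: e_def)
    then have "cmod ?I \<le> e * J"
      using le by (simp add: J_def)
    also have "e * J < cmod ?I"
      using I J by (simp add: e_def field_simps add_nonneg_pos)
    finally show False by simp
  qed
qed

text \<open>The indicator of \<open>A\<close> is a pointwise limit of continuous functions of the
  torus point, namely steepening tents around the image of \<open>A\<close>. Injectivity of the
  torus map keeps points outside \<open>A\<close> at positive distance from that image.\<close>

lemma coef0_compact:
  assumes A: "compact A" "A \<subseteq> box (\<chi> i. - (2 * L)) (\<chi> i. 2 * L)"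
  shows "(LINT x|Mbox L. f x * indicator A x) = 0"
proof (cases "A = {}")
  case False
  let ?E = "torus_map L ` A"
  have ct: "continuous_on UNIV (torus_map L)"
    unfolding torus_map_def by (intro continuous_intros)
  then have "compact ?E"
    using A(1) continuous_on_subset compact_continuous_image by blast
  then have E: "closed ?E" "?E \<noteq> {}"
    using False by (auto intro: compact_imp_closed)
  define g where "g = (\<lambda>n (z::complex^'d). max 0 (1 - real n * infdist z ?E))"
  have gc: "continuous_on UNIV (g n)" for n
    unfolding g_def by (intro continuous_intros)
  have gm: "(\<lambda>x. g n (torus_map L x)) \<in> borel_measurable (Mbox L)" for n
    by (intro Mbox_measurable measurable_completion)
      (use continuous_on_compose2[OF gc ct] in \<open>simp add: borel_measurable_continuous_onI\<close>)
  note [measurable] = L2_measurable_Mbox[OF f]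
  have Aset: "A \<in> sets lebesgue"
    using A(1) by (simp add: borel_compact)
  then have Am: "indicator A \<in> borel_measurable (Mbox L :: (real^'d) measure)"
    by (intro Mbox_measurable) simp
  have "(\<lambda>n. LINT x|Mbox L. f x * complex_of_real (g n (torus_map L x))) \<longlonglongrightarrow> (LINT x|Mbox L. f x * indicator A x)"
  proof (rule integral_dominated_convergence)
    show "(\<lambda>x. f x * indicator A x) \<in> borel_measurable (Mbox L)"
      using Am Aset by (intro borel_measurable_times) (auto intro!: Mbox_measurable)
    show "(\<lambda>x. f x * complex_of_real (g n (torus_map L x))) \<in> borel_measurable (Mbox L)" for n
      using gm[of n] by measurable
    show "integrable (Mbox L) (\<lambda>x. cmod (f x))"
      using L2_integrable[OF f] by simp
    show "AE x in Mbox L. norm (f x * complex_of_real (g n (torus_map L x))) \<le> cmod (f x)" for n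
    proof (rule AE_I2)
      fix x
      have "0 \<le> g n z" "g n z \<le> 1" for z
        by (auto simp: g_def infdist_nonneg)
      then show "norm (f x * complex_of_real (g n (torus_map L x))) \<le> cmod (f x)"
        by (simp add: norm_mult mult_left_le)
    qed
    show "AE x in Mbox L. (\<lambda>n. f x * complex_of_real (g n (torus_map L x))) \<longlonglongrightarrow> f x * indicator A x"
    proof (rule AE_I2)
      fix x assume "x \<in> space (Mbox L :: (real^'d) measure)"
      then have x: "x \<in> sqbox L" by simp
      have "(\<lambda>n. g n (torus_map L x)) \<longlonglongrightarrow> indicator A x"
      proof (cases "x \<in> A")
        case True
        then have "infdist (torus_map L x) ?E = 0" by simp
        then show ?thesis using True by (simp add: g_def)
      next
        case False
        then have "torus_map L x \<notin> ?E"
          using torus_map_inj[OF L x] A(2) by blast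
        then have d: "infdist (torus_map L x) ?E > 0"
          using infdist_pos_not_in_closed E by blast
        obtain N where N: "real N > 1 / infdist (torus_map L x) ?E"
          using reals_Archimedean2 by blast
        have "g n (torus_map L x) = 0" if "n \<ge> N" for n
        proof -
          have "real n * infdist (torus_map L x) ?E \<ge> real N * infdist (torus_map L x) ?E"
            using that d by (intro mult_right_mono) auto
          moreover have "real N * infdist (torus_map L x) ?E > 1"
            using N d by (simp add: field_simps)
          ultimately show ?thesis unfolding g_def by simp
        qed
        then have "\<forall>\<^sub>F n in sequentially. g n (torus_map L x) = 0"
          by (rule eventually_sequentiallyI)
        then show ?thesis
          using False by (simp add: tendsto_eventually)
      qed
      then have "(\<lambda>n. f x * complex_of_real (g n (torus_map L x))) \<longlonglongrightarrow> f x * complex_of_real (indicator A x)"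
        by (intro tendsto_intros)
      then show "(\<lambda>n. f x * complex_of_real (g n (torus_map L x))) \<longlonglongrightarrow> f x * indicator A x"
        by (cases "x \<in> A") auto
    qed
  qed
  then show ?thesis
    using coef0_continuous[OF gc] by (simp add: LIMSEQ_const_iff)
qed simp

lemma coef0_imp_AE_zero: "AE x in Mbox L. f x = 0"
proof -
  \<comment> \<open>The four values \<open>1\<close>, \<open>-1\<close>, \<open>\<i>\<close>,
    \<open>-\<i>\<close> of \<open>z\<close> bound the real and imaginary parts from both
    sides.\<close>
  have "AE x in Mbox L. Re (z * f x) \<le> 0" for z
  proof (rule real_zero_on_compacts_nonpos)
    note [measurable] = L2_measurable[OF f]
    show "(\<lambda>x. Re (z * f x)) \<in> borel_measurable lebesgue" by measurable
    have int: "integrable (Mbox L) (\<lambda>x. z * f x)"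
      using L2_integrable[OF f] by simp
    then show "integrable (Mbox L) (\<lambda>x. Re (z * f x))" by (rule integrable_Re)
    fix A :: "(real^'d) set" assume A: "compact A" "A \<subseteq> box (\<chi> i. - (2 * L)) (\<chi> i. 2 * L)"
    have Am: "A \<in> sets lebesgue" using A by (simp add: borel_compact)
    have i: "integrable (Mbox L) (\<lambda>x. z * (f x * indicator A x))"
    proof (rule Bochner_Integration.integrable_bound[OF int])
      show "(\<lambda>x. z * (f x * indicator A x)) \<in> borel_measurable (Mbox L)"
        using Am by (intro Mbox_measurable) simp
    qed (auto simp: indicator_def norm_mult)
    have "(LINT x|Mbox L. Re (z * f x) * indicator A x) = (LINT x|Mbox L. Re (z * (f x * indicator A x)))"
      by (intro Bochner_Integration.integral_cong) (auto simp: indicator_def)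
    also have "\<dots> = Re (LINT x|Mbox L. z * (f x * indicator A x))"
      using i by (rule integral_Re)
    also have "\<dots> = 0"
      using coef0_compact[OF A] by simp
    finally show "(LINT x|Mbox L. Re (z * f x) * indicator A x) = 0" .
  qed
  from this[of 1] this[of "-1"] this[of \<i>] this[of "-\<i>"] show ?thesis
    by eventually_elim (auto simp: complex_eq_iff)
qed

end

subsection \<open>The Riesz-Fischer theorem and Parseval's identity\<close>

text \<open>The bound \<open>2 a \<le> 2\<^sup>n a\<^sup>2 + 2\<^sup>-\<^sup>n\<close> makes the increments summable in \<open>L\<^sup>1\<close>, hence almost everywhere;
  Fatou's lemma then transfers the Cauchy estimate to the pointwise limit.\<close>

lemma fast_Cauchy_L2_limit:
  fixes p :: "nat \<Rightarrow> 'a \<Rightarrow> complex"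
  assumes "finite_measure M" and meas: "\<And>n. p n \<in> borel_measurable M"
    and bnd: "\<And>n m. n \<le> m \<Longrightarrow> (\<integral>\<^sup>+x. ennreal ((cmod (p m x - p n x))\<^sup>2) \<partial>M) \<le> ennreal ((1/4)^n)"
  shows "(\<integral>\<^sup>+x. ennreal ((cmod (lim (\<lambda>m. p m x) - p n x))\<^sup>2) \<partial>M) \<le> ennreal ((1/4)^n)"
proof -
  interpret finite_measure M by fact
  note [measurable] = meas
  define V where "V = measure M (space M)"
  define d where "d = (\<lambda>n x. cmod (p (Suc n) x - p n x))"
  have [measurable]: "d n \<in> borel_measurable M" for n
    unfolding d_def by measurable
  have d_int: "(\<integral>\<^sup>+x. ennreal (d n x) \<partial>M) \<le> ennreal ((1 + V) * (1/2)^n)" for n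
  proof -
    have le: "d n x \<le> 2^n * (d n x)\<^sup>2 + (1/2)^n" for x
    proof -
      have "0 \<le> d n x" by (simp add: d_def)
      moreover have "0 \<le> ((2::real)^n * d n x - 1)\<^sup>2 / 2^n"
        by simp
      moreover have "((2::real)^n * d n x - 1)\<^sup>2 / 2^n = 2^n * (d n x)\<^sup>2 - 2 * d n x + (1/2)^n"
        by (simp add: power2_eq_square field_simps power_divide)
      ultimately show ?thesis by linarith
    qed
    have "(\<integral>\<^sup>+x. ennreal (d n x) \<partial>M) \<le> (\<integral>\<^sup>+x. ennreal (2^n) * ennreal ((d n x)\<^sup>2) + ennreal ((1/2)^n) \<partial>M)"
      by (rule nn_integral_mono) (use le in \<open>simp add: ennreal_leI flip: ennreal_mult ennreal_plus\<close>)
    also have "\<dots> = ennreal (2^n) * (\<integral>\<^sup>+x. ennreal ((d n x)\<^sup>2) \<partial>M) + ennreal ((1/2)^n) * emeasure M (space M)"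
      by (subst nn_integral_add) (auto simp: nn_integral_cmult)
    also have "\<dots> \<le> ennreal (2^n) * ennreal ((1/4)^n) + ennreal ((1/2)^n) * ennreal V"
      using bnd[of n "Suc n"] by (intro add_mono mult_left_mono) (auto simp: d_def V_def emeasure_eq_measure)
    also have "\<dots> = ennreal (2^n * (1/4)^n + (1/2)^n * V)"
      by (simp add: V_def ennreal_mult[symmetric] flip: ennreal_plus)
    also have "2^n * (1/4)^n = ((1/2)^n :: real)"
      by (simp flip: power_mult_distrib)
    finally show ?thesis by (simp add: algebra_simps)
  qed
  have "(\<integral>\<^sup>+x. (\<Sum>n. ennreal (d n x)) \<partial>M) = (\<Sum>n. \<integral>\<^sup>+x. ennreal (d n x) \<partial>M)"
    by (rule nn_integral_suminf) measurable
  also have "\<dots> \<le> (\<Sum>n. ennreal ((1 + V) * (1/2)^n))"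
    by (intro suminf_le d_int) auto
  also have "\<dots> < \<infinity>"
  proof -
    have "summable (\<lambda>n. (1 + V) * (1/2)^n)"
      by (intro summable_mult summable_geometric) simp
    then have "(\<Sum>n. ennreal ((1 + V) * (1/2)^n)) = ennreal (\<Sum>n. (1 + V) * (1/2)^n)"
      by (intro suminf_ennreal2) (auto simp: V_def)
    then show ?thesis by simp
  qed
  finally have "AE x in M. (\<Sum>n. ennreal (d n x)) \<noteq> \<infinity>"
    by (intro nn_integral_noteq_infinite) auto
  then have conv: "AE x in M. (\<lambda>m. p m x) \<longlonglongrightarrow> lim (\<lambda>m. p m x)"
  proof (rule eventually_mono)
    fix x assume "(\<Sum>n. ennreal (d n x)) \<noteq> \<infinity>"
    then have "summable (\<lambda>n. d n x)"
      by (intro summable_suminf_not_top) (auto simp: d_def)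
    then have "summable (\<lambda>n. p (Suc n) x - p n x)"
      unfolding d_def by (rule summable_norm_cancel)
    then have "convergent (\<lambda>n. \<Sum>i<n. p (Suc i) x - p i x)"
      by (simp add: summable_iff_convergent)
    then have "convergent (\<lambda>n. p n x - p 0 x)"
      unfolding sum_lessThan_telescope[of "\<lambda>i. p i x"] .
    then have "convergent (\<lambda>n. (p n x - p 0 x) + p 0 x)"
      by (intro convergent_add convergent_const)
    then show "(\<lambda>m. p m x) \<longlonglongrightarrow> lim (\<lambda>m. p m x)"
      by (simp add: convergent_LIMSEQ_iff)
  qed
  have "(\<integral>\<^sup>+x. ennreal ((cmod (lim (\<lambda>m. p m x) - p n x))\<^sup>2) \<partial>M)
      = (\<integral>\<^sup>+x. liminf (\<lambda>m. ennreal ((cmod (p m x - p n x))\<^sup>2)) \<partial>M)"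
  proof (rule nn_integral_cong_AE, use conv in eventually_elim)
    fix x assume "(\<lambda>m. p m x) \<longlonglongrightarrow> lim (\<lambda>m. p m x)"
    then have "(\<lambda>m. ennreal ((cmod (p m x - p n x))\<^sup>2)) \<longlonglongrightarrow> ennreal ((cmod (lim (\<lambda>m. p m x) - p n x))\<^sup>2)"
      by (intro tendsto_intros)
    then show "ennreal ((cmod (lim (\<lambda>m. p m x) - p n x))\<^sup>2) = liminf (\<lambda>m. ennreal ((cmod (p m x - p n x))\<^sup>2))"
      by (intro lim_imp_Liminf[symmetric] trivial_limit_sequentially)
  qed
  also have "\<dots> \<le> liminf (\<lambda>m. \<integral>\<^sup>+x. ennreal ((cmod (p m x - p n x))\<^sup>2) \<partial>M)"
    by (rule nn_integral_liminf) measurable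
  also have "\<dots> \<le> ennreal ((1/4)^n)"
    using bnd by (intro Liminf_le) (auto intro!: eventually_sequentiallyI[of n])
  finally show ?thesis .
qed

section \<open>Frequency boxes and finite Fourier sums\<close>

lemma finite_Km: "finite (Km m :: (int^'d) set)"
  and card_Km: "card (Km m :: (int^'d) set) = (2 * m + 1) ^ CARD('d)"
proof -
  let ?P = "PiE (UNIV :: 'd set) (\<lambda>_. {- int m..int m})"
  have eq: "(Km m :: (int^'d) set) = vec_lambda ` ?P"
  proof (intro equalityI subsetI)
    fix k :: "int^'d" assume "k \<in> Km m"
    then have "vec_nth k \<in> ?P" "k = vec_lambda (vec_nth k)"
      by (auto simp: Km_def abs_le_iff minus_le_iff)
    then show "k \<in> vec_lambda ` ?P" by blast
  qed (auto simp: Km_def abs_le_iff PiE_iff minus_le_iff)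
  have "finite ?P" by (intro finite_PiE) auto
  then show "finite (Km m :: (int^'d) set)" by (simp add: eq)
  have "inj_on vec_lambda ?P"
    by (rule inj_onI) (metis UNIV_I vec_lambda_inject)
  then have "card (Km m :: (int^'d) set) = card ?P"
    unfolding eq by (rule card_image)
  also have "\<dots> = card {- int m..int m} ^ CARD('d)"
    by (simp add: card_PiE)
  also have "card {- int m..int m} = 2 * m + 1"
    by simp
  finally show "card (Km m :: (int^'d) set) = (2 * m + 1) ^ CARD('d)" .
qed

lemma incseq_Km: "incseq (Km :: nat \<Rightarrow> (int^'d) set)"
proof (rule incseq_SucI, rule subsetI)
  fix m :: nat and k :: "int^'d"
  assume "k \<in> Km m"
  then have "\<bar>k$l\<bar> \<le> int m" for l
    by (simp add: Km_def)
  then have "\<bar>k$l\<bar> \<le> int (Suc m)" for l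
    by (rule order_trans) simp
  then show "k \<in> Km (Suc m)"
    by (simp add: Km_def)
qed

lemma UN_Km: "(\<Union>m. Km m) = (UNIV :: (int^'d) set)"
proof -
  have "k \<in> Km (nat (\<Sum>l\<in>UNIV. \<bar>k$l\<bar>))" for k :: "int^'d"
    by (auto simp: Km_def sum_nonneg intro!: member_le_sum)
  then show ?thesis by blast
qed

lemmas cut_Km_tendsto = cut_tendsto[OF finite_Km incseq_Km UN_Km]

lemma phi_sum_L2: "(\<lambda>x. \<Sum>k\<in>F. c k * phi L k x) \<in> L2 L"
  by (intro L2_sum L2_cmult phi_L2)

lemma ip_phi_sum: "h \<in> L2 L \<Longrightarrow> ip L (\<lambda>x. \<Sum>k\<in>F. c k * phi L k x) h = (\<Sum>k\<in>F. c k * cnj (coef L h k))"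
  by (subst ip_sum_left)
    (auto intro: L2_cmult simp: ip_cmult_left coef_def ip_commute[of L "phi L _"])

lemma coef_phi_sum:
  assumes "L > 0" "finite F"
  shows "coef L (\<lambda>x. \<Sum>k\<in>F. c k * phi L k x) j = (if j \<in> F then c j else 0)"
proof -
  have "coef L (\<lambda>x. \<Sum>k\<in>F. c k * phi L k x) j = (\<Sum>k\<in>F. c k * (if k = j then 1 else 0))"
    unfolding coef_def[of L "\<lambda>x. \<Sum>k\<in>F. c k * phi L k x"]
    by (subst ip_phi_sum) (auto simp: coef_def ip_phi_phi[OF assms(1)] intro!: sum.cong)
  then show ?thesis using assms(2) by (simp add: if_distrib cong: if_cong)
qed

lemma Bessel_inequality:
  assumes "L > 0" "f \<in> L2 L" "finite F"
  shows "(\<Sum>k\<in>F. (cmod (coef L f k))\<^sup>2) \<le> Re (ip L f f)"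
proof -
  define p where "p = (\<lambda>x. \<Sum>k\<in>F. coef L f k * phi L k x)"
  have pL2: "p \<in> L2 L" unfolding p_def by (rule phi_sum_L2)
  define S where "S = (\<Sum>k\<in>F. (cmod (coef L f k))\<^sup>2)"
  have pf: "ip L p f = complex_of_real S"
    unfolding p_def by (subst ip_phi_sum) (auto simp: assms S_def complex_norm_square[symmetric])
  then have fp: "ip L f p = complex_of_real S"
    using ip_commute[of L f p] by simp
  have pp: "ip L p p = complex_of_real S"
    unfolding p_def by (subst ip_phi_sum)
      (auto simp: assms phi_sum_L2 coef_phi_sum S_def complex_norm_square[symmetric])
  have "ip L (\<lambda>x. f x - p x) (\<lambda>x. f x - p x) = ip L f f - complex_of_real S"
  proof -
    let ?g = "\<lambda>x. f x - p x"
    have g: "?g \<in> L2 L" by (intro L2_diff assms pL2)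
    have "ip L ?g ?g = ip L f ?g - ip L p ?g"
      by (intro ip_diff_left assms pL2 g)
    also have "ip L f ?g = cnj (ip L ?g f)" by (rule ip_commute)
    also have "ip L p ?g = cnj (ip L ?g p)" by (rule ip_commute)
    also have "ip L ?g f = ip L f f - ip L p f" by (intro ip_diff_left assms pL2)
    also have "ip L ?g p = ip L f p - ip L p p" by (intro ip_diff_left assms pL2)
    finally show ?thesis
      by (simp add: pf fp pp flip: ip_commute)
  qed
  moreover have "0 \<le> Re (ip L (\<lambda>x. f x - p x) (\<lambda>x. f x - p x))"
    by (simp add: ip_self)
  ultimately show ?thesis by (simp add: S_def)
qed

text \<open>On \<open>L2\<close> this map forgets exactly the values on null sets and outside the
  box, so equality almost everywhere becomes equality.\<close>

definition coefE :: "real \<Rightarrow> (real^'d \<Rightarrow> complex) \<Rightarrow> (int^'d) ell2"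
  where "coefE L f = Abs_ell2 (coef L f)"

lemma nth2_coefE [simp]:
  assumes "L > 0" "f \<in> L2 L"
  shows "nth2 (coefE L f) k = coef L f k"
proof -
  have "(\<lambda>k. (cmod (coef L f k))\<^sup>2) summable_on UNIV"
    using Bessel_inequality[OF assms]
    by (intro nonneg_bdd_above_summable_on bdd_aboveI[of _ "Re (ip L f f)"]) auto
  then show ?thesis
    unfolding coefE_def by (simp add: nth2_Abs)
qed

lemma cin_tendsto: "X \<longlonglongrightarrow> x \<Longrightarrow> (\<lambda>n. cin (X n) y) \<longlonglongrightarrow> cin x y"
  by (intro tendsto_complex_iff[THEN iffD2])
    (auto simp: Im_cin inner_ell2_def[symmetric] intro!: tendsto_intros)

lemma cin_cut_left: "finite K \<Longrightarrow> cin (cut K x) y = (\<Sum>k\<in>K. nth2 x k * cnj (nth2 y k))"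
proof -
  assume "finite K"
  have "cin (cut K x) y = (\<Sum>\<^sub>\<infinity>k\<in>K. nth2 x k * cnj (nth2 y k))"
    unfolding cin_def by (rule infsum_cong_neutral) auto
  then show ?thesis
    using \<open>finite K\<close> by simp
qed

text \<open>The weak form of the conclusion already contains Parseval's identity for the constructed
  function; it follows by continuity of both products in their first argument.\<close>

lemma Riesz_Fischer:
  fixes c :: "(int^'d) ell2"
  assumes L: "L > 0"
  shows "\<exists>f\<in>L2 L. \<forall>h\<in>L2 L. ip L f h = cin c (coefE L h)"
proof -
  have "\<exists>n\<ge>m. norm (cut (Km n) c - c) \<le> (1/2)^j" for m j
  proof -
    have "\<forall>\<^sub>F n in sequentially. norm (cut (Km n) c - c) < (1/2)^j"
      using cut_Km_tendsto[of c] by (auto simp: tendsto_iff dist_norm)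
    then have "\<forall>\<^sub>F n in sequentially. n \<ge> m \<and> norm (cut (Km n) c - c) < (1/2)^j"
      using eventually_ge_at_top by (rule eventually_conj[rotated])
    then show ?thesis
      by (auto simp: eventually_sequentially intro: less_imp_le)
  qed
  \<comment> \<open>Errors \<open>(1/2)^j\<close> have the squares \<open>(1/4)^j\<close> required
    by \<open>fast_Cauchy_L2_limit\<close>. Monotonicity of \<open>N\<close> makes a difference of
    partial sums a sum over frequencies outside the smaller box.\<close>
  then have "\<exists>N. \<forall>j. norm (cut (Km (N j)) c - c) \<le> (1/2)^j \<and> N (Suc j) \<ge> N j"
    by (intro dependent_nat_choice[where P="\<lambda>j n. norm (cut (Km n) c - c) \<le> (1/2)^j" and Q="\<lambda>_ m n. m \<le> n"]) blast+
  then obtain N where N: "\<And>j. norm (cut (Km (N j)) c - c) \<le> (1/2)^j" and "\<And>j. N j \<le> N (Suc j)"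
    by blast
  then have mono: "j \<le> i \<Longrightarrow> N j \<le> N i" for i j
    using lift_Suc_mono_le by blast
  define p where "p = (\<lambda>j x. \<Sum>k\<in>Km (N j). nth2 c k * phi L k x)"
  have pL2: "p j \<in> L2 L" for j
    unfolding p_def by (rule phi_sum_L2)
  have diff: "(LINT x|Mbox L. (cmod (p m x - p n x))\<^sup>2) \<le> (1/4)^n" if "n \<le> m" for m n
  proof -
    have sub: "Km (N n) \<subseteq> (Km (N m) :: (int^'d) set)"
      using incseqD[OF incseq_Km mono[OF that]] .
    let ?D = "Km (N m) - Km (N n) :: (int^'d) set"
    have D: "finite ?D" by (simp add: finite_Km)
    have eq: "(\<lambda>x. p m x - p n x) = (\<lambda>x. \<Sum>k\<in>?D. nth2 c k * phi L k x)"
      unfolding p_def by (intro ext) (simp only: sum_diff[OF finite_Km sub])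
    have "ip L (\<lambda>x. p m x - p n x) (\<lambda>x. p m x - p n x) = (\<Sum>k\<in>?D. nth2 c k * cnj (nth2 c k))"
      unfolding eq by (subst ip_phi_sum) (auto simp: phi_sum_L2 coef_phi_sum[OF L D])
    also have "\<dots> = complex_of_real (\<Sum>k\<in>?D. (cmod (nth2 c k))\<^sup>2)"
      by (simp add: complex_norm_square[symmetric])
    finally have "(LINT x|Mbox L. (cmod (p m x - p n x))\<^sup>2) = (\<Sum>k\<in>?D. (cmod (nth2 c k))\<^sup>2)"
      unfolding ip_self of_real_eq_iff .
    also have "\<dots> = (\<Sum>k\<in>?D. (cmod (nth2 (cut (Km (N n)) c - c) k))\<^sup>2)"
      by (intro sum.cong) auto
    also have "\<dots> \<le> ((1/2)^n)\<^sup>2"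
      using norm_ell2_le_iff[THEN iffD1, OF N] D by blast
    also have "\<dots> = (1/4)^n"
      by (simp add: power2_eq_square flip: power_mult_distrib)
    finally show ?thesis .
  qed
  define f where "f = (\<lambda>x. lim (\<lambda>n. p n x))"
  have fm: "f \<in> borel_measurable lebesgue"
    unfolding f_def using pL2[THEN L2_measurable] by (rule borel_measurable_lim_metric)
  have bound: "(\<integral>\<^sup>+x. ennreal ((cmod (f x - p n x))\<^sup>2) \<partial>Mbox L) \<le> ennreal ((1/4)^n)" for n
    unfolding f_def
  proof (rule fast_Cauchy_L2_limit[OF finite_measure_Mbox L2_measurable_Mbox[OF pL2]])
    fix n m :: nat assume "n \<le> m"
    have "integrable (Mbox L) (\<lambda>x. (cmod (p m x - p n x))\<^sup>2)"
      using L2_diff[OF pL2 pL2] by (simp add: L2_iff)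
    then have "(\<integral>\<^sup>+x. ennreal ((cmod (p m x - p n x))\<^sup>2) \<partial>Mbox L) = ennreal (LINT x|Mbox L. (cmod (p m x - p n x))\<^sup>2)"
      by (intro nn_integral_eq_integral) auto
    also have "\<dots> \<le> ennreal ((1/4)^n)"
      using diff[OF \<open>n \<le> m\<close>] by (rule ennreal_leI)
    finally show "(\<integral>\<^sup>+x. ennreal ((cmod (p m x - p n x))\<^sup>2) \<partial>Mbox L) \<le> ennreal ((1/4)^n)" .
  qed
  have fpm: "(\<lambda>x. f x - p n x) \<in> borel_measurable lebesgue" for n
    using fm pL2[THEN L2_measurable, of n] by measurable
  have fpL2: "(\<lambda>x. f x - p n x) \<in> L2 L" for n
    unfolding L2_iff
  proof (intro conjI fpm)
    note [measurable] = Mbox_measurable[OF fpm[of n]]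
    show "integrable (Mbox L) (\<lambda>x. (cmod (f x - p n x))\<^sup>2)"
      using bound[of n] order_le_less_trans[OF bound[of n], of \<infinity>]
      by (intro integrableI_nonneg) auto
  qed
  have fL2: "f \<in> L2 L"
    using L2_add[OF fpL2[of 0] pL2[of 0]] by simp
  have small: "Re (ip L (\<lambda>x. f x - p n x) (\<lambda>x. f x - p n x)) \<le> (1/4)^n" for n
  proof -
    have "ennreal (LINT x|Mbox L. (cmod (f x - p n x))\<^sup>2) = (\<integral>\<^sup>+x. ennreal ((cmod (f x - p n x))\<^sup>2) \<partial>Mbox L)"
      using fpL2[of n] by (intro nn_integral_eq_integral[symmetric]) (auto simp: L2_iff)
    then have "ennreal (LINT x|Mbox L. (cmod (f x - p n x))\<^sup>2) \<le> ennreal ((1/4)^n)"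
      using bound[of n] by simp
    then show ?thesis
      by (subst (asm) ennreal_le_iff) (simp_all add: ip_self)
  qed
  have "ip L f h = cin c (coefE L h)" if h: "h \<in> L2 L" for h
  proof (rule LIMSEQ_unique)
    have "(\<lambda>n. cut (Km (N n)) c - c) \<longlonglongrightarrow> 0"
    proof (rule tendsto_norm_zero_cancel, rule tendsto_sandwich[of "\<lambda>_. 0" _ _ "\<lambda>n. (1/2)^n"])
      show "(\<lambda>n. (1/2)^n :: real) \<longlonglongrightarrow> 0" by (rule LIMSEQ_power_zero) simp
    qed (use N in auto)
    then have "(\<lambda>n. cut (Km (N n)) c) \<longlonglongrightarrow> c"
      by (simp add: LIM_zero_iff)
    then have "(\<lambda>n. cin (cut (Km (N n)) c) (coefE L h)) \<longlonglongrightarrow> cin c (coefE L h)"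
      by (rule cin_tendsto)
    moreover have "cin (cut (Km (N n)) c) (coefE L h) = ip L (p n) h" for n
      unfolding p_def ip_phi_sum[OF h] by (simp add: cin_cut_left finite_Km L h)
    ultimately show "(\<lambda>n. ip L (p n) h) \<longlonglongrightarrow> cin c (coefE L h)" by simp
    have "(\<lambda>n. ip L (\<lambda>x. f x - p n x) h) \<longlonglongrightarrow> 0"
    proof -
      have "(cmod (ip L (\<lambda>x. f x - p n x) h))\<^sup>2 \<le> (1/4)^n * Re (ip L h h)" for n
        by (rule order_trans[OF ip_Cauchy_Schwarz[OF fpL2 h] mult_right_mono[OF small]]) (simp add: ip_self)
      then have le: "\<forall>\<^sub>F n in sequentially. (cmod (ip L (\<lambda>x. f x - p n x) h))\<^sup>2 \<le> (1/4)^n * Re (ip L h h)"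
        by (rule always_eventually[OF allI])
      have lim: "(\<lambda>n. (1/4)^n * Re (ip L h h)) \<longlonglongrightarrow> 0"
        by (intro tendsto_mult_left_zero LIMSEQ_power_zero) simp
      have "(\<lambda>n. (cmod (ip L (\<lambda>x. f x - p n x) h))\<^sup>2) \<longlonglongrightarrow> 0"
        by (rule tendsto_sandwich[OF _ le tendsto_const lim]) simp
      then have "(\<lambda>n. sqrt ((cmod (ip L (\<lambda>x. f x - p n x) h))\<^sup>2)) \<longlonglongrightarrow> sqrt 0"
        by (rule tendsto_real_sqrt)
      then show ?thesis by (simp add: tendsto_norm_zero_iff)
    qed
    then have "(\<lambda>n. ip L f h - ip L (p n) h) \<longlonglongrightarrow> 0"
      by (simp add: ip_diff_left fL2 pL2 h)
    from tendsto_diff[OF tendsto_const[of "ip L f h"] this]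
    show "(\<lambda>n. ip L (p n) h) \<longlonglongrightarrow> ip L f h" by simp
  qed
  then show ?thesis using fL2 by blast
qed

lemma coef_phi: "L > 0 \<Longrightarrow> coef L (phi L j) k = (if k = j then 1 else 0)"
  by (simp add: coef_def ip_phi_phi eq_commute)

lemma coef_eq_imp_AE_eq:
  assumes "L > 0" "f \<in> L2 L" "g \<in> L2 L" "\<And>k. coef L f k = coef L g k"
  shows "AE x in Mbox L. f x = g x"
proof -
  have "AE x in Mbox L. f x - g x = 0"
    using assms by (intro coef0_imp_AE_zero L2_diff) (auto simp: coef_def ip_diff_left)
  then show ?thesis by simp
qed

lemma coef_surj:
  fixes c :: "(int^'d) ell2"
  assumes L: "L > 0"
  obtains f where "f \<in> L2 L" "\<And>k. coef L f k = nth2 c k" "\<And>h. h \<in> L2 L \<Longrightarrow> ip L f h = cin c (coefE L h)"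
proof -
  obtain f where f: "f \<in> L2 L" "\<And>h. h \<in> L2 L \<Longrightarrow> ip L f h = cin c (coefE L h)"
    using Riesz_Fischer[OF L] by blast
  have "coef L f k = nth2 c k" for k
  proof -
    have "coef L f k = cin c (coefE L (phi L k))"
      unfolding coef_def using f(2) by simp
    also have "\<dots> = (\<Sum>\<^sub>\<infinity>j\<in>{k}. nth2 c j * cnj (nth2 (coefE L (phi L k)) j))"
      unfolding cin_def by (rule infsum_cong_neutral) (auto simp: L coef_phi)
    finally show ?thesis by (simp add: L coef_phi)
  qed
  with f that show thesis by blast
qed

text \<open>The function built from the coefficients of \<open>f\<close> satisfies the identity by
  construction, and by completeness it agrees with \<open>f\<close> almost everywhere on the
  box.\<close>

lemma Parseval:
  assumes L: "L > 0" and f: "f \<in> L2 L" and h: "h \<in> L2 L"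
  shows "ip L f h = cin (coefE L f) (coefE L h)"
proof -
  obtain g where g: "g \<in> L2 L" "\<And>k. coef L g k = nth2 (coefE L f) k"
    "\<And>h. h \<in> L2 L \<Longrightarrow> ip L g h = cin (coefE L f) (coefE L h)"
    using coef_surj[OF L] by metis
  have "AE x in Mbox L. f x = g x"
    by (rule coef_eq_imp_AE_eq) (use L f g in auto)
  then have "ip L f h = ip L g h"
    using f g h by (intro ip_cong_AE) auto
  then show ?thesis using g h by simp
qed

subsection \<open>Norm convergence of Galerkin approximations\<close>

lemma norm_blinfun_bound_cball:
  fixes T :: "'a::real_normed_vector \<Rightarrow>\<^sub>L 'b::real_normed_vector"
  assumes "0 \<le> b" "\<And>x. norm x \<le> 1 \<Longrightarrow> norm (T x) \<le> b"
  shows "norm T \<le> b"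
proof (rule norm_blinfun_bound[OF assms(1)])
  fix x
  show "norm (T x) \<le> b * norm x"
  proof (cases "x = 0")
    case False
    then have "norm (T (x /\<^sub>R norm x)) \<le> b"
      by (intro assms(2)) simp
    then show ?thesis
      using False by (simp add: blinfun.scaleR_right field_simps)
  qed simp
qed

lemma compact_closure_image_compose:
  fixes U :: "'b::real_normed_vector \<Rightarrow>\<^sub>L 'c::real_normed_vector" and S :: "'a::real_normed_vector \<Rightarrow>\<^sub>L 'b"
    and V :: "'d::real_normed_vector \<Rightarrow>\<^sub>L 'a"
  assumes S: "compact (closure (blinfun_apply S ` cball 0 1))"
  shows "compact (closure (blinfun_apply (U o\<^sub>L S o\<^sub>L V) ` cball 0 1))"
proof -
  define r where "r = norm V + 1"
  have r: "r > 0" by (simp add: r_def add_nonneg_pos)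
  let ?D = "(\<lambda>y. U (r *\<^sub>R y)) ` closure (blinfun_apply S ` cball 0 1)"
  have D: "compact ?D"
    using S by (intro compact_continuous_image continuous_intros)
  have "(U o\<^sub>L S o\<^sub>L V) ` cball 0 1 \<subseteq> ?D"
  proof
    fix y assume "y \<in> (U o\<^sub>L S o\<^sub>L V) ` cball 0 1"
    then obtain x where x: "norm x \<le> 1" "y = U (S (V x))" by auto
    have "norm (V x) \<le> norm V * norm x" by (rule norm_blinfun)
    also have "\<dots> \<le> norm V * 1" using x(1) by (intro mult_left_mono) auto
    finally have "norm (V x /\<^sub>R r) \<le> 1"
      using r by (simp add: field_simps r_def)
    then have "S (V x /\<^sub>R r) \<in> closure (blinfun_apply S ` cball 0 1)"
      by (intro subsetD[OF closure_subset]) auto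
    moreover have "y = U (r *\<^sub>R S (V x /\<^sub>R r))"
      using r by (simp add: x(2) blinfun.scaleR_right)
    ultimately show "y \<in> ?D" by blast
  qed
  then have "closure ((U o\<^sub>L S o\<^sub>L V) ` cball 0 1) \<subseteq> ?D"
    using D by (simp add: closure_minimal compact_imp_closed)
  then show ?thesis
    using D by (metis closed_closure closed_Int_compact inf.absorb_iff1)
qed

lemma strong_tendsto_apply:
  fixes A :: "nat \<Rightarrow> 'a::real_normed_vector \<Rightarrow>\<^sub>L 'b::real_normed_vector" and A' :: "'a \<Rightarrow>\<^sub>L 'b"
  assumes "\<And>n. norm (A n) \<le> B" "\<And>x. (\<lambda>n. A n x) \<longlonglongrightarrow> A' x" "y \<longlonglongrightarrow> z"
  shows "(\<lambda>n. A n (y n)) \<longlonglongrightarrow> A' z"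
proof -
  have "(\<lambda>n. A n (y n - z)) \<longlonglongrightarrow> 0"
  proof (rule Lim_null_comparison)
    have "norm (A n (y n - z)) \<le> B * norm (y n - z)" for n
      using norm_blinfun[of "A n" "y n - z"] assms(1)[of n] by (meson mult_right_mono norm_ge_zero order_trans)
    then show "\<forall>\<^sub>F n in sequentially. norm (A n (y n - z)) \<le> B * norm (y n - z)" by simp
    show "(\<lambda>n. B * norm (y n - z)) \<longlonglongrightarrow> 0"
      using assms(3) by (intro tendsto_mult_right_zero tendsto_norm_zero) (simp add: LIM_zero_iff)
  qed
  from tendsto_add[OF this assms(2)[of z]] show ?thesis
    by (simp add: blinfun.diff_right)
qed

text \<open>Strong convergence of uniformly bounded operators is uniform on totally bounded sets,
  and \<open>S\<close> maps the unit ball into one.\<close>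

lemma strong_compose_compact_tendsto:
  fixes Z :: "nat \<Rightarrow> 'b::real_normed_vector \<Rightarrow>\<^sub>L 'c::real_normed_vector" and Z' :: "'b \<Rightarrow>\<^sub>L 'c" and S :: "'a::real_normed_vector \<Rightarrow>\<^sub>L 'b"
  assumes B: "\<And>n. norm (Z n) \<le> B" and strong: "\<And>x. (\<lambda>n. Z n x) \<longlonglongrightarrow> Z' x"
    and S: "compact (closure (blinfun_apply S ` cball 0 1))"
  shows "(\<lambda>n. Z n o\<^sub>L S) \<longlonglongrightarrow> (Z' o\<^sub>L S)"
proof (rule LIMSEQ_I)
  fix e :: real assume e: "e > 0"
  define b where "b = B + norm Z' + 1"
  have B0: "0 \<le> B" using B[of 0] norm_ge_zero order_trans by blast
  then have b: "b > 0" by (simp add: b_def add_nonneg_pos)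
  \<comment> \<open>\<open>b\<close> bounds the norm of \<open>Z n - Z'\<close>, so moving to a net
    point costs \<open>b * \<delta> = e/4\<close>; the other \<open>e/4\<close> is the error on the
    finite net.\<close>
  define \<delta> where "\<delta> = e / (4 * b)"
  have \<delta>: "\<delta> > 0" using e b by (simp add: \<delta>_def)
  have Zb: "norm (Z n - Z') \<le> b" for n
    using norm_triangle_ineq4[of "Z n" Z'] B[of n] by (simp add: b_def)
  obtain F where F: "finite F" "closure (blinfun_apply S ` cball 0 1) \<subseteq> (\<Union>x\<in>F. ball x \<delta>)"
    using S \<delta> unfolding compact_eq_totally_bounded by metis
  have "\<forall>\<^sub>F n in sequentially. \<forall>y\<in>F. norm ((Z n - Z') y) < e / 4"
  proof (intro eventually_ball_finite[OF F(1)] ballI)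
    fix y
    have "(\<lambda>n. (Z n - Z') y) \<longlonglongrightarrow> 0"
      using strong[of y] by (simp add: blinfun.diff_left LIM_zero_iff)
    then show "\<forall>\<^sub>F n in sequentially. norm ((Z n - Z') y) < e / 4"
      using e by (intro order_tendstoD(2)[OF tendsto_norm_zero]) auto
  qed
  then obtain N where N: "\<And>n y. n \<ge> N \<Longrightarrow> y \<in> F \<Longrightarrow> norm ((Z n - Z') y) < e / 4"
    by (auto simp: eventually_sequentially)
  have "norm ((Z n o\<^sub>L S) - (Z' o\<^sub>L S)) \<le> e / 2" if "n \<ge> N" for n
  proof (rule norm_blinfun_bound_cball)
    fix x :: 'a assume "norm x \<le> 1"
    then have "S x \<in> closure (blinfun_apply S ` cball 0 1)"
      by (intro subsetD[OF closure_subset]) auto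
    then obtain y where y: "y \<in> F" "norm (S x - y) < \<delta>"
      using F(2) by (auto simp: dist_norm norm_minus_commute)
    have "((Z n o\<^sub>L S) - (Z' o\<^sub>L S)) x = (Z n - Z') (S x - y) + (Z n - Z') y"
      by (simp add: blinfun.diff_left blinfun.diff_right)
    also have "norm \<dots> \<le> norm ((Z n - Z') (S x - y)) + norm ((Z n - Z') y)"
      by (rule norm_triangle_ineq)
    also have "\<dots> \<le> b * \<delta> + e / 4"
    proof (intro add_mono)
      have "norm ((Z n - Z') (S x - y)) \<le> norm (Z n - Z') * norm (S x - y)"
        by (rule norm_blinfun)
      also have "\<dots> \<le> b * \<delta>"
        using Zb[of n] y(2) b by (intro mult_mono) auto
      finally show "norm ((Z n - Z') (S x - y)) \<le> b * \<delta>" .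
    qed (use N[OF that y(1)] in simp)
    also have "\<dots> = e / 2"
      using b by (simp add: \<delta>_def field_simps)
    finally show "norm (((Z n o\<^sub>L S) - (Z' o\<^sub>L S)) x) \<le> e / 2" .
  qed (use e in simp)
  then show "\<exists>N. \<forall>n\<ge>N. norm ((Z n o\<^sub>L S) - (Z' o\<^sub>L S)) < e"
    using e by (intro exI[of _ N]) (smt (verit) field_sum_of_halves)
qed

text \<open>Transfers norm convergence from \<open>Cn n o\<^sub>L S\<close> to the reversed product,
  where \<open>S\<close> stands on the wrong side for strong convergence to suffice.\<close>

lemma norm_le_adjoint:
  fixes X Y :: "'a::real_inner \<Rightarrow>\<^sub>L 'a"
  assumes "\<And>x y. inner (X x) y = inner x (Y y)"
  shows "norm X \<le> norm Y"
proof (rule norm_blinfun_bound)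
  fix x
  have "norm (X x) * norm (X x) = inner (X x) (X x)"
    by (simp add: power2_norm_eq_inner flip: power2_eq_square)
  also have "\<dots> \<le> norm x * norm (Y (X x))"
    unfolding assms by (rule norm_cauchy_schwarz)
  also have "\<dots> \<le> norm x * (norm Y * norm (X x))"
    by (intro mult_left_mono norm_blinfun) auto
  finally have "norm (X x) * norm (X x) \<le> (norm Y * norm x) * norm (X x)"
    by (simp add: mult_ac)
  then show "norm (X x) \<le> norm Y * norm x"
    by (cases "X x = 0") auto
qed simp

lemma norm_le_one_apply:
  fixes A :: "'a::real_normed_vector \<Rightarrow>\<^sub>L 'b::real_normed_vector"
  shows "norm A \<le> 1 \<Longrightarrow> norm (A x) \<le> norm x"
  using norm_blinfun[of A x] mult_left_le_one_le[of "norm x" "norm A"] by auto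

lemma norm_le_one_compose:
  fixes A :: "'b::real_normed_vector \<Rightarrow>\<^sub>L 'c::real_normed_vector" and B :: "'a::real_normed_vector \<Rightarrow>\<^sub>L 'b"
  shows "norm A \<le> 1 \<Longrightarrow> norm B \<le> 1 \<Longrightarrow> norm (A o\<^sub>L B) \<le> 1"
  by (rule norm_blinfun_bound) (use norm_le_one_apply[of A] norm_le_one_apply[of B] order_trans in \<open>fastforce+\<close>)

lemma cscale_add: "cscale z (x + y) = cscale z x + cscale z y"
  by (rule ell2_eqI) (simp add: algebra_simps)

lemma cscale_scaleR: "cscale z (r *\<^sub>R x) = r *\<^sub>R cscale z x"
  by (rule ell2_eqI) simp

lemma cin_scaleR [simp]:
  "cin (r *\<^sub>R x) y = complex_of_real r * cin x y" "cin x (r *\<^sub>R y) = complex_of_real r * cin x y"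
  by (simp_all add: scaleR_ell2_def)

lemma binv_clinear:
  fixes G :: "'i ell2 \<Rightarrow>\<^sub>L 'i ell2"
  assumes "\<And>x. (norm x)\<^sup>2 \<le> inner (G x) x" "\<And>z x. G (cscale z x) = cscale z (G x)"
  shows "binv G (cscale z x) = cscale z (binv G x)"
  by (metis assms binv_left binv_right)

lemma binv_selfadjoint:
  fixes G :: "'i ell2 \<Rightarrow>\<^sub>L 'i ell2"
  assumes "\<And>x. (norm x)\<^sup>2 \<le> inner (G x) x" "\<And>x y. cin (G x) y = cin x (G y)"
  shows "cin (binv G x) y = cin x (binv G y)"
  by (metis assms binv_right)

lemma binv_pos:
  fixes G :: "'a::{real_inner,complete_space} \<Rightarrow>\<^sub>L 'a"
  assumes "\<And>x. (norm x)\<^sup>2 \<le> inner (G x) x"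
  shows "0 \<le> inner (binv G x) x"
  using assms[of "binv G x"] binv_right[of G x] assms
  by (metis inner_commute order_trans zero_le_power2)

text \<open>In coordinates \<open>u = S b\<close>, with \<open>S\<close> the inverse square root of the Sobolev weight, the form \<open>q\<close>
  becomes the bounded coercive operator \<open>G = 1 + \<mu> E\<^sup>* C E\<close>, so that \<open>M\<^sup>-\<^sup>1 = S G\<^sup>-\<^sup>1 S\<close>; the
  Galerkin approximation replaces \<open>G\<close> by \<open>1 + \<mu> \<Pi> E\<^sup>* C E \<Pi>\<close>.\<close>

locale galerkin =
  fixes C :: "'i ell2 \<Rightarrow>\<^sub>L 'i ell2" and sm :: "'i \<Rightarrow> real" and em :: "'i \<Rightarrow> complex"
    and mu :: real and K :: "nat \<Rightarrow> 'i set" and Bs Be :: real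
  assumes C_lin: "\<And>z x. C (cscale z x) = cscale z (C x)"
    and C_sa: "\<And>x y. cin (C x) y = cin x (C y)"
    and C_pos: "\<And>x. 0 \<le> inner (C x) x"
    and C_norm: "norm C \<le> 1"
    and sm_bound: "\<And>k. \<bar>sm k\<bar> \<le> Bs"
    and em_bound: "\<And>k. cmod (em k) \<le> Be"
    and mu: "0 \<le> mu"
    and K: "\<And>n. finite (K n)" "incseq K" "(\<Union>n. K n) = UNIV"
    and sm_tail: "\<And>e. e > 0 \<Longrightarrow> \<exists>n. \<forall>k. k \<notin> K n \<longrightarrow> \<bar>sm k\<bar> \<le> e"
begin

definition S :: "'i ell2 \<Rightarrow>\<^sub>L 'i ell2" where "S = diag (\<lambda>k. complex_of_real (sm k))"
definition E :: "'i ell2 \<Rightarrow>\<^sub>L 'i ell2" where "E = diag em"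
definition E' :: "'i ell2 \<Rightarrow>\<^sub>L 'i ell2" where "E' = diag (\<lambda>k. cnj (em k))"
definition P :: "nat \<Rightarrow> 'i ell2 \<Rightarrow>\<^sub>L 'i ell2" where "P n = cut (K n)"
definition G :: "'i ell2 \<Rightarrow>\<^sub>L 'i ell2" where "G = id_blinfun + mu *\<^sub>R (E' o\<^sub>L C o\<^sub>L E)"
text \<open>The compression of \<open>G\<close> to the range of \<open>P n\<close>, completed by the
  identity on its complement. It acts on the whole space and is coercive with the constant of
  \<open>G\<close>.\<close>

definition Gm :: "nat \<Rightarrow> 'i ell2 \<Rightarrow>\<^sub>L 'i ell2" where
  "Gm n = id_blinfun + mu *\<^sub>R (P n o\<^sub>L E' o\<^sub>L C o\<^sub>L E o\<^sub>L P n)"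
definition Cn :: "nat \<Rightarrow> 'i ell2 \<Rightarrow>\<^sub>L 'i ell2" where "Cn n = P n o\<^sub>L C o\<^sub>L P n"
definition Top :: "'i ell2 \<Rightarrow>\<^sub>L 'i ell2" where "Top = C o\<^sub>L S o\<^sub>L binv G o\<^sub>L S o\<^sub>L C"
definition Tn :: "nat \<Rightarrow> 'i ell2 \<Rightarrow>\<^sub>L 'i ell2" where "Tn n = Cn n o\<^sub>L S o\<^sub>L binv (Gm n) o\<^sub>L S o\<^sub>L Cn n"

lemma nth2_S [simp]: "nth2 (S x) k = complex_of_real (sm k) * nth2 x k"
  unfolding S_def by (rule nth2_diag[where B=Bs]) (simp add: sm_bound)

lemma nth2_E [simp]: "nth2 (E x) k = em k * nth2 x k"
  unfolding E_def by (rule nth2_diag[where B=Be]) (simp add: em_bound)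

lemma nth2_E' [simp]: "nth2 (E' x) k = cnj (em k) * nth2 x k"
  unfolding E'_def by (rule nth2_diag[where B=Be]) (simp add: em_bound)

lemma nth2_P [simp]: "nth2 (P n x) k = (if k \<in> K n then nth2 x k else 0)"
  by (simp add: P_def)

lemma S_sa: "cin (S x) y = cin x (S y)"
  unfolding cin_def by (simp add: mult_ac)

lemma E_adj: "cin (E' x) y = cin x (E y)" "cin (E x) y = cin x (E' y)"
  unfolding cin_def by (simp_all add: mult_ac)

lemma P_sa: "cin (P n x) y = cin x (P n y)"
  by (simp add: P_def cin_cut)

lemma P_P [simp]: "P n (P n x) = P n x"
  by (simp add: P_def)

lemma P_S: "P n (S x) = S (P n x)"
  by (rule ell2_eqI) simp

lemma lin: "S (cscale z x) = cscale z (S x)" "E (cscale z x) = cscale z (E x)"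
    "E' (cscale z x) = cscale z (E' x)" "P n (cscale z x) = cscale z (P n x)"
  by (rule ell2_eqI, simp)+

lemma G_apply: "G x = x + mu *\<^sub>R E' (C (E x))"
  by (simp add: G_def blinfun.add_left blinfun.scaleR_left)

lemma Gm_apply: "Gm n x = x + mu *\<^sub>R P n (E' (C (E (P n x))))"
  by (simp add: Gm_def blinfun.add_left blinfun.scaleR_left)

lemma G_coercive: "(norm x)\<^sup>2 \<le> inner (G x) x"
proof -
  have "inner (E' (C (E x))) x = inner (C (E x)) (E x)"
    by (simp add: inner_ell2_def E_adj)
  then show ?thesis
    using mu C_pos[of "E x"] by (simp add: G_apply inner_add_left power2_norm_eq_inner)
qed

lemma Gm_coercive: "(norm x)\<^sup>2 \<le> inner (Gm n x) x"
proof -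
  have "inner (P n (E' (C (E (P n x))))) x = inner (C (E (P n x))) (E (P n x))"
    by (simp add: inner_ell2_def E_adj P_sa)
  then show ?thesis
    using mu C_pos[of "E (P n x)"] by (simp add: Gm_apply inner_add_left power2_norm_eq_inner)
qed

lemma G_lin: "G (cscale z x) = cscale z (G x)" "Gm n (cscale z x) = cscale z (Gm n x)"
  by (simp_all add: G_apply Gm_apply lin C_lin cscale_add cscale_scaleR)

lemma G_sa: "cin (G x) y = cin x (G y)" "cin (Gm n x) y = cin x (Gm n y)"
  by (simp_all add: G_apply Gm_apply cin_add_left cin_add_right E_adj C_sa P_sa)

lemma P_norm: "norm (P n) \<le> 1"
  by (simp add: P_def norm_cut_le)

lemma Cn_norm: "norm (Cn n) \<le> 1"
  unfolding Cn_def by (intro norm_le_one_compose P_norm C_norm)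

lemma Cn_lin: "Cn n (cscale z x) = cscale z (Cn n x)"
  by (simp add: Cn_def lin C_lin)

lemma Cn_sa: "cin (Cn n x) y = cin x (Cn n y)"
  by (simp add: Cn_def P_sa C_sa)

lemma S_compact: "compact (closure (blinfun_apply S ` cball 0 1))"
proof (rule compact_closure_image_if_finite_rank_approx)
  fix e :: real assume "e > 0"
  then obtain n where n: "\<And>k. k \<notin> K n \<Longrightarrow> \<bar>sm k\<bar> \<le> e"
    using sm_tail by blast
  have "norm (S - (S o\<^sub>L cut (K n))) \<le> e"
    unfolding S_def by (rule norm_diag_cut_le[where B=Bs]) (use n \<open>e > 0\<close> sm_bound in auto)
  then show "\<exists>K U. finite K \<and> norm (S - (U o\<^sub>L cut K)) \<le> e"
    using K(1) by blast
qed

lemma sandwich_compact_positive: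
  fixes Q H :: "'i ell2 \<Rightarrow>\<^sub>L 'i ell2"
  assumes Q: "\<And>z x. Q (cscale z x) = cscale z (Q x)" "\<And>x y. cin (Q x) y = cin x (Q y)"
    and H: "\<And>x. (norm x)\<^sup>2 \<le> inner (H x) x" "\<And>z x. H (cscale z x) = cscale z (H x)"
      "\<And>x y. cin (H x) y = cin x (H y)"
  shows "compact_positive (Q o\<^sub>L S o\<^sub>L binv H o\<^sub>L S o\<^sub>L Q)"
  unfolding compact_positive_def
proof (intro conjI allI)
  let ?T = "Q o\<^sub>L S o\<^sub>L binv H o\<^sub>L S o\<^sub>L Q"
  show "?T (cscale z x) = cscale z (?T x)" for z x
    by (simp add: Q lin binv_clinear[OF H(1,2)])
  show "cin (?T x) y = cin x (?T y)" for x y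
    by (simp add: Q S_sa binv_selfadjoint[OF H(1,3)])
  have "inner (?T x) x = inner (binv H (S (Q x))) (S (Q x))" for x
    by (simp add: inner_ell2_def Q S_sa)
  then show "0 \<le> inner (?T x) x" for x
    using binv_pos[OF H(1)] by simp
  \<comment> \<open>Reassociated so that the left \<open>S\<close> is the compact factor between two
    bounded ones.\<close>
  have "?T = Q o\<^sub>L S o\<^sub>L (binv H o\<^sub>L S o\<^sub>L Q)"
    by (rule blinfun_eqI) simp
  then show "compact (closure (?T ` cball 0 1))"
    by (simp only: compact_closure_image_compose[OF S_compact])
qed

text \<open>Coercivity bounds the inverse of \<open>H\<close> by 1, so the form is controlled by
  \<open>S\<close> alone: this is why the eigenvalue bounds depend neither on \<open>mu\<close> nor
  on the truncation.\<close>

lemma sandwich_form_le: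
  fixes Q H :: "'i ell2 \<Rightarrow>\<^sub>L 'i ell2"
  assumes Q: "\<And>x y. cin (Q x) y = cin x (Q y)" and H: "\<And>x. (norm x)\<^sup>2 \<le> inner (H x) x"
  shows "inner ((Q o\<^sub>L S o\<^sub>L binv H o\<^sub>L S o\<^sub>L Q) x) x \<le> (norm (S (Q x)))\<^sup>2"
proof -
  have "inner ((Q o\<^sub>L S o\<^sub>L binv H o\<^sub>L S o\<^sub>L Q) x) x = inner (binv H (S (Q x))) (S (Q x))"
    by (simp add: inner_ell2_def Q S_sa)
  also have "\<dots> \<le> norm (binv H (S (Q x))) * norm (S (Q x))"
    by (rule norm_cauchy_schwarz)
  also have "\<dots> \<le> norm (S (Q x)) * norm (S (Q x))"
    by (intro mult_right_mono norm_le_one_apply norm_binv_le H) auto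
  finally show ?thesis by (simp add: power2_eq_square)
qed

lemma Top_compact_positive: "compact_positive Top"
  unfolding Top_def by (intro sandwich_compact_positive C_lin C_sa G_coercive G_lin G_sa)

lemma Tn_compact_positive: "compact_positive (Tn n)"
  unfolding Tn_def by (intro sandwich_compact_positive Cn_lin Cn_sa Gm_coercive G_lin G_sa)

lemma sval_Top_Tn_le:
  assumes "k \<ge> 1" "finite N" "card N < k" "\<And>i. i \<notin> N \<Longrightarrow> \<bar>sm i\<bar> \<le> b" "0 \<le> b"
  shows "sval Top k \<le> b\<^sup>2" "sval (Tn n) k \<le> b\<^sup>2"
proof -
  have m: "cmod (complex_of_real (sm i)) \<le> Bs" for i
    by (simp add: sm_bound)
  have N: "cmod (complex_of_real (sm i)) \<le> b" if "i \<notin> N" for i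
    using assms(4) that by simp
  show "sval Top k \<le> b\<^sup>2"
    by (rule sval_le_multiplier[OF Top_compact_positive assms(1) C_norm C_lin _ m assms(2,3) N assms(5)])
      (use sandwich_form_le[OF C_sa G_coercive] in \<open>simp add: Top_def S_def\<close>)
  show "sval (Tn n) k \<le> b\<^sup>2"
    by (rule sval_le_multiplier[OF Tn_compact_positive assms(1) Cn_norm Cn_lin _ m assms(2,3) N assms(5)])
      (use sandwich_form_le[OF Cn_sa Gm_coercive] in \<open>simp add: Tn_def S_def\<close>)
qed

lemma P_tendsto: "(\<lambda>n. P n x) \<longlonglongrightarrow> x"
  unfolding P_def by (rule cut_tendsto[OF K])

lemma PP_tendsto: "(\<lambda>n. P n (A (P n x))) \<longlonglongrightarrow> A x" for A :: "'i ell2 \<Rightarrow>\<^sub>L 'i ell2"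
  using strong_tendsto_apply[of P 1 id_blinfun "\<lambda>n. A (P n x)" "A x"] P_norm P_tendsto
  by (simp add: blinfun.tendsto)

lemma Cn_tendsto: "(\<lambda>n. Cn n x) \<longlonglongrightarrow> C x"
  using PP_tendsto[of C x] by (simp add: Cn_def)

lemma Gm_tendsto: "(\<lambda>n. Gm n x) \<longlonglongrightarrow> G x"
  using PP_tendsto[of "E' o\<^sub>L C o\<^sub>L E" x] by (auto simp: Gm_apply G_apply intro!: tendsto_intros)

text \<open>With \<open>y = binv G x\<close>, the error is \<open>binv (Gm n)\<close> applied to
  \<open>G y - Gm n y\<close>; the uniform bound on the inverses reduces the claim to strong
  convergence of \<open>Gm\<close>.\<close>

lemma binv_Gm_tendsto: "(\<lambda>n. binv (Gm n) x) \<longlonglongrightarrow> binv G x"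
proof -
  let ?y = "binv G x"
  have "(\<lambda>n. binv (Gm n) x - ?y) \<longlonglongrightarrow> 0"
  proof (rule Lim_null_comparison)
    have "norm (binv (Gm n) x - ?y) \<le> norm (G ?y - Gm n ?y)" for n
    proof -
      have "binv (Gm n) x - ?y = binv (Gm n) (G ?y - Gm n ?y)"
        by (simp add: blinfun.diff_right binv_left[OF Gm_coercive] binv_right[OF G_coercive])
      then show ?thesis
        by (simp add: norm_le_one_apply norm_binv_le[OF Gm_coercive])
    qed
    then show "\<forall>\<^sub>F n in sequentially. norm (binv (Gm n) x - ?y) \<le> norm (G ?y - Gm n ?y)" by simp
    have "(\<lambda>n. G ?y - Gm n ?y) \<longlonglongrightarrow> G ?y - G ?y"
      by (intro tendsto_diff tendsto_const Gm_tendsto)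
    then show "(\<lambda>n. norm (G ?y - Gm n ?y)) \<longlonglongrightarrow> 0"
      by (simp add: tendsto_norm_zero)
  qed
  then show ?thesis by (simp add: LIM_zero_iff)
qed

lemma Tn_tendsto: "Tn \<longlonglongrightarrow> Top"
proof -
  note compose_tendsto = bounded_bilinear.tendsto[OF bounded_bilinear_blinfun_compose]
  have CS: "(\<lambda>n. Cn n o\<^sub>L S) \<longlonglongrightarrow> (C o\<^sub>L S)"
    by (rule strong_compose_compact_tendsto[OF Cn_norm Cn_tendsto S_compact])
  have RS: "(\<lambda>n. binv (Gm n) o\<^sub>L S) \<longlonglongrightarrow> (binv G o\<^sub>L S)"
    by (rule strong_compose_compact_tendsto[OF norm_binv_le[OF Gm_coercive] binv_Gm_tendsto S_compact])
  \<comment> \<open>The difference has the adjoint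
    \<open>(Cn n o\<^sub>L S) - (C o\<^sub>L S)\<close>, whose norm tends to 0 by
    \<open>CS\<close>.\<close>
  have SC: "(\<lambda>n. (S o\<^sub>L Cn n) - (S o\<^sub>L C)) \<longlonglongrightarrow> 0"
  proof (rule Lim_null_comparison)
    show "\<forall>\<^sub>F n in sequentially. norm ((S o\<^sub>L Cn n) - (S o\<^sub>L C)) \<le> norm ((Cn n o\<^sub>L S) - (C o\<^sub>L S))"
    proof (intro always_eventually allI norm_le_adjoint)
      fix n x y
      have "inner (S (Cn n x)) y = inner x (Cn n (S y))" "inner (S (C x)) y = inner x (C (S y))"
        by (simp_all add: inner_ell2_def S_sa Cn_sa C_sa)
      then show "inner (((S o\<^sub>L Cn n) - (S o\<^sub>L C)) x) y = inner x (((Cn n o\<^sub>L S) - (C o\<^sub>L S)) y)"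
        by (simp add: blinfun.diff_left inner_diff_left inner_diff_right)
    qed
    show "(\<lambda>n. norm ((Cn n o\<^sub>L S) - (C o\<^sub>L S))) \<longlonglongrightarrow> 0"
      using CS by (intro tendsto_norm_zero) (simp add: LIM_zero_iff)
  qed
  have R: "(\<lambda>n. binv (Gm n) o\<^sub>L ((S o\<^sub>L Cn n) - (S o\<^sub>L C))) \<longlonglongrightarrow> 0"
  proof (rule Lim_null_comparison)
    have "norm (binv (Gm n) o\<^sub>L X) \<le> norm X" for n and X :: "'i ell2 \<Rightarrow>\<^sub>L 'i ell2"
      using norm_blinfun_compose[of "binv (Gm n)" X] norm_binv_le[OF Gm_coercive, of n]
      by (meson mult_left_le_one_le norm_ge_zero order_trans)
    then show "\<forall>\<^sub>F n in sequentially. norm (binv (Gm n) o\<^sub>L ((S o\<^sub>L Cn n) - (S o\<^sub>L C))) \<le> norm ((S o\<^sub>L Cn n) - (S o\<^sub>L C))"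
      by simp
    show "(\<lambda>n. norm ((S o\<^sub>L Cn n) - (S o\<^sub>L C))) \<longlonglongrightarrow> 0"
      using SC by (rule tendsto_norm_zero)
  qed
  \<comment> \<open>The right \<open>S\<close> is needed by both \<open>binv (Gm n)\<close> and
    \<open>Cn n\<close>. Splitting off \<open>S o\<^sub>L C\<close> lets it serve each once: the
    difference is small in norm, and in the remaining term \<open>C\<close> is fixed.\<close>
  have "(\<lambda>n. (Cn n o\<^sub>L S) o\<^sub>L ((binv (Gm n) o\<^sub>L ((S o\<^sub>L Cn n) - (S o\<^sub>L C))) + ((binv (Gm n) o\<^sub>L S) o\<^sub>L C)))
      \<longlonglongrightarrow> ((C o\<^sub>L S) o\<^sub>L (0 + ((binv G o\<^sub>L S) o\<^sub>L C)))"
    by (intro compose_tendsto tendsto_add CS RS R tendsto_const)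
  moreover have "(Cn n o\<^sub>L S) o\<^sub>L ((binv (Gm n) o\<^sub>L ((S o\<^sub>L Cn n) - (S o\<^sub>L C))) + ((binv (Gm n) o\<^sub>L S) o\<^sub>L C)) = Tn n" for n
    by (rule blinfun_eqI) (simp add: Tn_def blinfun.add_left blinfun.diff_left blinfun.add_right blinfun.diff_right)
  moreover have "(C o\<^sub>L S) o\<^sub>L (0 + ((binv G o\<^sub>L S) o\<^sub>L C)) = Top"
    by (rule blinfun_eqI) (simp add: Top_def)
  ultimately show ?thesis by simp
qed

lemma sval_Tn_tendsto:
  assumes "k \<ge> 1"
  shows "(\<lambda>n. sval (Tn n) k) \<longlonglongrightarrow> sval Top k"
proof -
  have "(\<lambda>n. sval (Tn n) k - sval Top k) \<longlonglongrightarrow> 0"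
  proof (rule Lim_null_comparison)
    show "\<forall>\<^sub>F n in sequentially. norm (sval (Tn n) k - sval Top k) \<le> norm (Tn n - Top)"
      using sval_diff_le[OF Tn_compact_positive Top_compact_positive assms] by simp
    show "(\<lambda>n. norm (Tn n - Top)) \<longlonglongrightarrow> 0"
      using Tn_tendsto by (intro tendsto_norm_zero) (simp add: LIM_zero_iff)
  qed
  then show ?thesis by (simp add: LIM_zero_iff)
qed

end

subsection \<open>Transport to Fourier coefficients\<close>

lemma norm_coefE: "L > 0 \<Longrightarrow> f \<in> L2 L \<Longrightarrow> (norm (coefE L f))\<^sup>2 = Re (ip L f f)"
  by (simp add: Parseval cin_self_norm)

lemma coefE_cmult:
  assumes "L > 0" "f \<in> L2 L"
  shows "coefE L (\<lambda>x. c * f x) = cscale c (coefE L f)"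
  using assms by (intro ell2_eqI) (simp add: L2_cmult, simp add: coef_def ip_cmult_left)

lemma coefE_eqI:
  assumes "L > 0" "f \<in> L2 L" "\<And>k. coef L f k = nth2 c k"
  shows "coefE L f = c"
  using assms by (intro ell2_eqI) simp

lemma coefE_eq_iff_AE:
  assumes "L > 0" "f \<in> L2 L" "g \<in> L2 L"
  shows "coefE L f = coefE L g \<longleftrightarrow> (AE x in lebesgue. x \<in> sqbox L \<longrightarrow> f x = g x)"
proof
  assume eq: "coefE L f = coefE L g"
  have "coef L f k = coef L g k" for k
    using assms eq nth2_coefE by metis
  then show "AE x in lebesgue. x \<in> sqbox L \<longrightarrow> f x = g x"
    using coef_eq_imp_AE_eq[OF assms] by (simp add: AE_Mbox)
next
  assume "AE x in lebesgue. x \<in> sqbox L \<longrightarrow> f x = g x"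
  then have "coef L f k = coef L g k" for k
    unfolding coef_def by (intro ip_cong_AE assms phi_L2) (simp add: AE_Mbox)
  then have "coef L f = coef L g" ..
  then show "coefE L f = coefE L g"
    by (simp add: coefE_def)
qed

lemma coefE_surj:
  assumes "L > 0"
  obtains f where "f \<in> L2 L" "coefE L f = c"
  using coef_surj[OF assms, of c] coefE_eqI[OF assms] by metis

text \<open>Taking coefficients preserves products and turns eigenvalue equations almost everywhere
  into equations in \<open>ell2\<close>; surjectivity of \<open>coefE\<close> brings eigenvectors
  back.\<close>

lemma sdown_eq_sval:
  fixes A :: "(int^'d) ell2 \<Rightarrow>\<^sub>L (int^'d) ell2"
  assumes L: "L > 0" and T: "\<And>f. f \<in> L2 L \<Longrightarrow> T f \<in> L2 L" "\<And>f. f \<in> L2 L \<Longrightarrow> coefE L (T f) = A (coefE L f)"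
  shows "sdown L T k = sval A k"
proof -
  have ev: "(AE x in lebesgue. x \<in> sqbox L \<longrightarrow> T f x = complex_of_real \<mu> * f x)
      \<longleftrightarrow> A (coefE L f) = \<mu> *\<^sub>R coefE L f" if "f \<in> L2 L" for f \<mu>
    using coefE_eq_iff_AE[OF L T(1)[OF that] L2_cmult[OF that]]
    by (simp add: T(2) that coefE_cmult L scaleR_ell2_def)
  define Q where "Q = (\<lambda>r fs \<mu>s. length fs = k \<and>
      (\<forall>i<k. fs!i \<in> L2 L \<and> \<mu>s i \<ge> r \<and>
         (AE x in lebesgue. x \<in> sqbox L \<longrightarrow> T (fs!i) x = complex_of_real (\<mu>s i) * (fs!i) x)) \<and>
      (\<forall>i<k. \<forall>j<k. ip L (fs!i) (fs!j) = (if i = j then 1 else 0)))"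
  have "(\<exists>fs \<mu>s. Q r fs \<mu>s) \<longleftrightarrow> (\<exists>e \<mu>. orthonormal k e \<and> (\<forall>i<k. r \<le> \<mu> i \<and> A (e i) = \<mu> i *\<^sub>R e i))" for r
  proof
    assume "\<exists>fs \<mu>s. Q r fs \<mu>s"
    then obtain fs \<mu>s where Q: "Q r fs \<mu>s" by blast
    have "orthonormal k (\<lambda>i. coefE L (fs!i))"
      using Q by (auto simp: Q_def orthonormal_def Parseval[OF L, symmetric])
    moreover have "\<forall>i<k. r \<le> \<mu>s i \<and> A (coefE L (fs!i)) = \<mu>s i *\<^sub>R coefE L (fs!i)"
      using Q ev unfolding Q_def by blast
    ultimately show "\<exists>e \<mu>. orthonormal k e \<and> (\<forall>i<k. r \<le> \<mu> i \<and> A (e i) = \<mu> i *\<^sub>R e i)"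
      by (intro exI[of _ "\<lambda>i. coefE L (fs!i)"] exI[of _ \<mu>s]) simp
  next
    assume "\<exists>e \<mu>. orthonormal k e \<and> (\<forall>i<k. r \<le> \<mu> i \<and> A (e i) = \<mu> i *\<^sub>R e i)"
    then obtain e \<mu> where e: "orthonormal k e" "\<And>i. i < k \<Longrightarrow> r \<le> \<mu> i" "\<And>i. i < k \<Longrightarrow> A (e i) = \<mu> i *\<^sub>R e i"
      by blast
    have "\<exists>f. f \<in> L2 L \<and> coefE L f = c" for c :: "(int^'d) ell2"
      using coefE_surj[OF L] by metis
    then obtain g where g: "\<And>c. g c \<in> L2 L" "\<And>c :: (int^'d) ell2. coefE L (g c) = c"
      by metis
    have "Q r (map (\<lambda>i. g (e i)) [0..<k]) \<mu>"
      unfolding Q_def using e g ev[OF g(1)] by (auto simp: Parseval[OF L g(1) g(1)] orthonormal_def)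
    then show "\<exists>fs \<mu>s. Q r fs \<mu>s" by blast
  qed
  then show ?thesis
    unfolding sdown_def sval_def eigen_levels_def Q_def by simp
qed

section \<open>Restriction to the domain as an operator on coefficients\<close>

lemma Cop_L2:
  assumes "\<Omega> \<in> sets lebesgue" "f \<in> L2 L"
  shows "Cop \<Omega> f \<in> L2 L"
  unfolding Cop_def by (rule L2_mult_bounded[where B=1]) (use assms in \<open>auto simp: indicator_def\<close>)

lemma ip_Cop: "ip L (Cop \<Omega> f) g = ip L f (Cop \<Omega> g)"
  unfolding ip_eq Cop_def by (intro Bochner_Integration.integral_cong) (auto simp: indicator_def)

lemma ip_Cop_Cop: "ip L (Cop \<Omega> f) (Cop \<Omega> g) = ip L (Cop \<Omega> f) g"
  unfolding ip_eq Cop_def by (intro Bochner_Integration.integral_cong) (auto simp: indicator_def)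

lemma ip_Cop_le:
  assumes "\<Omega> \<in> sets lebesgue" "f \<in> L2 L"
  shows "Re (ip L (Cop \<Omega> f) (Cop \<Omega> f)) \<le> Re (ip L f f)"
  unfolding ip_self using Cop_L2[OF assms] assms(2)
  by (auto simp: L2_iff Cop_def indicator_def intro!: integral_mono)

text \<open>Restriction is self-adjoint, so the coefficient of \<open>Cop \<Omega> f\<close> at
  \<open>k\<close> is the product of \<open>f\<close> with
  \<open>Cop \<Omega> (phi L k)\<close>.\<close>

definition Cell :: "real \<Rightarrow> (real^'d) set \<Rightarrow> (int^'d) ell2 \<Rightarrow>\<^sub>L (int^'d) ell2" where
  "Cell L \<Omega> = Blinfun (\<lambda>c. Abs_ell2 (\<lambda>k. cin c (coefE L (Cop \<Omega> (phi L k)))))"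

context
  fixes L :: real and \<Omega> :: "(real^'d) set"
  assumes L: "L > 0" and \<Omega>: "\<Omega> \<in> sets lebesgue"
begin

lemma Cell_coefE:
  assumes "f \<in> L2 L"
  shows "Cell L \<Omega> (coefE L f) = coefE L (Cop \<Omega> f)"
    and "norm (Cell L \<Omega>) \<le> 1"
proof -
  define D where "D = (\<lambda>c. Abs_ell2 (\<lambda>k. cin c (coefE L (Cop \<Omega> (phi L k)))))"
  have D: "D (coefE L f) = coefE L (Cop \<Omega> f)" if "f \<in> L2 L" for f
  proof -
    have "cin (coefE L f) (coefE L (Cop \<Omega> (phi L k))) = coef L (Cop \<Omega> f) k" for k
      using that by (simp add: Parseval[symmetric] L Cop_L2 \<Omega> coef_def ip_Cop)
    then show ?thesis
      unfolding D_def coefE_def[of L "Cop \<Omega> f"] by simp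
  qed
  \<comment> \<open>Square-summability of the defining family is inherited from
    \<open>Cop \<Omega> f\<close>, where \<open>f\<close> is a function with coefficients
    \<open>c\<close>.\<close>
  have nth: "nth2 (D c) k = cin c (coefE L (Cop \<Omega> (phi L k)))" for c k
  proof -
    obtain f where f: "f \<in> L2 L" "coefE L f = c"
      using coefE_surj[OF L] by blast
    then show ?thesis
      using D[OF f(1)] by (simp add: L Cop_L2 \<Omega> coef_def Parseval ip_Cop flip: f(2))
  qed
  have n: "norm (D c) \<le> norm c" for c
  proof -
    obtain f where f: "f \<in> L2 L" "coefE L f = c"
      using coefE_surj[OF L] by blast
    have "(norm (D c))\<^sup>2 \<le> (norm c)\<^sup>2"
      using ip_Cop_le[OF \<Omega> f(1)] D[OF f(1)] by (simp add: norm_coefE L Cop_L2 \<Omega> f(1) flip: f(2))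
    then show ?thesis by (rule power2_le_imp_le) simp
  qed
  have "D (x + y) = D x + D y" "D (r *\<^sub>R x) = r *\<^sub>R D x" for x y r
    by (auto intro!: ell2_eqI simp: nth cin_add_left)
  then have "bounded_linear D"
    by (rule bounded_linear_intro[where K=1]) (simp add: n)
  then have app: "blinfun_apply (Cell L \<Omega>) = D"
    unfolding Cell_def D_def[symmetric] by (simp add: bounded_linear_Blinfun_apply)
  show "Cell L \<Omega> (coefE L f) = coefE L (Cop \<Omega> f)"
    using D[OF assms] by (simp add: app)
  show "norm (Cell L \<Omega>) \<le> 1"
    by (rule norm_blinfun_bound) (simp_all add: app n)
qed

lemma Cell_norm: "norm (Cell L \<Omega>) \<le> 1"
  using Cell_coefE(2)[OF phi_L2] .

lemma Cell_cscale: "Cell L \<Omega> (cscale z x) = cscale z (Cell L \<Omega> x)"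
proof -
  obtain f where f: "f \<in> L2 L" "coefE L f = x"
    using coefE_surj[OF L] by blast
  have "Cop \<Omega> (\<lambda>x. z * f x) = (\<lambda>x. z * Cop \<Omega> f x)"
    by (simp add: Cop_def mult_ac)
  then show ?thesis
    using f(1) by (simp add: coefE_cmult[symmetric] L Cell_coefE L2_cmult Cop_L2 \<Omega> flip: f(2))
qed

lemma cin_Cell_coefE:
  assumes "f \<in> L2 L" "g \<in> L2 L"
  shows "cin (Cell L \<Omega> (coefE L f)) (coefE L g) = ip L (Cop \<Omega> f) g"
  using assms by (simp add: Cell_coefE Parseval L Cop_L2 \<Omega>)

lemma Cell_sa: "cin (Cell L \<Omega> x) y = cin x (Cell L \<Omega> y)"
proof -
  obtain f g where "f \<in> L2 L" "coefE L f = x" "g \<in> L2 L" "coefE L g = y"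
    using coefE_surj[OF L] by metis
  then show ?thesis
    by (metis Cell_coefE(1) Cop_L2 L Parseval \<Omega> ip_Cop)
qed

lemma Cell_pos: "0 \<le> inner (Cell L \<Omega> x) x"
proof -
  obtain f where f: "f \<in> L2 L" "coefE L f = x"
    using coefE_surj[OF L] by metis
  have "inner (Cell L \<Omega> x) x = Re (ip L (Cop \<Omega> f) (Cop \<Omega> f))"
    using cin_Cell_coefE[OF f(1) f(1)] by (simp add: inner_ell2_def f(2) ip_Cop_Cop)
  then show ?thesis by (simp add: ip_self)
qed

end

lemma Proj_L2: "Proj L m g \<in> L2 L"
  unfolding Proj_def by (rule phi_sum_L2)

lemma coefE_Proj:
  assumes "L > 0" "g \<in> L2 L"
  shows "coefE L (Proj L m g) = cut (Km m) (coefE L g)"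
  by (rule coefE_eqI) (use assms in \<open>simp_all add: Proj_L2, simp add: Proj_def coef_phi_sum finite_Km\<close>)

subsection \<open>The Sobolev form in Fourier coordinates\<close>

lemma sqnorm_nonneg: "0 \<le> sqnorm k"
  by (simp add: sqnorm_def sum_nonneg)

lemma component_sq_le_sqnorm: "(real_of_int (k$l))\<^sup>2 \<le> sqnorm k"
  unfolding sqnorm_def by (rule member_le_sum) auto

lemma norm_div_one_plus_le:
  assumes "0 \<le> t" "t \<le> B"
  shows "norm (t / (1 + t)) \<le> (B :: real)"
proof -
  have "t / (1 + t) \<le> t"
    using assms by (simp add: divide_le_eq_1 field_simps)
  then show ?thesis using assms by simp
qed

lemma cin_right_eqI:
  assumes "\<And>y. cin x y = cin x' y"
  shows "x = x'"
  using assms by (metis inner_ell2_def inner_eq_zero_iff inner_diff_left right_minus_eq)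

locale sobolev =
  fixes L :: real and \<Omega> :: "(real^'d) set" and s :: nat and lam mu :: real
    and a :: "('d \<Rightarrow> nat) \<Rightarrow> real"
  assumes L: "L > 0" and \<Omega>: "\<Omega> \<in> sets lebesgue" and \<Omega>_sub: "\<Omega> \<subseteq> cube L"
    and s: "real s > real CARD('d) / 2" and lam: "lam > 0" and mu: "mu \<ge> 0"
begin

definition V :: real where "V = (2*L) ^ CARD('d)"
text \<open>The weight of \<open>hs_inner\<close> multiplied by \<open>lam\<close>: dividing by its
  square root turns the first term of \<open>q\<close> into the squared norm, with constant
  1.\<close>

definition wt :: "int^'d \<Rightarrow> real" where "wt k = lam * (1 + (sqnorm k / V) ^ s)"
definition sm :: "int^'d \<Rightarrow> real" where "sm k = 1 / sqrt (wt k)"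
text \<open>The symbol of the differential operator composed with \<open>S\<close>.\<close>

definition em :: "int^'d \<Rightarrow> complex" where "em k = symb L s a k * complex_of_real (sm k)"

lemma V_pos: "V > 0"
  using L by (simp add: V_def)

lemma wt_ge: "lam \<le> wt k"
proof -
  have "0 \<le> (sqnorm k / V) ^ s"
    using V_pos sqnorm_nonneg[of k] by simp
  then show ?thesis
    using lam by (simp add: wt_def)
qed

lemma wt_pos: "wt k > 0"
  using wt_ge[of k] lam by simp

lemma sm_pos: "sm k > 0"
  by (simp add: sm_def wt_pos)

lemma sm_sq: "(sm k)\<^sup>2 = 1 / wt k"
  using wt_pos[of k] by (simp add: sm_def power_divide)

lemma sm_le: "\<bar>sm k\<bar> \<le> 1 / sqrt lam"
  using wt_ge[of k] wt_pos[of k] lam by (simp add: sm_def frac_le)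

text \<open>\<open>Hs\<close> and \<open>hs_inner\<close> use different weights. This bound and
  \<open>wt_le_sobolev\<close> make them equivalent, so that \<open>Hs\<close> corresponds to the
  range of \<open>S\<close>.\<close>

lemma sobolev_weight_le: "1 + sqnorm k ^ s \<le> (1 + V ^ s) / lam * wt k"
proof -
  have "(sqnorm k / V) ^ s * V ^ s = sqnorm k ^ s" "0 \<le> (sqnorm k / V) ^ s" "0 < V ^ s"
    using V_pos sqnorm_nonneg[of k] by (simp_all add: power_divide)
  moreover have "(1 + V ^ s) / lam * wt k = 1 + V ^ s + (sqnorm k / V) ^ s + (sqnorm k / V) ^ s * V ^ s"
    using lam by (simp add: wt_def field_simps)
  ultimately show ?thesis by linarith
qed

lemma wt_le_sobolev: "wt k \<le> lam * (1 + 1 / V ^ s) * (1 + sqnorm k ^ s)"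
proof -
  have "wt k = lam * (1 + 1 / V ^ s * sqnorm k ^ s)"
    by (simp add: wt_def power_divide)
  also have "\<dots> \<le> lam * ((1 + 1 / V ^ s) * (1 + sqnorm k ^ s))"
  proof (rule mult_left_mono)
    have "0 \<le> 1 / V ^ s" "0 \<le> sqnorm k ^ s"
      using V_pos sqnorm_nonneg[of k] by simp_all
    then show "1 + 1 / V ^ s * sqnorm k ^ s \<le> (1 + 1 / V ^ s) * (1 + sqnorm k ^ s)"
      unfolding distrib_left distrib_right by linarith
  qed (use lam in simp)
  finally show ?thesis by (simp add: mult.assoc)
qed

definition Be :: real where
  "Be = (\<Sum>\<alpha>\<in>mindex s. \<bar>a \<alpha>\<bar>) * sqrt ((1 + pi / (2*L)) ^ (2 * s) * ((1 + V ^ s) / lam))"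

text \<open>The operator has order at most \<open>s\<close>, so its symbol grows no faster than the
  square root of the weight.\<close>

lemma em_le: "cmod (em k) \<le> Be"
proof -
  define c where "c = pi / (2*L)"
  have c: "c > 0" using L by (simp add: c_def)
  define r where "r = sqrt (sqnorm k)"
  \<comment> \<open>\<open>\<rho>\<close> dominates every factor
    \<open>\<i> * pi * k$l / (2*L)\<close>, and being at least 1 it lets all orders up to
    \<open>s\<close> be bounded by the power \<open>s\<close>.\<close>
  define \<rho> where "\<rho> = (1 + c) * max 1 r"
  have \<rho>1: "1 \<le> \<rho>"
    unfolding \<rho>_def using c mult_mono[of 1 "1 + c" 1 "max 1 r"] by simp
  have comp: "cmod (\<i> * complex_of_real (pi * real_of_int (k$l) / (2*L))) \<le> \<rho>" for l
  proof -
    have "cmod (\<i> * complex_of_real (pi * real_of_int (k$l) / (2*L))) = c * \<bar>real_of_int (k$l)\<bar>"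
      unfolding norm_mult norm_of_real using L by (simp add: c_def abs_mult)
    also have "\<dots> \<le> c * r"
      using c component_sq_le_sqnorm[of k l] unfolding r_def by (intro mult_left_mono real_le_rsqrt) auto
    also have "\<dots> \<le> \<rho>"
      unfolding \<rho>_def using c sqnorm_nonneg[of k] by (intro mult_mono) (auto simp: r_def)
    finally show ?thesis .
  qed
  have "cmod (symb L s a k) \<le> (\<Sum>\<alpha>\<in>mindex s. \<bar>a \<alpha>\<bar> * \<rho> ^ s)"
    unfolding symb_def
  proof (rule order_trans[OF norm_sum sum_mono])
    fix \<alpha> :: "'d \<Rightarrow> nat" assume \<alpha>: "\<alpha> \<in> mindex s"
    have "cmod (\<Prod>l\<in>UNIV. (\<i> * complex_of_real (pi * real_of_int (k$l) / (2*L))) ^ \<alpha> l) \<le> (\<Prod>l\<in>UNIV. \<rho> ^ \<alpha> l)"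
      unfolding prod_norm[symmetric] norm_power by (intro prod_mono conjI power_mono comp) auto
    also have "\<dots> = \<rho> ^ (\<Sum>l\<in>UNIV. \<alpha> l)"
      by (simp add: power_sum)
    also have "\<dots> \<le> \<rho> ^ s"
      using \<alpha> \<rho>1 by (intro power_increasing) (auto simp: mindex_def)
    finally show "cmod (complex_of_real (a \<alpha>) * (\<Prod>l\<in>UNIV. (\<i> * complex_of_real (pi * real_of_int (k$l) / (2*L))) ^ \<alpha> l))
        \<le> \<bar>a \<alpha>\<bar> * \<rho> ^ s"
      by (simp add: norm_mult mult_left_mono)
  qed
  then have symb: "cmod (symb L s a k) \<le> (\<Sum>\<alpha>\<in>mindex s. \<bar>a \<alpha>\<bar>) * \<rho> ^ s"
    by (simp add: sum_distrib_right)
  have "(\<rho> ^ s * sm k)\<^sup>2 \<le> (1 + c) ^ (2 * s) * ((1 + V ^ s) / lam)"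
  proof -
    have "(max 1 r)\<^sup>2 = max 1 (sqnorm k)"
      using sqnorm_nonneg[of k] by (auto simp: r_def max_def)
    then have "(max 1 r ^ s)\<^sup>2 = max 1 (sqnorm k) ^ s"
      by (metis power_mult mult.commute)
    also have "\<dots> \<le> 1 + sqnorm k ^ s"
      using sqnorm_nonneg[of k] by (auto simp: max_def)
    also have "\<dots> \<le> (1 + V ^ s) / lam * wt k"
      by (rule sobolev_weight_le)
    finally have "(max 1 r ^ s)\<^sup>2 / wt k \<le> (1 + V ^ s) / lam"
      using wt_pos[of k] by (simp add: divide_le_eq)
    then have "(1 + c) ^ (2 * s) * ((max 1 r ^ s)\<^sup>2 / wt k) \<le> (1 + c) ^ (2 * s) * ((1 + V ^ s) / lam)"
      using c by (intro mult_left_mono) auto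
    moreover have "(\<rho> ^ s * sm k)\<^sup>2 = (1 + c) ^ (2 * s) * ((max 1 r ^ s)\<^sup>2 / wt k)"
      by (simp add: \<rho>_def power_mult_distrib sm_sq flip: power_mult, simp add: mult.commute)
    ultimately show ?thesis by simp
  qed
  then have \<rho>s: "\<rho> ^ s * sm k \<le> sqrt ((1 + c) ^ (2 * s) * ((1 + V ^ s) / lam))"
    by (rule real_le_rsqrt)
  have "cmod (em k) = cmod (symb L s a k) * sm k"
    using sm_pos[of k] by (simp add: em_def norm_mult)
  also have "\<dots> \<le> (\<Sum>\<alpha>\<in>mindex s. \<bar>a \<alpha>\<bar>) * \<rho> ^ s * sm k"
    using symb sm_pos[of k] by (intro mult_right_mono) auto
  also have "\<dots> \<le> (\<Sum>\<alpha>\<in>mindex s. \<bar>a \<alpha>\<bar>) * sqrt ((1 + c) ^ (2 * s) * ((1 + V ^ s) / lam))"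
    unfolding mult.assoc using \<rho>s by (intro mult_left_mono sum_nonneg) auto
  finally show ?thesis by (simp add: Be_def c_def)
qed

definition \<kappa> :: real where "\<kappa> = sqrt (V ^ s / lam)"

lemma \<kappa>_pos: "\<kappa> > 0"
  using V_pos lam by (simp add: \<kappa>_def)

text \<open>Outside \<open>Km m\<close> some coordinate has modulus at least \<open>m + 1\<close>.
  The value of \<open>\<kappa>\<close> is what the leading term of the weight gives at squared
  frequency \<open>(m + 1)\<^sup>2\<close>.\<close>

lemma sm_tail_bound:
  assumes "k \<notin> Km m"
  shows "\<bar>sm k\<bar> \<le> \<kappa> / real (m + 1) ^ s"
proof -
  obtain l where "\<not> \<bar>k$l\<bar> \<le> int m"
    using assms by (auto simp: Km_def)
  then have "int (m + 1) \<le> \<bar>k$l\<bar>"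
    by simp
  then have "real_of_int (int (m + 1)) \<le> real_of_int \<bar>k$l\<bar>"
    by (simp only: of_int_le_iff)
  then have "real (m + 1) ^ 2 \<le> \<bar>real_of_int (k$l)\<bar> ^ 2"
    by (intro power_mono) auto
  also have "\<dots> \<le> sqnorm k"
    using component_sq_le_sqnorm[of k l] by simp
  finally have sq: "real (m + 1) ^ 2 \<le> sqnorm k" .
  have "(real (m + 1) ^ s / \<kappa>)\<^sup>2 = lam * (real (m + 1) ^ 2 / V) ^ s"
    using V_pos lam by (simp add: \<kappa>_def power_divide field_simps flip: power_mult)
  also have "\<dots> \<le> lam * (sqnorm k / V) ^ s"
    using sq lam V_pos by (intro mult_left_mono power_mono divide_right_mono) auto
  also have "\<dots> \<le> wt k"
    using lam by (simp add: wt_def)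
  finally have "real (m + 1) ^ s / \<kappa> \<le> sqrt (wt k)"
    by (rule real_le_rsqrt)
  moreover have "0 < real (m + 1) ^ s / \<kappa>"
    using \<kappa>_pos by simp
  ultimately have "1 / sqrt (wt k) \<le> 1 / (real (m + 1) ^ s / \<kappa>)"
    by (intro divide_left_mono mult_pos_pos) (auto simp: wt_pos)
  then show ?thesis
    using sm_pos[of k] by (simp add: sm_def)
qed

lemma s_pos: "s \<ge> 1"
  using s by (cases s) auto

sublocale galerkin "Cell L \<Omega>" sm em mu Km "1 / sqrt lam" Be
proof
  show "\<exists>n. \<forall>k. k \<notin> Km n \<longrightarrow> \<bar>sm k\<bar> \<le> e" if "e > 0" for e
  proof -
    obtain n where n: "\<kappa> / e < real n"
      using reals_Archimedean2 by blast
    have "\<kappa> / real (n + 1) ^ s \<le> e"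
    proof -
      have "\<kappa> / e \<le> real (n + 1)" using n by simp
      also have "\<dots> \<le> real (n + 1) ^ s"
        using s_pos power_increasing[of 1 s "real (n + 1)"] by simp
      finally show ?thesis
        using that by (simp add: divide_le_eq mult.commute)
    qed
    then show ?thesis
      using sm_tail_bound[of _ n] order_trans by blast
  qed
qed (use L \<Omega> mu in \<open>simp_all add: Cell_cscale Cell_sa Cell_pos Cell_norm sm_le em_le finite_Km incseq_Km UN_Km\<close>)

section \<open>The form and the two inverses in the coordinates of \<open>S\<close>\<close>

lemma Hs_imp_range_S:
  assumes "f \<in> Hs L s"
  shows "\<exists>b. coefE L f = S b"
proof -
  have f: "f \<in> L2 L" "(\<lambda>k. (cmod (coef L f k))\<^sup>2 * (1 + sqnorm k ^ s)) summable_on UNIV"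
    using assms by (auto simp: Hs_def)
  define b where "b = (\<lambda>k. coef L f k * complex_of_real (sqrt (wt k)))"
  have "(\<lambda>k. (cmod (b k))\<^sup>2) summable_on UNIV"
  proof (rule summable_on_comparison_test)
    show "(\<lambda>k. lam * (1 + 1 / V ^ s) * ((cmod (coef L f k))\<^sup>2 * (1 + sqnorm k ^ s))) summable_on UNIV"
      using f(2) by (rule summable_on_cmult_right)
    fix k
    have "(cmod (b k))\<^sup>2 = (cmod (coef L f k))\<^sup>2 * wt k"
      using wt_pos[of k] by (simp add: b_def norm_mult power_mult_distrib)
    also have "\<dots> \<le> (cmod (coef L f k))\<^sup>2 * (lam * (1 + 1 / V ^ s) * (1 + sqnorm k ^ s))"
      by (intro mult_left_mono wt_le_sobolev) auto
    finally show "(cmod (b k))\<^sup>2 \<le> lam * (1 + 1 / V ^ s) * ((cmod (coef L f k))\<^sup>2 * (1 + sqnorm k ^ s))"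
      by (simp add: mult_ac)
  qed auto
  then have "coefE L f = S (Abs_ell2 b)"
    using L f(1) wt_pos by (intro ell2_eqI) (simp add: nth2_Abs b_def sm_def less_imp_neq[symmetric])
  then show ?thesis by blast
qed

text \<open>Together with \<open>Hs_imp_range_S\<close>: test functions in \<open>Hs\<close> amount
  to arbitrary \<open>b'\<close> after the substitution by \<open>S\<close>.\<close>

lemma range_S_imp_Hs:
  assumes "f \<in> L2 L" "coefE L f = S b"
  shows "f \<in> Hs L s"
proof -
  have coef: "coef L f k = complex_of_real (sm k) * nth2 b k" for k
    using nth2_coefE[OF L assms(1), of k] assms(2) by simp
  have "(\<lambda>k. (cmod (coef L f k))\<^sup>2 * (1 + sqnorm k ^ s)) summable_on UNIV"
  proof (rule summable_on_comparison_test)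
    show "(\<lambda>k. (1 + V ^ s) / lam * (cmod (nth2 b k))\<^sup>2) summable_on UNIV"
      by (intro summable_on_cmult_right nth2_summable)
    fix k
    have "(cmod (coef L f k))\<^sup>2 * (1 + sqnorm k ^ s) = (cmod (nth2 b k))\<^sup>2 * ((1 + sqnorm k ^ s) / wt k)"
      by (simp add: coef norm_mult power_mult_distrib sm_sq)
    also have "\<dots> \<le> (cmod (nth2 b k))\<^sup>2 * ((1 + V ^ s) / lam)"
      using sobolev_weight_le[of k] wt_pos[of k] by (intro mult_left_mono) (auto simp: divide_le_eq)
    finally show "(cmod (coef L f k))\<^sup>2 * (1 + sqnorm k ^ s) \<le> (1 + V ^ s) / lam * (cmod (nth2 b k))\<^sup>2"
      by (simp add: mult.commute)
  qed (simp add: sqnorm_nonneg)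
  then show ?thesis
    using assms(1) by (simp add: Hs_def)
qed

text \<open>Boundedness of \<open>em\<close> provides a function with the required coefficients, so
  \<open>SOME\<close> picks one; its coefficients are determined even though its values on null sets
  are not.\<close>

lemma Dop_coefE:
  assumes "f \<in> L2 L" "coefE L f = S b"
  shows "Dop L s a f \<in> L2 L" "coefE L (Dop L s a f) = E b"
proof -
  obtain g where g: "g \<in> L2 L" "\<And>k. coef L g k = nth2 (E b) k"
    using coef_surj[OF L, of "E b"] by metis
  have f: "coef L f k = complex_of_real (sm k) * nth2 b k" for k
    using nth2_coefE[OF L assms(1), of k] assms(2) by simp
  have "\<exists>g. g \<in> L2 L \<and> (\<forall>k. coef L g k = symb L s a k * coef L f k)"
    using g by (intro exI[of _ g]) (simp add: f em_def mult.assoc)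
  from someI_ex[OF this] have D: "Dop L s a f \<in> L2 L" "\<And>k. coef L (Dop L s a f) k = symb L s a k * coef L f k"
    unfolding Dop_def by auto
  show "Dop L s a f \<in> L2 L" by (fact D(1))
  show "coefE L (Dop L s a f) = E b"
    by (rule coefE_eqI[OF L D(1)]) (simp add: D(2) f em_def mult.assoc)
qed

lemma \<Omega>_sub_sqbox: "\<Omega> \<subseteq> sqbox L"
proof
  fix x assume "x \<in> \<Omega>"
  then have "\<bar>x$l\<bar> \<le> L" for l
    using \<Omega>_sub by (auto simp: cube_def)
  then have "\<bar>x$l\<bar> \<le> 2 * L" for l
    by (rule order_trans) (use L in simp)
  then show "x \<in> sqbox L"
    by (simp add: sqbox_def cube_def)
qed

text \<open>In the Sobolev term \<open>sm k\<close> squared cancels the weight up to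
  \<open>1 / lam\<close>. In the other term the domain lies in the box, so the integral over it is
  an \<open>ip\<close> with \<open>Cop\<close> inserted.\<close>

lemma qsesq_eq:
  assumes f: "f \<in> L2 L" "coefE L f = S b" and h: "h \<in> L2 L" "coefE L h = S b'"
  shows "qsesq L \<Omega> s lam mu a f h = cin (G b) b'"
proof -
  have "hs_inner L s f h = (\<Sum>\<^sub>\<infinity>k. complex_of_real (1 / lam) * (nth2 b k * cnj (nth2 b' k)))"
    unfolding hs_inner_def
  proof (rule infsum_cong)
    fix k
    have "coef L f k = complex_of_real (sm k) * nth2 b k" "coef L h k = complex_of_real (sm k) * nth2 b' k"
      using nth2_coefE[OF L f(1), of k] nth2_coefE[OF L h(1), of k] f(2) h(2) by simp_all
    moreover have "(sm k)\<^sup>2 * (1 + (sqnorm k / (2*L) ^ CARD('d)) ^ s) = 1 / lam"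
      using lam wt_pos[of k] unfolding sm_sq wt_def V_def by (simp add: zero_less_mult_iff)
    then have "complex_of_real (sm k) * complex_of_real (sm k) * complex_of_real (1 + (sqnorm k / (2*L) ^ CARD('d)) ^ s)
        = complex_of_real (1 / lam)"
      by (metis of_real_mult power2_eq_square)
    ultimately show "coef L f k * cnj (coef L h k) * complex_of_real (1 + (sqnorm k / (2*L) ^ CARD('d)) ^ s)
        = complex_of_real (1 / lam) * (nth2 b k * cnj (nth2 b' k))"
      by (simp add: mult_ac)
  qed
  also have "\<dots> = complex_of_real (1 / lam) * cin b b'"
    unfolding cin_def by (rule infsum_cmult_right) (simp add: cin_summable)
  finally have 1: "complex_of_real lam * hs_inner L s f h = cin b b'"
    using lam by simp
  have "(LINT x:\<Omega>|lebesgue. Dop L s a f x * cnj (Dop L s a h x)) = ip L (Cop \<Omega> (Dop L s a f)) (Dop L s a h)"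
    unfolding ip_def set_lebesgue_integral_def Cop_def
    using \<Omega>_sub_sqbox by (intro Bochner_Integration.integral_cong) (auto simp: indicator_def)
  also have "\<dots> = cin (Cell L \<Omega> (E b)) (E b')"
    using cin_Cell_coefE[OF L \<Omega>] Dop_coefE[OF f] Dop_coefE[OF h] by metis
  also have "\<dots> = cin (E' (Cell L \<Omega> (E b))) b'"
    by (simp add: E_adj)
  finally show ?thesis
    unfolding qsesq_def by (simp add: 1 G_apply cin_add_left)
qed

text \<open>\<open>SOME\<close> may return any solution, so existence is not enough: every solution
  is shown to have the same coefficients.\<close>

lemma Minv_coefE:
  assumes g: "g \<in> L2 L"
  shows "Minv L \<Omega> s lam mu a g \<in> L2 L"
    and "coefE L (Minv L \<Omega> s lam mu a g) = S (binv G (S (coefE L g)))"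
proof -
  let ?Q = "\<lambda>f. f \<in> Hs L s \<and> (\<forall>h\<in>Hs L s. qsesq L \<Omega> s lam mu a f h = ip L g h)"
  have ipS: "ip L g h = cin (S (coefE L g)) b'" if "h \<in> L2 L" "coefE L h = S b'" for h b'
    using that by (simp add: Parseval L g S_sa)
  obtain f where f: "f \<in> L2 L" "coefE L f = S (binv G (S (coefE L g)))"
    using coefE_surj[OF L] by blast
  have "?Q f"
  proof (intro conjI ballI)
    show "f \<in> Hs L s" using f by (rule range_S_imp_Hs)
    fix h :: "real^'d \<Rightarrow> complex" assume h: "h \<in> Hs L s"
    then obtain b' where b': "coefE L h = S b'"
      using Hs_imp_range_S by blast
    have hL2: "h \<in> L2 L" using h by (simp add: Hs_def)
    show "qsesq L \<Omega> s lam mu a f h = ip L g h"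
      by (simp add: qsesq_eq[OF f hL2 b'] ipS[OF hL2 b'] binv_right[OF G_coercive])
  qed
  then have Q: "?Q (Minv L \<Omega> s lam mu a g)"
    unfolding Minv_def by (rule someI[of ?Q])
  let ?u = "Minv L \<Omega> s lam mu a g"
  show u: "?u \<in> L2 L" using Q by (simp add: Hs_def)
  obtain b where b: "coefE L ?u = S b"
    using Q Hs_imp_range_S by blast
  \<comment> \<open>Every \<open>S b'\<close> is the coefficient family of a test function, so the
    variational equation determines \<open>G b\<close>.\<close>
  have "cin (G b) b' = cin (S (coefE L g)) b'" for b'
  proof -
    obtain h where h: "h \<in> L2 L" "coefE L h = S b'"
      using coefE_surj[OF L] by blast
    show ?thesis
      using Q range_S_imp_Hs[OF h] qsesq_eq[OF u b h] ipS[OF h] by simp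
  qed
  then have "G b = S (coefE L g)" by (rule cin_right_eqI)
  then show "coefE L ?u = S (binv G (S (coefE L g)))"
    using b binv_left[OF G_coercive, of b] by simp
qed

lemma Hm_coefE:
  assumes "f \<in> Hm L m"
  shows "f \<in> L2 L" "\<exists>b. coefE L f = S b \<and> P m b = b"
proof -
  obtain c where c: "f = (\<lambda>x. \<Sum>k\<in>Km m. c k * phi L k x)"
    using assms by (auto simp: Hm_def)
  show f: "f \<in> L2 L" unfolding c by (rule phi_sum_L2)
  define b where "b = (\<lambda>k. if k \<in> Km m then c k / complex_of_real (sm k) else 0)"
  have "(\<lambda>k. (cmod (b k))\<^sup>2) summable_on UNIV"
    by (rule finite_nonzero_values_imp_summable_on) (rule finite_subset[OF _ finite_Km[of m]], auto simp: b_def)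
  then have nb: "nth2 (Abs_ell2 b) = b" by (rule nth2_Abs)
  have "coef L f k = (if k \<in> Km m then c k else 0)" for k
    unfolding c by (rule coef_phi_sum[OF L finite_Km])
  then have "coefE L f = S (Abs_ell2 b)"
    using sm_pos by (intro ell2_eqI) (simp add: L f nb, simp add: b_def less_imp_neq[symmetric])
  moreover have "P m (Abs_ell2 b) = Abs_ell2 b"
    by (rule ell2_eqI) (simp add: nb, simp add: b_def)
  ultimately show "\<exists>b. coefE L f = S b \<and> P m b = b" by blast
qed

lemma Hm_surj:
  obtains f where "f \<in> Hm L m" "coefE L f = S (P m b)"
proof
  let ?f = "\<lambda>x. \<Sum>k\<in>Km m. nth2 (S b) k * phi L k x"
  show "?f \<in> Hm L m" by (auto simp: Hm_def)
  show "coefE L ?f = S (P m b)"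
    by (rule coefE_eqI[OF L phi_sum_L2]) (simp add: coef_phi_sum[OF L finite_Km])
qed

text \<open>The Galerkin equations test \<open>G b\<close> only against the range of
  \<open>P m\<close>, where \<open>G\<close> and \<open>Gm m\<close> have the same form.\<close>

lemma Gm_on_range:
  assumes "P m b = b"
  shows "cin (G b) (P m b') = cin (Gm m b) b'"
  using assms by (simp add: G_apply Gm_apply cin_add_left P_sa flip: P_sa[of m b b'])

lemma Mminv_coefE:
  assumes g: "g \<in> L2 L"
  shows "Mminv L \<Omega> s lam mu a m g \<in> L2 L"
    and "coefE L (Mminv L \<Omega> s lam mu a m g) = P m (S (binv (Gm m) (S (P m (coefE L g)))))"
proof -
  let ?Q = "\<lambda>f. f \<in> Hm L m \<and> (\<forall>h\<in>Hm L m. qsesq L \<Omega> s lam mu a f h = ip L (Proj L m g) h)"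
  define y where "y = S (P m (coefE L g))"
  have Py: "P m y = y" by (simp add: y_def P_S)
  have ipS: "ip L (Proj L m g) h = cin y b'" if "h \<in> L2 L" "coefE L h = S b'" for h b'
    using that by (simp add: Parseval L g Proj_L2 coefE_Proj S_sa y_def P_def)
  define b where "b = binv (Gm m) y"
  have Gb: "Gm m b = y" by (simp add: b_def binv_right[OF Gm_coercive])
  \<comment> \<open>\<open>Gm m\<close> is the identity modulo the range of \<open>P m\<close>, so a
    right-hand side in that range has its solution there.\<close>
  have Pb: "P m b = b"
  proof -
    have "b = y - mu *\<^sub>R P m (E' (Cell L \<Omega> (E (P m b))))"
      using Gb by (simp add: Gm_apply algebra_simps)
    then show ?thesis
      by (metis P_P Py blinfun.diff_right blinfun.scaleR_right)
  qed
  obtain f where f: "f \<in> Hm L m" "coefE L f = S b"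
    using Hm_surj[of m b] Pb by metis
  have "?Q f"
  proof (intro conjI ballI f(1))
    fix h :: "real^'d \<Rightarrow> complex" assume "h \<in> Hm L m"
    then obtain b' where h: "h \<in> L2 L" "coefE L h = S b'" "P m b' = b'"
      using Hm_coefE by blast
    have "qsesq L \<Omega> s lam mu a f h = cin (G b) (P m b')"
      using qsesq_eq[OF Hm_coefE(1)[OF f(1)] f(2) h(1,2)] h(3) by simp
    then show "qsesq L \<Omega> s lam mu a f h = ip L (Proj L m g) h"
      by (simp add: Gm_on_range[OF Pb] Gb ipS[OF h(1,2)])
  qed
  define u where "u = (SOME f. ?Q f)"
  have Q: "?Q u"
    unfolding u_def using \<open>?Q f\<close> by (rule someI[of ?Q])
  have u: "u \<in> L2 L" using Q Hm_coefE(1) by blast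
  obtain d where d: "coefE L u = S d" "P m d = d"
    using Q Hm_coefE(2) by blast
  \<comment> \<open>The equations hold only for test vectors in the range of \<open>P m\<close>, but
    \<open>Gm m d\<close> and \<open>y\<close> lie in that range, so arbitrary \<open>b'\<close> may
    be used.\<close>
  have "cin (Gm m d) b' = cin y b'" for b'
  proof -
    obtain h where h: "h \<in> Hm L m" "coefE L h = S (P m b')"
      using Hm_surj by blast
    have "cin (G d) (P m b') = cin y (P m b')"
      using Q h(1) qsesq_eq[OF u d(1) Hm_coefE(1)[OF h(1)] h(2)] ipS[OF Hm_coefE(1)[OF h(1)] h(2)]
      by simp
    then show ?thesis
      using P_sa[of m y b'] by (simp add: Gm_on_range[OF d(2)] Py)
  qed
  then have "Gm m d = y" by (rule cin_right_eqI)
  then have "d = binv (Gm m) y"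
    using binv_left[OF Gm_coercive, of m d] by simp
  moreover have M: "Mminv L \<Omega> s lam mu a m g = Proj L m u"
    by (simp add: Mminv_def u_def)
  ultimately show "coefE L (Mminv L \<Omega> s lam mu a m g) = P m (S (binv (Gm m) (S (P m (coefE L g)))))"
    by (simp add: coefE_Proj L u d(1) y_def P_def)
  show "Mminv L \<Omega> s lam mu a m g \<in> L2 L"
    by (simp add: M Proj_L2)
qed

section \<open>Identification of both operators and uniform decay of eigenvalues\<close>

lemma sdown_T: "sdown L (Cop \<Omega> \<circ> Minv L \<Omega> s lam mu a \<circ> Cop \<Omega>) k = sval Top k"
proof (rule sdown_eq_sval[OF L])
  fix f :: "real^'d \<Rightarrow> complex" assume f: "f \<in> L2 L"
  then have "Cop \<Omega> f \<in> L2 L" by (rule Cop_L2[OF \<Omega>])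
  note M = Minv_coefE[OF this]
  show "(Cop \<Omega> \<circ> Minv L \<Omega> s lam mu a \<circ> Cop \<Omega>) f \<in> L2 L"
    using M(1) by (simp add: Cop_L2 \<Omega>)
  show "coefE L ((Cop \<Omega> \<circ> Minv L \<Omega> s lam mu a \<circ> Cop \<Omega>) f) = Top (coefE L f)"
    using M f by (simp add: Top_def flip: Cell_coefE(1)[OF L \<Omega>])
qed

lemma Cm_coefE:
  assumes "f \<in> L2 L"
  shows "Cm L \<Omega> m f \<in> L2 L" "coefE L (Cm L \<Omega> m f) = Cn m (coefE L f)"
proof -
  have 1: "Cop \<Omega> (Proj L m f) \<in> L2 L"
    by (intro Cop_L2 \<Omega> Proj_L2)
  show "Cm L \<Omega> m f \<in> L2 L"
    by (simp add: Cm_def Proj_L2)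
  show "coefE L (Cm L \<Omega> m f) = Cn m (coefE L f)"
    by (simp add: Cm_def Cn_def P_def coefE_Proj L 1 assms Proj_L2 flip: Cell_coefE(1)[OF L \<Omega>])
qed

text \<open>The projections carried by \<open>Mminv\<close> are absorbed by the adjacent
  \<open>Cn m\<close>, so \<open>Tn\<close> needs none of its own.\<close>

lemma Cn_P [simp]: "Cn m (P m x) = Cn m x" "P m (Cn m x) = Cn m x"
  by (simp_all add: Cn_def)

lemma sdown_Tm: "sdown L (Cm L \<Omega> m \<circ> Mminv L \<Omega> s lam mu a m \<circ> Cm L \<Omega> m) k = sval (Tn m) k"
proof (rule sdown_eq_sval[OF L])
  fix f :: "real^'d \<Rightarrow> complex" assume f: "f \<in> L2 L"
  note M = Mminv_coefE[OF Cm_coefE(1)[OF f, of m], of m]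
  show "(Cm L \<Omega> m \<circ> Mminv L \<Omega> s lam mu a m \<circ> Cm L \<Omega> m) f \<in> L2 L"
    using M(1) by (simp add: Cm_coefE)
  show "coefE L ((Cm L \<Omega> m \<circ> Mminv L \<Omega> s lam mu a m \<circ> Cm L \<Omega> m) f) = Tn m (coefE L f)"
    using M f by (simp add: Tn_def Cm_coefE)
qed

text \<open>The exponent exceeds 1 in modulus exactly because \<open>s > d/2\<close>. The term
  \<open>\<kappa>\<^sup>2 * 9 ^ s\<close> serves \<open>k > 0\<close>, and \<open>1 / lam\<close>
  covers the first eigenvalue, for which no frequency can be discarded.\<close>

definition \<beta> :: "nat \<Rightarrow> real" where
  "\<beta> k = (\<kappa>\<^sup>2 * 9 ^ s + 1 / lam) * real (Suc k) powr (- (2 * real s / real CARD('d)))"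

lemma summable_\<beta>: "summable \<beta>"
proof -
  have "2 * real s / real CARD('d) > 1"
    using s by (simp add: field_simps)
  then have "summable (\<lambda>n. real n powr (- (2 * real s / real CARD('d))))"
    by (subst summable_real_powr_iff) simp
  then have "summable (\<lambda>k. real (Suc k) powr (- (2 * real s / real CARD('d))))"
    by (subst summable_Suc_iff)
  then show ?thesis
    unfolding \<beta>_def by (rule summable_mult)
qed

text \<open>At most \<open>(2m+1)\<^sup>d\<close> frequencies lie in \<open>Km m\<close> and outside the weight is \<open>O((m+1)\<^sup>-\<^sup>2\<^sup>s)\<close>.\<close>

lemma sval_le_\<beta>: "sval Top (Suc k) \<le> \<beta> k" "sval (Tn n) (Suc k) \<le> \<beta> k"
proof -
  define N where "N = Suc k"
  define d where "d = CARD('d)"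
  have d: "d \<ge> 1" by (simp add: d_def Suc_leI)
  have "\<exists>b F. finite F \<and> card F < N \<and> (\<forall>i. i \<notin> F \<longrightarrow> \<bar>sm i\<bar> \<le> b) \<and> 0 \<le> b \<and> b\<^sup>2 \<le> \<beta> k"
  proof (cases "k = 0")
    case True
    have "(1 / sqrt lam)\<^sup>2 \<le> \<beta> k"
      using True lam \<kappa>_pos by (simp add: \<beta>_def power_divide)
    then show ?thesis
      using sm_le lam by (intro exI[of _ "1 / sqrt lam"] exI[of _ "{}"]) (auto simp: N_def)
  next
    case False
    have "N \<le> (2 * N + 1) ^ d"
      using d power_increasing[of 1 d "2 * N + 1"] by simp
    then have ex: "\<exists>n. N \<le> (2 * n + 1) ^ d" by blast
    \<comment> \<open>The predecessor \<open>m\<close> of the least such \<open>n\<close> gives the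
      largest box with fewer than \<open>N\<close> frequencies, as the multiplier bound demands,
      while \<open>n\<close> still controls \<open>N\<close> from above.\<close>
    define n where "n = (LEAST n. N \<le> (2 * n + 1) ^ d)"
    have n: "N \<le> (2 * n + 1) ^ d"
      unfolding n_def using ex by (rule LeastI_ex)
    have "n \<noteq> 0"
    proof
      assume "n = 0"
      then show False using n False by (simp add: N_def)
    qed
    then obtain m where m: "n = Suc m" by (cases n) auto
    have small: "(2 * m + 1) ^ d < N"
      using not_less_Least[of m "\<lambda>n. N \<le> (2 * n + 1) ^ d"] m by (simp add: n_def)
    let ?b = "\<kappa> / real (m + 1) ^ s"
    have "?b\<^sup>2 \<le> \<kappa>\<^sup>2 * 9 ^ s * real N powr (- (2 * real s / real d))"
    proof -
      have "real N \<le> real ((2 * n + 1) ^ d)"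
        using n by (simp only: of_nat_le_iff)
      \<comment> \<open>Since \<open>n = m + 1\<close>, one has
        \<open>2*n + 1 = 2*m + 3 \<le> 3 * (m + 1)\<close>; the power \<open>2*s\<close> of 3 is the
        source of \<open>9 ^ s\<close>.\<close>
      also have "\<dots> \<le> (3 * real (m + 1)) ^ d"
        unfolding of_nat_power by (intro power_mono) (auto simp: m)
      finally have "real N powr (2 * real s / real d) \<le> ((3 * real (m + 1)) ^ d) powr (2 * real s / real d)"
        by (intro powr_mono2) auto
      also have "\<dots> = (3 * real (m + 1)) powr (real d * (2 * real s / real d))"
        by (subst powr_realpow[symmetric]) (auto simp: powr_powr)
      also have "real d * (2 * real s / real d) = real (2 * s)"
        using d by simp
      also have "(3 * real (m + 1)) powr real (2 * s) = (3 * real (m + 1)) ^ (2 * s)"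
        by (rule powr_realpow) simp
      also have "\<dots> = 9 ^ s * (real (m + 1) ^ s)\<^sup>2"
      proof -
        have nine: "(9 :: real) = 3\<^sup>2" by simp
        show ?thesis
          unfolding nine by (simp only: power_mult_distrib power_mult[symmetric] mult.commute[of s 2])
      qed
      finally have *: "real N powr (2 * real s / real d) \<le> 9 ^ s * (real (m + 1) ^ s)\<^sup>2" .
      have "?b\<^sup>2 = \<kappa>\<^sup>2 * 9 ^ s / (9 ^ s * (real (m + 1) ^ s)\<^sup>2)"
        by (simp add: power_divide)
      also have "\<dots> \<le> \<kappa>\<^sup>2 * 9 ^ s / real N powr (2 * real s / real d)"
        using * by (intro divide_left_mono) (auto simp: N_def)
      finally show ?thesis
        by (simp only: powr_minus_divide) simp
    qed
    also have "\<dots> \<le> \<beta> k"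
      unfolding \<beta>_def N_def d_def using lam by (intro mult_right_mono) auto
    finally have "?b\<^sup>2 \<le> \<beta> k" .
    moreover have "card (Km m :: (int^'d) set) < N"
      using small by (simp add: card_Km d_def)
    ultimately show ?thesis
      using sm_tail_bound[of _ m] \<kappa>_pos
      by (intro exI[of _ ?b] exI[of _ "Km m"]) (auto simp: finite_Km)
  qed
  then obtain b F where "finite F" "card F < Suc k" "\<And>i. i \<notin> F \<Longrightarrow> \<bar>sm i\<bar> \<le> b" "0 \<le> b" "b\<^sup>2 \<le> \<beta> k"
    unfolding N_def by blast
  then show "sval Top (Suc k) \<le> \<beta> k" "sval (Tn n) (Suc k) \<le> \<beta> k"
    using sval_Top_Tn_le[of "Suc k" F b] order_trans by (metis One_nat_def Suc_le_mono le0)+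
qed

lemma norm_sval_le_\<beta>:
  "norm (sval Top (Suc k) / (1 + sval Top (Suc k))) \<le> \<beta> k"
  "norm (sval (Tn n) (Suc k) / (1 + sval (Tn n) (Suc k))) \<le> \<beta> k"
  by (intro norm_div_one_plus_le sval_nonneg sval_le_\<beta> Top_compact_positive Tn_compact_positive; simp)+

text \<open>The series run over \<open>Suc k\<close> since eigenvalues are numbered from 1. As
  \<open>x / (1 + x) \<le> x\<close> for nonnegative \<open>x\<close>, the sequence
  \<open>\<beta>\<close> dominates all of them at once, and Tannery's theorem exchanges limit and
  sum.\<close>

lemma sval_effective_dimension_tendsto:
  "(\<forall>n. summable (\<lambda>k. sval (Tn n) (Suc k) / (1 + sval (Tn n) (Suc k))))
   \<and> summable (\<lambda>k. sval Top (Suc k) / (1 + sval Top (Suc k)))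
   \<and> (\<lambda>n. \<Sum>k. sval (Tn n) (Suc k) / (1 + sval (Tn n) (Suc k)))
        \<longlonglongrightarrow> (\<Sum>k. sval Top (Suc k) / (1 + sval Top (Suc k)))
   \<and> (\<forall>k\<ge>1. (\<lambda>n. sval (Tn n) k) \<longlonglongrightarrow> sval Top k)"
proof (intro conjI allI impI)
  show "summable (\<lambda>k. sval (Tn n) (Suc k) / (1 + sval (Tn n) (Suc k)))" for n
    by (rule summable_comparison_test[OF _ summable_\<beta>]) (use norm_sval_le_\<beta> in blast)
  show "summable (\<lambda>k. sval Top (Suc k) / (1 + sval Top (Suc k)))"
    by (rule summable_comparison_test[OF _ summable_\<beta>]) (use norm_sval_le_\<beta> in blast)
  show "(\<lambda>n. sval (Tn n) k) \<longlonglongrightarrow> sval Top k" if "k \<ge> 1" for k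
    using that by (rule sval_Tn_tendsto)
  show "(\<lambda>n. \<Sum>k. sval (Tn n) (Suc k) / (1 + sval (Tn n) (Suc k)))
        \<longlonglongrightarrow> (\<Sum>k. sval Top (Suc k) / (1 + sval Top (Suc k)))"
  proof (rule tannerys_theorem[THEN conjunct2, THEN conjunct2, OF _ _ summable_\<beta>])
    show "(\<lambda>n. sval (Tn n) (Suc k) / (1 + sval (Tn n) (Suc k))) \<longlonglongrightarrow> sval Top (Suc k) / (1 + sval Top (Suc k))" for k
      using sval_nonneg[OF Top_compact_positive, of "Suc k"]
      by (intro tendsto_intros sval_Tn_tendsto) auto
    show "\<forall>\<^sub>F (k, n) in sequentially \<times>\<^sub>F sequentially. norm (sval (Tn n) (Suc k) / (1 + sval (Tn n) (Suc k))) \<le> \<beta> k"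
      using norm_sval_le_\<beta>(2) by (auto intro!: always_eventually)
  qed simp
qed

end

theorem theorem1:
  fixes L :: real and \<Omega> :: "(real^'d) set" and s :: nat and lam mu :: real
    and a :: "('d \<Rightarrow> nat) \<Rightarrow> real"
  assumes "L > 0" and "\<Omega> \<in> sets lebesgue" and "\<Omega> \<subseteq> cube L"
    and "real s > real CARD('d) / 2" and "lam > 0" and "mu \<ge> 0"
  defines "T \<equiv> Cop \<Omega> \<circ> Minv L \<Omega> s lam mu a \<circ> Cop \<Omega>"
    and "Tm \<equiv> \<lambda>m. Cm L \<Omega> m \<circ> Mminv L \<Omega> s lam mu a m \<circ> Cm L \<Omega> m"
  shows "(\<forall>m\<ge>1. summable (\<lambda>k. sdown L (Tm m) (Suc k) / (1 + sdown L (Tm m) (Suc k))))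
     \<and> summable (\<lambda>k. sdown L T (Suc k) / (1 + sdown L T (Suc k)))
     \<and> (\<lambda>m. \<Sum>k. sdown L (Tm m) (Suc k) / (1 + sdown L (Tm m) (Suc k)))
          \<longlonglongrightarrow> (\<Sum>k. sdown L T (Suc k) / (1 + sdown L T (Suc k)))
     \<and> (\<forall>k\<ge>1. (\<lambda>m. sdown L (Tm m) k) \<longlonglongrightarrow> sdown L T k)"
proof -
  interpret sobolev L \<Omega> s lam mu a
    by unfold_locales (use assms in auto)
  show ?thesis
    using sval_effective_dimension_tendsto unfolding T_def Tm_def sdown_T sdown_Tm by blast
qed

end
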